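(* Let $\mathcal A$ be a finite or countable alphabet, $X=\mathcal A^{\mathbb N}$, $T:X\to X$ the shift, and let $g(x)=g_0\prod_{i=1}^\infty g_i(x_i)$ be an $\ell_1$-bounded, summable potential function of product type. Put $$\lambda=g_0\sum_{a\in\mathcal A}\prod_{k=1}^\infty g_k(a),\qquad \tilde g(x)=\frac{\prod_{i=1}^\infty g_i(x_1)}{\sum_{a\in\mathcal A}\prod_{i=1}^\infty g_i(a)}.$$ Let $\mu=\otimes_{n=1}^\infty\mu_n$ be the measure of product type and $\tilde\mu$ the (stationary) Bernoulli measure with weights $\{\tilde\mu_0(a):a\in\mathcal A\}$, where $$\mu_n(a)=\frac{\prod_{i=1}^n g_i(a)}{\sum_{b\in\mathcal A}\prod_{i=1}^n g_i(b)},\qquad \tilde\mu_0(a)=\frac{\prod_{i=1}^\infty g_i(a)}{\sum_{b\in\mathcal A}\prod_{i=1}^\infty g_i(b)}.$$ (1) We have $\mathcal L_{\log g}^*(\mu)=\lambda\mu$, $\mathcal L_{\log\tilde g}^*(\tilde\mu)=\tilde\mu$, $\log\lambda=P(\log g)$ and $$P(\log g)=h_{\tilde\mu}(T)+\int\log g\,d\tilde\mu .$$ If $\mathcal A$ is finite, then $\tilde\mu$ is an equilibrium state for $\log g$. (2) If $g$ is in balanced form, $\mathcal A$ is finite and, for some $k>1$, $$\sum_{i=k}^\infty\sup_{a\in\mathcal A}\Big(\sum_{j=i}^\infty\log g_j(a)\Big)^2<\infty,$$ then $h(x)=\prod_{i=1}^\infty h_i(x_i)$, with $h_i(a)=\prod_{k>i}g_k(a)$,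 exists for almost every $x\in X$ with respect to the $(1/|\mathcal A|,\ldots,1/|\mathcal A|)$-Bernoulli measure on $X$. Furthermore, $\mathcal L_{\log g}(h)=\lambda h$.
   Context: $X=\mathcal A^{\mathbb N}$ carries the product topology and its Borel $\sigma$-algebra; $T(x_1,x_2,\ldots)=(x_2,x_3,\ldots)$; $[a_1,\ldots,a_n]=\{x\in X:x_i=a_i,\ 1\le i\le n\}$. A function $g:X\to(0,\infty)$ is of product type if $g(x)=g_0\prod_{i\ge1}g_i(x_i)$ with a constant $g_0>0$ and $g_i:\mathcal A\to(0,\infty)$ such that $\sum_i\log g_i(x_i)$ converges for all $x$. It is $\ell_1$-bounded if $\sum_{k=2}^\infty\|\log g_k\|_\infty<\infty$, summable if $\sum_{a\in\mathcal A}g_1(a)<\infty$, and in balanced form if $\prod_{a\in\mathcal A}g_i(a)=1$ for all $i\ge1$. Ruelle operator: $\mathcal L_f\phi(x)=\sum_{T(y)=x}\phi(y)e^{f(y)}$. Its dual $\mathcal L_{\log g}^*$ acts on finite signed Borel measures by $\int\phi\,d\mathcal L^*_{\log g}\mu=\int\mathcal L_{\log g}(\phi)\,d\mu$ for bounded continuous $\phi$. Pressure: $P(\log g)=\lim_{n\to\infty}\frac1n\log\sum_{a\in\mathcal A^n}\sup_{x\in[a]}\prod_{i=0}^{n-1}g(T^i(x))$. $h_m(T)$ denotes the Kolmogorov–Sinai entropy of a $T$-invariant probability measure $m$. For finite $\mathcal A$ and continuous $\log g$, the variational principle $P(\log g)=\sup_m\{h_m(T)+\int\log g\,dm\}$ (sup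 over $T$-invariant Borel probabilities) holds, and an equilibrium state is an invariant probability measure attaining the supremum. A measure of product type is a product $\otimes_i\mu_i$ of probability measures $\mu_i$ on $\mathcal A$ (with $\mu_i(a)=\mu_i(\{a\})$); the Bernoulli measure with weights $\{p(a)\}$ is the product of identical factors with weights $p$.
   Formalization: For infinite alphabets the entropy of μ̃ can be ∞ while ∫log g dμ̃ = −∞, so their sum is undefined; P(log g) = h + ∫log g dμ̃ is stated when the sum is not ∞ − ∞, and h = P(log g) − ∫log g dμ̃ is stated in all cases. *)

theory Defs
  imports "HOL-Probability.Probability"
begin

text \<open>
  The alphabet is a type of sort {countable, discrete_topology}, so that the type
  nat => 'a carries the product topology and its Borel sigma-algebra.
  Coordinates are numbered from 0: the point (x_1, x_2, ...) is the function x with x i = x_(i+1),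
  and likewise G i is the factor g_(i+1) and weight n the weight function of mu_(n+1).
\<close>

definition shift_map :: "(nat \<Rightarrow> 'a) \<Rightarrow> nat \<Rightarrow> 'a" where
  "shift_map x = (\<lambda>i. x (Suc i))"

definition cylinder :: "'a list \<Rightarrow> (nat \<Rightarrow> 'a) set" where
  "cylinder w = {x. \<forall>i<length w. x i = w ! i}"


subsection \<open>Potentials of product type\<close>

definition product_type ::
  "((nat \<Rightarrow> 'a) \<Rightarrow> real) \<Rightarrow> real \<Rightarrow> (nat \<Rightarrow> 'a \<Rightarrow> real) \<Rightarrow> bool" where
  "product_type g g0 G \<longleftrightarrow>
     g0 > 0 \<and> (\<forall>i a. G i a > 0) \<and>
     (\<forall>x. summable (\<lambda>i. ln (G i (x i)))) \<and>
     (\<forall>x. g x = g0 * (\<Prod>i. G i (x i)))"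

text \<open>The first factor G 0 = g_1 is exempt from the boundedness condition.\<close>

definition l1_bounded :: "(nat \<Rightarrow> 'a \<Rightarrow> real) \<Rightarrow> bool" where
  "l1_bounded G \<longleftrightarrow>
     (\<forall>k\<ge>1. bdd_above (range (\<lambda>a. \<bar>ln (G k a)\<bar>))) \<and>
     summable (\<lambda>k. SUP a. \<bar>ln (G (Suc k) a)\<bar>)"

definition summable_potential :: "(nat \<Rightarrow> 'a \<Rightarrow> real) \<Rightarrow> bool" where
  "summable_potential G \<longleftrightarrow> G 0 summable_on UNIV"

text \<open>Only meaningful for a finite alphabet (a product over an infinite set is 1 by convention).\<close>

definition balanced :: "(nat \<Rightarrow> 'a \<Rightarrow> real) \<Rightarrow> bool" where
  "balanced G \<longleftrightarrow> (\<forall>i. (\<Prod>a\<in>UNIV. G i a) = 1)"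


subsection \<open>Measures of product type\<close>

definition product_type_measure :: "(nat \<Rightarrow> 'a \<Rightarrow> real) \<Rightarrow> (nat \<Rightarrow> 'a) measure" where
  "product_type_measure p = (\<Pi>\<^sub>M n\<in>UNIV. point_measure UNIV (\<lambda>a. ennreal (p n a)))"

definition bernoulli_measure :: "('a \<Rightarrow> real) \<Rightarrow> (nat \<Rightarrow> 'a) measure" where
  "bernoulli_measure p = product_type_measure (\<lambda>_. p)"


subsection \<open>The Ruelle operator and its dual\<close>

definition ruelle ::
  "((nat \<Rightarrow> 'a) \<Rightarrow> real) \<Rightarrow> ((nat \<Rightarrow> 'a) \<Rightarrow> real) \<Rightarrow> (nat \<Rightarrow> 'a) \<Rightarrow> real" where
  "ruelle f \<phi> x = (\<Sum>\<^sub>\<infinity>y\<in>{y. shift_map y = x}. \<phi> y * exp (f y))"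

text \<open>
  The image of a finite (nonnegative) Borel measure under the dual operator, as the unique finite
  Borel measure with the defining property. Summability and integrability are required explicitly,
  since infinite sums and integrals default to 0 otherwise.
\<close>

definition ruelle_dual ::
  "((nat \<Rightarrow> 'a::topological_space) \<Rightarrow> real) \<Rightarrow> (nat \<Rightarrow> 'a) measure \<Rightarrow> (nat \<Rightarrow> 'a) measure" where
  "ruelle_dual f \<mu> = (THE \<nu>. finite_measure \<nu> \<and> sets \<nu> = sets borel \<and>
     (\<forall>\<phi>. continuous_on UNIV \<phi> \<and> bounded (range \<phi>) \<longrightarrow>
        (\<forall>x. (\<lambda>y. \<phi> y * exp (f y)) summable_on {y. shift_map y = x}) \<and>
        integrable \<mu> (ruelle f \<phi>) \<and>
        (\<integral>x. \<phi> x \<partial>\<nu>) = (\<integral>x. ruelle f \<phi> x \<partial>\<mu>)))"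


subsection \<open>Pressure\<close>

definition partition_function :: "((nat \<Rightarrow> 'a) \<Rightarrow> real) \<Rightarrow> nat \<Rightarrow> ennreal" where
  "partition_function f n =
     (\<Sum>\<^sub>\<infinity>w\<in>{w. length w = n}. SUP x\<in>cylinder w. ennreal (\<Prod>i<n. exp (f ((shift_map ^^ i) x))))"

definition ln_ennreal :: "ennreal \<Rightarrow> ereal" where
  "ln_ennreal z = (if z = 0 then - \<infinity> else if z = \<infinity> then \<infinity> else ereal (ln (enn2real z)))"

definition pressure_seq :: "((nat \<Rightarrow> 'a) \<Rightarrow> real) \<Rightarrow> nat \<Rightarrow> ereal" where
  "pressure_seq f n = ereal (1 / real n) * ln_ennreal (partition_function f n)"

definition pressure :: "((nat \<Rightarrow> 'a) \<Rightarrow> real) \<Rightarrow> ereal" where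
  "pressure f = lim (pressure_seq f)"


subsection \<open>Kolmogorov--Sinai entropy and equilibrium states\<close>

text \<open>
  A finite measurable partition is represented by a labelling, i.e. a simple function into nat
  whose level sets are the atoms. The join of the first n preimages of the partition is then the
  partition labelled by itineraries of length n. Logarithms are natural.
\<close>

definition labelling_entropy :: "'x measure \<Rightarrow> ('x \<Rightarrow> 'l) \<Rightarrow> real" where
  "labelling_entropy m \<xi> = prob_space.entropy m (exp 1) (count_space (\<xi> ` space m)) \<xi>"

definition itinerary :: "('x \<Rightarrow> 'x) \<Rightarrow> ('x \<Rightarrow> 'l) \<Rightarrow> nat \<Rightarrow> 'x \<Rightarrow> 'l list" where
  "itinerary S \<xi> n x = map (\<lambda>i. \<xi> ((S ^^ i) x)) [0..<n]"

definition partition_ks_entropy :: "'x measure \<Rightarrow> ('x \<Rightarrow> 'x) \<Rightarrow> ('x \<Rightarrow> 'l) \<Rightarrow> real" where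
  "partition_ks_entropy m S \<xi> = lim (\<lambda>n. labelling_entropy m (itinerary S \<xi> n) / real n)"

definition ks_entropy :: "'x measure \<Rightarrow> ('x \<Rightarrow> 'x) \<Rightarrow> ereal" where
  "ks_entropy m S =
     (SUP \<xi>\<in>{\<xi> :: 'x \<Rightarrow> nat. simple_function m \<xi>}. ereal (partition_ks_entropy m S \<xi>))"

text \<open>Meaningful unless the integrals of the positive and of the negative part are both infinite.
  The logarithm of a summable potential is bounded above, but its integral can be -\<infinity>.\<close>

definition ext_integral :: "'x measure \<Rightarrow> ('x \<Rightarrow> real) \<Rightarrow> ereal" where
  "ext_integral m f =
     enn2ereal (\<integral>\<^sup>+x. ennreal (f x) \<partial>m) - enn2ereal (\<integral>\<^sup>+x. ennreal (- f x) \<partial>m)"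

definition invariant_probabilities :: "(nat \<Rightarrow> 'a::topological_space) measure set" where
  "invariant_probabilities = {m. prob_space m \<and> sets m = sets borel \<and> distr m m shift_map = m}"

definition equilibrium_state ::
  "((nat \<Rightarrow> 'a::topological_space) \<Rightarrow> real) \<Rightarrow> (nat \<Rightarrow> 'a) measure \<Rightarrow> bool" where
  "equilibrium_state f m \<longleftrightarrow> m \<in> invariant_probabilities \<and>
     ks_entropy m shift_map + ext_integral m f =
       (SUP m'\<in>invariant_probabilities. ks_entropy m' shift_map + ext_integral m' f)"

end

(*
  For the eigenmeasure, mu_i(a) g_(i+1)(a) = mu_(i+1)(a) Z_(i+1)/Z_i with Z_i the normalising sums, so
  on cylinders the dual Ruelle operator multiplies mu by g_0 Z_0 times the telescoping product of
  the Z_(i+1)/Z_i, which is lambda.  For the pressure, collecting the factors of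
  g(x) g(Tx) ... g(T^(n-1)x) site by site gives the product of the g_0 prod_i g_i(x_k) up to
  a factor exp(o(n)), and summing over words gives lambda^n.  For the same reason log g is
  cohomologous, as far as invariant measures can see, to log lambda + log mu~_0(x_1); hence the variational
  statements reduce to h_m <= - integral of log p(x_1) dm for every positive weight vector p, with
  equality for the Bernoulli measure with weights p.  In part (2), balancedness makes the log h_i(x_i)
  centred and independent, so Kolmogorov's one-series theorem applies, and the eigenvalue
  equation is the telescoping identity h_i(a) g_i(a) = h_(i-1)(a).
*)
theory Submission
  imports Defs
begin

section \<open>Cylinders and product measures\<close>

text \<open>The entropy is a supremum over all finite measurable labellings, and the itineraries of
  a general labelling bear no relation to cylinders. For h_m <= - integral of log p(x_1) dm, a
  labelling is therefore replaced by one that reads finitely many coordinates, and the law of a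
  noisy itinerary of the latter under the Bernoulli measure serves as comparison weight in Gibbs'
  inequality; the noise keeps the logarithm finite where the two labellings disagree. In the other
  direction an infinite alphabet has no finite partition into letters, so all but finitely many
  letters are lumped together and the cut-off is removed by monotone convergence. The integral of
  log g may be -infinity. The correction to the one-site potential is bounded and of mean zero,
  which allows the positive and the negative part to be treated separately. The o(n) in the pressure
  is a sum of tails of the l1-bound, small after division by n as a Cesaro mean. The dual operator
  is a definite description, so each eigenmeasure identity contains a uniqueness claim; indicators
  of cylinders are continuous, and they are enough test functions to settle it.\<close>

lemma mem_cylinder_iff: "x \<in> cylinder w \<longleftrightarrow> (\<forall>i<length w. x i = w ! i)"
  by (simp add: cylinder_def)

lemma cylinder_Nil [simp]: "cylinder [] = UNIV"
  by (auto simp: cylinder_def)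

lemma cylinder_eq_PiE: "cylinder w = (\<Pi>\<^sub>E i\<in>UNIV. if i < length w then {w ! i} else UNIV)"
  by (auto simp: cylinder_def PiE_iff split: if_splits)

lemma open_cylinder: "open (cylinder w :: (nat \<Rightarrow> 'a::discrete_topology) set)"
proof -
  have "finite {i. (if i < length w then {w ! i} else UNIV) \<noteq> UNIV}"
    by (rule finite_subset[of _ "{..<length w}"]) auto
  then show ?thesis
    unfolding cylinder_eq_PiE
    by (intro open_PiE discrete_topology_class.open_discrete) auto
qed

text \<open>Words of one fixed length partition the space, so cylinders are clopen. This is what
  makes their indicators continuous, hence admissible test functions for
  \<open>ruelle_dual\<close>.\<close>

lemma compl_cylinder: "- cylinder w = (\<Union>v\<in>{v. length v = length w \<and> v \<noteq> w}. cylinder v)"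
proof (intro set_eqI iffI)
  fix x assume "x \<in> - cylinder w"
  then obtain i where i: "i < length w" "x i \<noteq> w ! i" by (auto simp: cylinder_def)
  then have "map x [0..<length w] ! i \<noteq> w ! i" by simp
  then have "map x [0..<length w] \<noteq> w" by metis
  then show "x \<in> (\<Union>v\<in>{v. length v = length w \<and> v \<noteq> w}. cylinder v)"
    by (intro UN_I[of "map x [0..<length w]"]) (auto simp: cylinder_def)
next
  fix x assume "x \<in> (\<Union>v\<in>{v. length v = length w \<and> v \<noteq> w}. cylinder v)"
  then show "x \<in> - cylinder w"
    by (auto simp: cylinder_def) (metis nth_equalityI)
qed

lemma continuous_on_indicator_cylinder:
  "continuous_on UNIV (indicator (cylinder w :: (nat \<Rightarrow> 'a::discrete_topology) set) :: _ \<Rightarrow> real)"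
proof -
  have "closed (cylinder w :: (nat \<Rightarrow> 'a) set)"
    unfolding closed_def compl_cylinder by (intro open_UN ballI open_cylinder)
  then have "continuous_on (cylinder w \<union> - cylinder w)
      (\<lambda>x. if x \<in> cylinder w then 1 else 0 :: real)"
    by (intro continuous_on_If) (auto simp: open_closed[symmetric] open_cylinder continuous_on_const)
  then show ?thesis
    by (simp add: indicator_def of_bool_def)
qed

lemma open_contains_cylinder:
  fixes U :: "(nat \<Rightarrow> 'a::discrete_topology) set"
  assumes "open U" "x \<in> U"
  obtains n where "cylinder (map x [0..<n]) \<subseteq> U"
proof -
  have "openin (product_topology (\<lambda>i. euclidean) UNIV) U" using assms unfolding open_fun_def by simp
  from product_topology_open_contains_basis[OF this assms(2)]
  obtain X where X: "x \<in> (\<Pi>\<^sub>E i\<in>UNIV. X i)" "finite {i. X i \<noteq> UNIV}" "(\<Pi>\<^sub>E i\<in>UNIV. X i) \<subseteq> U"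
    by auto
  obtain n where n: "\<And>i. X i \<noteq> UNIV \<Longrightarrow> i < n"
    using X(2) by (metis (mono_tags, lifting) finite_nat_set_iff_bounded mem_Collect_eq)
  have "cylinder (map x [0..<n]) \<subseteq> (\<Pi>\<^sub>E i\<in>UNIV. X i)"
  proof
    fix y assume y: "y \<in> cylinder (map x [0..<n])"
    have "y i \<in> X i" for i
      using n[of i] X(1) y by (cases "X i = UNIV") (auto simp: cylinder_def PiE_iff)
    then show "y \<in> (\<Pi>\<^sub>E i\<in>UNIV. X i)" by (simp add: PiE_iff)
  qed
  from this X(3) show ?thesis by (rule that[OF subset_trans])
qed

lemma cylinder_Int:
  assumes "length u \<le> length v"
  shows "cylinder u \<inter> cylinder v = (if take (length u) v = u then cylinder v else {})"
proof (cases "take (length u) v = u")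
  case True
  have "v ! i = u ! i" if "i < length u" for i using True that by (metis nth_take)
  then show ?thesis using True assms by (auto simp: cylinder_def)
next
  case False
  have "\<exists>i<length u. v ! i \<noteq> u ! i"
  proof (rule ccontr)
    assume "\<not> (\<exists>i<length u. v ! i \<noteq> u ! i)"
    then have "take (length u) v = u" using assms by (auto intro: nth_equalityI)
    with False show False by simp
  qed
  then show ?thesis using False assms by (auto simp: cylinder_def) 
qed

text \<open>Of two cylinders either one contains the other or they are disjoint; the second case is
  why the empty set joins the generator.\<close>

lemma Int_stable_cylinders: "Int_stable (insert {} (range cylinder))"
proof (rule Int_stableI)
  fix a b :: "(nat \<Rightarrow> 'a) set"
  assume "a \<in> insert {} (range cylinder)" "b \<in> insert {} (range cylinder)"
  moreover have "cylinder u \<inter> cylinder v \<in> insert {} (range cylinder)" for u v :: "'a list"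
  proof (cases "length u \<le> length v")
    case True
    then show ?thesis by (auto simp: cylinder_Int)
  next
    case False
    then have "cylinder u \<inter> cylinder v = cylinder v \<inter> cylinder u" "length v \<le> length u" by auto
    then show ?thesis by (simp add: cylinder_Int)
  qed
  ultimately show "a \<inter> b \<in> insert {} (range cylinder)" by auto
qed

text \<open>Over a countable alphabet there are countably many words, so every open set is a
  countable union of cylinders.\<close>

lemma sets_borel_eq_sigma_cylinders:
  "sets (borel :: (nat \<Rightarrow> 'a::{countable, discrete_topology}) measure) =
    sigma_sets UNIV (insert {} (range cylinder))"
proof (rule antisym)
  have "U \<in> sigma_sets UNIV (insert {} (range cylinder))"
    if "open U" for U :: "(nat \<Rightarrow> 'a) set"
  proof -
    have eq: "U = (\<Union>w\<in>{w. cylinder w \<subseteq> U}. cylinder w)"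
    proof
      show "U \<subseteq> (\<Union>w\<in>{w. cylinder w \<subseteq> U}. cylinder w)"
      proof
        fix x assume "x \<in> U"
        from open_contains_cylinder[OF that this] obtain n where n: "cylinder (map x [0..<n]) \<subseteq> U" .
        have "x \<in> cylinder (map x [0..<n])" by (simp add: cylinder_def)
        with n show "x \<in> (\<Union>w\<in>{w. cylinder w \<subseteq> U}. cylinder w)" by blast
      qed
    qed auto
    show ?thesis
    proof (cases "U = {}")
      case True
      then show ?thesis by (auto intro: sigma_sets.Basic)
    next
      case False
      interpret S: sigma_algebra UNIV "sigma_sets UNIV (insert {} (range (cylinder :: 'a list \<Rightarrow> _)))"
        by (rule sigma_algebra_sigma_sets) auto
      have "(\<Union>w\<in>{w. cylinder w \<subseteq> U}. cylinder w) \<in> sigma_sets UNIV (insert {} (range cylinder))"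
        by (rule S.countable_UN'') (auto intro: sigma_sets.Basic)
      then show ?thesis using eq by simp
    qed
  qed
  then show "sets (borel :: (nat \<Rightarrow> 'a) measure) \<subseteq> sigma_sets UNIV (insert {} (range cylinder))"
    unfolding borel_def by (subst sets_measure_of) (auto intro!: sigma_sets_mono)
next
  have "insert {} (range cylinder) \<subseteq> sets (borel :: (nat \<Rightarrow> 'a) measure)"
    by (auto intro: borel_open open_cylinder)
  then show "sigma_sets UNIV (insert {} (range cylinder)) \<subseteq> sets (borel :: (nat \<Rightarrow> 'a) measure)"
    by (metis sets.sigma_sets_subset space_borel)
qed

text \<open>The empty word gives the whole space, so equality of the total masses is among the
  hypotheses, and uniqueness on an intersection-stable generator applies.\<close>

lemma measure_eqI_cylinder:
  fixes M N :: "(nat \<Rightarrow> 'a::{countable, discrete_topology}) measure"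
  assumes "sets M = sets borel" "sets N = sets borel" "finite_measure M"
    and "\<And>w. emeasure M (cylinder w) = emeasure N (cylinder w)"
  shows "M = N"
proof (rule measure_eqI_generator_eq[where E = "insert {} (range cylinder)" and \<Omega> = UNIV
      and A = "\<lambda>_. UNIV"])
  show "emeasure M UNIV \<noteq> \<infinity>" for i :: nat
    using finite_measure.emeasure_finite[OF assms(3)] by simp
  show "range (\<lambda>_. UNIV) \<subseteq> insert {} (range (cylinder :: 'a list \<Rightarrow> _))"
    using cylinder_Nil by (metis insertCI rangeI image_subsetI)
qed (use assms Int_stable_cylinders in \<open>auto simp: sets_borel_eq_sigma_cylinders\<close>)

section \<open>Measurability of coordinates, of the shift and of functions of finitely many
  coordinates\<close>

lemma measurable_coord [measurable]:
  "(\<lambda>x :: nat \<Rightarrow> 'a::{countable, discrete_topology}. x i) \<in> borel \<rightarrow>\<^sub>M count_space UNIV"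
proof (rule measurableI)
  fix A :: "'a set"
  have "open ((\<lambda>x :: nat \<Rightarrow> 'a. x i) -` A)"
    by (intro open_vimage continuous_on_product_coordinates discrete_topology_class.open_discrete)
  then show "(\<lambda>x :: nat \<Rightarrow> 'a. x i) -` A \<inter> space borel \<in> sets borel" by simp
qed simp

lemma sets_PiM_count_space_eq_borel:
  "sets (\<Pi>\<^sub>M i\<in>UNIV. count_space UNIV) = sets (borel :: (nat \<Rightarrow> 'a::{countable, discrete_topology}) measure)"
proof (rule antisym)
  show "sets (\<Pi>\<^sub>M i\<in>UNIV. count_space UNIV) \<subseteq> sets (borel :: (nat \<Rightarrow> 'a) measure)"
  proof (rule sets_PiM_in_sets)
    show "{x \<in> space (borel :: (nat \<Rightarrow> 'a) measure). x i \<in> A} \<in> sets borel" for i and A :: "'a set"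
      using measurable_sets[OF measurable_coord[of i], of A] by (auto simp: vimage_def)
  qed auto
  have "cylinder w \<in> sets (\<Pi>\<^sub>M i\<in>UNIV. count_space UNIV)" for w :: "'a list"
  proof -
    have "{x \<in> space (\<Pi>\<^sub>M i\<in>UNIV. count_space UNIV). \<forall>i<length w. x i = w ! i} \<in> sets (\<Pi>\<^sub>M i\<in>UNIV. count_space (UNIV :: 'a set))"
      by measurable
    then show ?thesis by (simp add: cylinder_def space_PiM)
  qed
  then show "sets (borel :: (nat \<Rightarrow> 'a) measure) \<subseteq> sets (\<Pi>\<^sub>M i\<in>UNIV. count_space UNIV)"
    unfolding sets_borel_eq_sigma_cylinders
    by (intro sets.sigma_sets_subset[of _ "\<Pi>\<^sub>M i\<in>UNIV. count_space UNIV", simplified space_PiM, simplified]) auto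
qed

lemma measurable_shift_map [measurable]:
  "shift_map \<in> borel \<rightarrow>\<^sub>M (borel :: (nat \<Rightarrow> 'a::{countable, discrete_topology}) measure)"
proof -
  have "(\<lambda>x::nat \<Rightarrow> 'a. \<lambda>i. x (Suc i)) \<in> borel \<rightarrow>\<^sub>M (\<Pi>\<^sub>M i\<in>UNIV. count_space UNIV)"
    by (rule measurable_PiM_single') (auto simp: PiE_iff)
  then show ?thesis
    unfolding shift_map_def
    using measurable_cong_sets[OF refl sets_PiM_count_space_eq_borel] by blast
qed

lemma funpow_shift_map: "(shift_map ^^ n) x i = x (i + n)"
  by (induction n arbitrary: x i) (auto simp: shift_map_def)

lemma measurable_funpow_shift_map [measurable]:
  "(shift_map ^^ n) \<in> borel \<rightarrow>\<^sub>M (borel :: (nat \<Rightarrow> 'a::{countable, discrete_topology}) measure)"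
  by (induction n) (auto intro: measurable_comp[unfolded comp_def] measurable_shift_map simp: comp_def)

text \<open>The preimage of any set is a union of cylinders of length \<open>n\<close>, hence open;
  the sigma-algebra of \<open>N\<close> can be arbitrary.\<close>

lemma measurable_finite_dependence:
  fixes f :: "(nat \<Rightarrow> 'a::{countable, discrete_topology}) \<Rightarrow> 'b"
  assumes "\<And>x y. (\<And>i. i < n \<Longrightarrow> x i = y i) \<Longrightarrow> f x = f y" and "\<And>x. f x \<in> space N"
  shows "f \<in> borel \<rightarrow>\<^sub>M N"
proof (rule measurableI)
  fix A assume "A \<in> sets N"
  have "open (f -` A)"
  proof (rule topological_space_class.openI)
    fix x assume "x \<in> f -` A"
    moreover have "f y = f x" if "y \<in> cylinder (map x [0..<n])" for y
      using that by (intro assms(1)) (simp add: cylinder_def)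
    ultimately have "cylinder (map x [0..<n]) \<subseteq> f -` A" by auto
    then show "\<exists>T. open T \<and> x \<in> T \<and> T \<subseteq> f -` A"
      by (intro exI[of _ "cylinder (map x [0..<n])"]) (simp add: open_cylinder mem_cylinder_iff)
  qed
  then show "f -` A \<inter> space borel \<in> sets borel" by simp
qed (simp add: assms(2))

lemma has_sum_imp_nn_integral_count_space:
  assumes "(f has_sum s) A" "\<And>x. x \<in> A \<Longrightarrow> f x \<ge> (0::real)"
  shows "(\<integral>\<^sup>+x. ennreal (f x) \<partial>count_space A) = ennreal s"
proof -
  have "f summable_on A" using assms(1) by (auto simp: summable_on_def)
  then have "Infinite_Sum.abs_summable_on f A"
    using summable_on_iff_abs_summable_on_real by blast
  then have *: "Infinite_Set_Sum.abs_summable_on f A" by (rule abs_summable_equivalent[THEN iffD1])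
  have "infsetsum f A = s"
    using infsetsum_infsum[OF *] infsumI[OF assms(1)] by (rule trans)
  then show ?thesis using nn_integral_conv_infsetsum[OF *] assms(2) by metis
qed

section \<open>Product measures given by a sequence of probability vectors\<close>

locale product_weights =
  fixes p :: "nat \<Rightarrow> 'a::countable \<Rightarrow> real"
  assumes weight_nonneg: "p n a \<ge> 0"
    and weight_has_sum: "(p n has_sum 1) UNIV"
begin

abbreviation factor :: "nat \<Rightarrow> 'a measure" where
  "factor n \<equiv> point_measure UNIV (\<lambda>a. ennreal (p n a))"

abbreviation P :: "(nat \<Rightarrow> 'a) measure" where
  "P \<equiv> product_type_measure p"

lemma nn_integral_factor:
  "(\<integral>\<^sup>+a. f a \<partial>factor n) = (\<integral>\<^sup>+a. ennreal (p n a) * f a \<partial>count_space UNIV)"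
  unfolding point_measure_def by (subst nn_integral_density) auto

lemma prob_space_factor: "prob_space (factor n)"
proof
  show "emeasure (factor n) (space (factor n)) = 1"
    using has_sum_imp_nn_integral_count_space[OF weight_has_sum[of n]] weight_nonneg
    by (simp add: point_measure_def emeasure_density space_point_measure)
qed

sublocale product_prob_space factor UNIV
  by (rule product_prob_spaceI) (rule prob_space_factor)

lemma sets_product_type_measure: "sets P = sets (\<Pi>\<^sub>M i\<in>UNIV. count_space UNIV)"
  unfolding product_type_measure_def by (intro sets_PiM_cong) (auto simp: sets_point_measure)

lemma space_product_type_measure [simp]: "space P = UNIV"
  by (auto simp: product_type_measure_def space_PiM space_point_measure)

lemma prob_space_product_type_measure: "prob_space P"
  unfolding product_type_measure_def by (rule P.prob_space_axioms)

lemma emeasure_factor_singleton: "emeasure (factor n) {a} = ennreal (p n a)"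
  by (simp add: emeasure_point_measure_finite2 sets_point_measure)

text \<open>The integrand sees only the first \<open>n\<close> coordinates, so the integral descends
  to the finite product, where Tonelli splits it.\<close>

lemma nn_integral_prod_coords:
  "(\<integral>\<^sup>+x. (\<Prod>i<n. f i (x i)) \<partial>P) = (\<Prod>i<n. \<integral>\<^sup>+a. f i a \<partial>factor i)"
proof -
  have "(\<integral>\<^sup>+x. (\<Prod>i<n. f i (x i)) \<partial>P) =
      (\<integral>\<^sup>+x. (\<Prod>i<n. f i (restrict x {..<n} i)) \<partial>P)"
    by simp
  also have "\<dots> = (\<integral>\<^sup>+x. (\<Prod>i<n. f i (x i)) \<partial>distr P (PiM {..<n} factor) (\<lambda>x. restrict x {..<n}))"
    unfolding product_type_measure_def
    by (subst nn_integral_distr) (auto intro!: borel_measurable_prod_ennreal measurable_restrict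
         measurable_compose[OF measurable_component_singleton] simp: measurable_point_measure_eq1 space_point_measure)
  also have "\<dots> = (\<integral>\<^sup>+x. (\<Prod>i<n. f i (x i)) \<partial>PiM {..<n} factor)"
    unfolding product_type_measure_def by (subst distr_PiM_restrict_finite) auto
  also have "\<dots> = (\<Prod>i<n. \<integral>\<^sup>+a. f i a \<partial>factor i)"
    by (rule product_nn_integral_prod) (auto simp: measurable_point_measure_eq1 space_point_measure)
  finally show ?thesis .
qed

lemma emeasure_coords: "emeasure P {x. \<forall>i<n. x i \<in> A i} = (\<Prod>i<n. emeasure (factor i) (A i))"
proof -
  have "emeasure P {x. \<forall>i<n. x i \<in> A i} = emeasure P {x \<in> space P. \<forall>i\<in>{..<n}. x i \<in> A i}"
    by (simp add: Ball_def)
  also have "\<dots> = (\<Prod>i<n. emeasure (factor i) (A i))"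
    unfolding product_type_measure_def
    by (rule emeasure_PiM_Collect) (auto simp: sets_point_measure)
  finally show ?thesis .
qed

lemma emeasure_cylinder: "emeasure P (cylinder w) = ennreal (\<Prod>i<length w. p i (w ! i))"
proof -
  have "cylinder w = {x. \<forall>i<length w. x i \<in> {w ! i}}" by (auto simp: cylinder_def)
  then show ?thesis
    using emeasure_coords[of "length w" "\<lambda>i. {w ! i}"]
    by (simp add: emeasure_factor_singleton prod_ennreal weight_nonneg)
qed

end

section \<open>The dual of the Ruelle operator\<close>

lemma shift_map_case_nat [simp]: "shift_map (case_nat a x) = x"
  by (auto simp: shift_map_def)

lemma shift_map_fibre: "{y. shift_map y = x} = range (\<lambda>a. case_nat a x)"
proof (intro set_eqI iffI)
  fix y assume "y \<in> {y. shift_map y = x}"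
  then have "y = case_nat (y 0) x"
    by (auto simp: shift_map_def fun_eq_iff split: nat.split)
  then show "y \<in> range (\<lambda>a. case_nat a x)" by (rule range_eqI)
qed auto

lemma inj_case_nat: "inj (\<lambda>a. case_nat a x)"
  by (rule injI) (metis nat.case(1))

lemma ruelle_eq: "ruelle f \<phi> x = (\<Sum>\<^sub>\<infinity>a. \<phi> (case_nat a x) * exp (f (case_nat a x)))"
  unfolding ruelle_def shift_map_fibre
  by (subst infsum_reindex[OF inj_case_nat]) (simp add: o_def)

lemma measurable_case_nat [measurable]:
  "(\<lambda>x. case_nat a x) \<in> borel \<rightarrow>\<^sub>M (borel :: (nat \<Rightarrow> 'a::{countable, discrete_topology}) measure)"
proof -
  have "(\<lambda>x. case_nat a x i) \<in> borel \<rightarrow>\<^sub>M count_space (UNIV :: 'a set)" for i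
    by (cases i) simp_all
  then have "(\<lambda>x. \<lambda>i. case_nat a x i) \<in> borel \<rightarrow>\<^sub>M (\<Pi>\<^sub>M i\<in>UNIV. count_space (UNIV :: 'a set))"
    by (intro measurable_PiM_single') (auto simp: PiE_iff)
  then show ?thesis
    using measurable_cong_sets[OF refl sets_PiM_count_space_eq_borel] by blast
qed

lemma case_nat_in_cylinder:
  "case_nat a x \<in> cylinder (b # w) \<longleftrightarrow> a = b \<and> x \<in> cylinder w"
  by (auto simp: cylinder_def nth_Cons split: nat.splits)

lemma infsum_eq_lebesgue_integral_count_space:
  fixes f :: "'a \<Rightarrow> real"
  assumes "integrable (count_space UNIV) f"
  shows "f summable_on UNIV" "infsum f UNIV = (\<integral>a. f a \<partial>count_space UNIV)"
proof -
  have f: "Infinite_Set_Sum.abs_summable_on f UNIV"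
    using assms by (simp add: Infinite_Set_Sum.abs_summable_on_def)
  then have "Infinite_Sum.abs_summable_on f UNIV"
    by (rule abs_summable_equivalent[THEN iffD2])
  then show "f summable_on UNIV" using summable_on_iff_abs_summable_on_real by blast
  show "infsum f UNIV = (\<integral>a. f a \<partial>count_space UNIV)"
    using infsetsum_infsum[OF f] by (simp add: infsetsum_def)
qed

lemma integrable_count_space_iff_summable:
  fixes f :: "'a \<Rightarrow> real"
  shows "integrable (count_space UNIV) f \<longleftrightarrow> f summable_on UNIV"
proof -
  have "integrable (count_space UNIV) f \<longleftrightarrow> Infinite_Set_Sum.abs_summable_on f UNIV"
    by (simp add: Infinite_Set_Sum.abs_summable_on_def)
  also have "\<dots> \<longleftrightarrow> Infinite_Sum.abs_summable_on f UNIV"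
    by (rule abs_summable_equivalent[symmetric])
  also have "\<dots> \<longleftrightarrow> f summable_on UNIV"
    by (rule summable_on_iff_abs_summable_on_real[symmetric])
  finally show ?thesis .
qed

text \<open>Reduces a statement about all bounded continuous test functions to a check on cylinders.
  Existence: the cylinder identity makes \<nu> the image of a density on pairs (letter, point), and
  Fubini then gives the duality. Uniqueness: any other candidate has the same integrals of cylinder
  indicators.\<close>

lemma ruelle_dual_eqI:
  fixes f :: "(nat \<Rightarrow> 'a::{countable, discrete_topology}) \<Rightarrow> real"
  assumes \<mu>: "finite_measure \<mu>" "sets \<mu> = sets borel"
    and \<nu>: "finite_measure \<nu>" "sets \<nu> = sets borel"
    and f [measurable]: "f \<in> borel_measurable borel"
    and summable: "\<And>x. (\<lambda>a. exp (f (case_nat a x))) summable_on UNIV"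
    and cyl: "\<And>a w. emeasure \<nu> (cylinder (a # w)) =
        (\<integral>\<^sup>+x. indicator (cylinder w) x * ennreal (exp (f (case_nat a x))) \<partial>\<mu>)"
  shows "ruelle_dual f \<mu> = \<nu>"
proof -
  note [measurable_cong] = \<mu>(2) \<nu>(2)
  interpret \<mu>: finite_measure \<mu> by fact
  interpret \<nu>: finite_measure \<nu> by fact
  have sp [simp]: "space \<mu> = UNIV" "space \<nu> = UNIV"
    using \<mu>(2) \<nu>(2) by (auto dest: sets_eq_imp_space_eq)
  have cylinder_sets [simp]: "cylinder w \<in> sets (borel :: (nat \<Rightarrow> 'a) measure)" for w
    by (intro borel_open open_cylinder)
  interpret C: sigma_finite_measure "count_space (UNIV :: 'a set)"
    by (intro sigma_finite_measure_count_space_countable) simp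
  interpret CM: pair_sigma_finite "count_space (UNIV :: 'a set)" \<mu> ..
  have cons [measurable]: "(\<lambda>(a, x). case_nat a x) \<in> count_space UNIV \<Otimes>\<^sub>M \<mu> \<rightarrow>\<^sub>M (borel :: (nat \<Rightarrow> 'a) measure)"
    by (rule measurable_pair_measure_countable1) simp_all
  define e where "e = (\<lambda>(a, x). exp (f (case_nat a x)))"
  have e [measurable]: "e \<in> borel_measurable (count_space UNIV \<Otimes>\<^sub>M \<mu>)"
    unfolding e_def using measurable_compose[OF cons f] 
    by (auto simp: split_beta' intro!: borel_measurable_exp)
  \<comment> \<open>The dual image built by hand: weight the pair \<open>(a, x)\<close> by
    \<open>exp f\<close> at the point with \<open>a\<close> put in front of \<open>x\<close>, then
    push forward under this prepending.\<close>
  define \<nu>' where "\<nu>' = distr (density (count_space UNIV \<Otimes>\<^sub>M \<mu>) (\<lambda>z. ennreal (e z))) borel (\<lambda>(a, x). case_nat a x)"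
  have nn: "(\<integral>\<^sup>+y. h y \<partial>\<nu>') = (\<integral>\<^sup>+a. \<integral>\<^sup>+x. ennreal (exp (f (case_nat a x))) * h (case_nat a x) \<partial>\<mu> \<partial>count_space UNIV)"
    if [measurable]: "h \<in> borel_measurable borel" for h
  proof -
    have "(\<integral>\<^sup>+y. h y \<partial>\<nu>') = (\<integral>\<^sup>+z. ennreal (e z) * h (case z of (a, x) \<Rightarrow> case_nat a x) \<partial>(count_space UNIV \<Otimes>\<^sub>M \<mu>))"
      unfolding \<nu>'_def by (subst nn_integral_distr) (auto simp: nn_integral_density)
    also have "\<dots> = (\<integral>\<^sup>+a. \<integral>\<^sup>+x. ennreal (e (a, x)) * h (case (a, x) of (a, x) \<Rightarrow> case_nat a x) \<partial>\<mu> \<partial>count_space UNIV)"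
      by (subst \<mu>.nn_integral_fst[symmetric]) auto
    finally show ?thesis by (simp add: e_def)
  qed
  have cons_cyl: "emeasure \<nu>' (cylinder (b # w)) = emeasure \<nu> (cylinder (b # w))" for b w
  proof -
    have "emeasure \<nu>' (cylinder (b # w)) = (\<integral>\<^sup>+y. indicator (cylinder (b # w)) y \<partial>\<nu>')"
      by (rule nn_integral_indicator[symmetric]) (simp add: \<nu>'_def)
    also have "\<dots> = (\<integral>\<^sup>+a. \<integral>\<^sup>+x. ennreal (exp (f (case_nat a x))) * indicator (cylinder (b # w)) (case_nat a x) \<partial>\<mu> \<partial>count_space UNIV)"
      by (intro nn borel_measurable_indicator cylinder_sets)
    also have "\<dots> = (\<integral>\<^sup>+a. emeasure \<nu> (cylinder (b # w)) * indicator {b} a \<partial>count_space UNIV)"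
    proof (intro nn_integral_cong)
      fix a
      have "ennreal (exp (f (case_nat a x))) * indicator (cylinder (b # w)) (case_nat a x) =
          (indicator (cylinder w) x * ennreal (exp (f (case_nat a x)))) * indicator {b} a" for x
        by (auto simp: indicator_def case_nat_in_cylinder)
      then show "(\<integral>\<^sup>+x. ennreal (exp (f (case_nat a x))) * indicator (cylinder (b # w)) (case_nat a x) \<partial>\<mu>) =
          emeasure \<nu> (cylinder (b # w)) * indicator {b} a"
        by (cases "a = b") (simp_all add: cyl)
    qed
    also have "\<dots> = emeasure \<nu> (cylinder (b # w))"
      by simp
    finally show ?thesis .
  qed
  \<comment> \<open>The hypothesis \<open>cyl\<close> speaks of nonempty words only; the empty word
    is recovered by summing over its one-letter extensions.\<close>
  have UN: "emeasure M UNIV = (\<integral>\<^sup>+a. emeasure M (cylinder [a]) \<partial>count_space (UNIV :: 'a set))"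
    if M: "sets M = sets borel" for M :: "(nat \<Rightarrow> 'a) measure"
  proof -
    have U: "(\<Union>a. cylinder [a]) = (UNIV :: (nat \<Rightarrow> 'a) set)"
      by (auto simp: cylinder_def)
    have "emeasure M (\<Union>a\<in>(UNIV :: 'a set). cylinder [a]) = (\<integral>\<^sup>+a. emeasure M (cylinder [a]) \<partial>count_space (UNIV :: 'a set))"
      by (rule emeasure_UN_countable) (auto simp: M disjoint_family_on_def cylinder_def)
    then show ?thesis by (simp only: U)
  qed
  have sets_\<nu>' [simp]: "sets \<nu>' = sets borel" by (simp add: \<nu>'_def)
  have "emeasure \<nu> (cylinder w) = emeasure \<nu>' (cylinder w)" for w
    by (cases w) (simp_all add: cons_cyl UN[OF sets_\<nu>'] UN[OF \<nu>(2)])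
  then have \<nu>'_eq: "\<nu>' = \<nu>"
    using \<nu> by (intro measure_eqI_cylinder[symmetric]) auto
  have dual: "(\<forall>x. (\<lambda>y. \<phi> y * exp (f y)) summable_on {y. shift_map y = x}) \<and>
        integrable \<mu> (ruelle f \<phi>) \<and> (\<integral>x. \<phi> x \<partial>\<nu>) = (\<integral>x. ruelle f \<phi> x \<partial>\<mu>)"
    if \<phi>: "continuous_on UNIV \<phi>" "bounded (range \<phi>)" for \<phi> :: "(nat \<Rightarrow> 'a) \<Rightarrow> real"
  proof -
    have \<phi>_meas [measurable]: "\<phi> \<in> borel_measurable borel"
      using \<phi>(1) by (rule borel_measurable_continuous_onI)
    obtain B where B: "\<And>x. \<bar>\<phi> x\<bar> \<le> B" using \<phi>(2) by (auto simp: bounded_iff)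
    have B0: "B \<ge> 0" using B[of undefined] by simp
    have int_a: "integrable (count_space UNIV) (\<lambda>a. \<phi> (case_nat a x) * exp (f (case_nat a x)))" for x
    proof (rule Bochner_Integration.integrable_bound)
      show "integrable (count_space UNIV) (\<lambda>a. B * exp (f (case_nat a x)))"
        using summable[of x] by (simp add: integrable_count_space_iff_summable[symmetric])
    qed (use B B0 in \<open>auto simp: abs_mult intro!: mult_right_mono\<close>)
    have "integrable \<nu>' \<phi>"
      unfolding \<nu>'_eq using \<phi>_meas
      by (intro \<nu>.integrable_const_bound[of _ B]) (use B in auto)
    then have "integrable (density (count_space UNIV \<Otimes>\<^sub>M \<mu>) (\<lambda>z. ennreal (e z))) (\<lambda>z. \<phi> (case z of (a, x) \<Rightarrow> case_nat a x))"
      unfolding \<nu>'_def by (subst (asm) integrable_distr_eq) auto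
    then have int_pair: "integrable (count_space UNIV \<Otimes>\<^sub>M \<mu>) (\<lambda>(a, x). \<phi> (case_nat a x) * exp (f (case_nat a x)))"
      by (subst (asm) integrable_density) (auto simp: e_def split_beta' mult.commute)
    have ruelle_int: "ruelle f \<phi> x = (\<integral>a. \<phi> (case_nat a x) * exp (f (case_nat a x)) \<partial>count_space UNIV)" for x
      unfolding ruelle_eq by (rule infsum_eq_lebesgue_integral_count_space(2)[OF int_a])
    have "(\<integral>x. \<phi> x \<partial>\<nu>) = (\<integral>z. \<phi> (case z of (a, x) \<Rightarrow> case_nat a x) \<partial>density (count_space UNIV \<Otimes>\<^sub>M \<mu>) (\<lambda>z. ennreal (e z)))"
      unfolding \<nu>'_eq[symmetric] \<nu>'_def by (subst integral_distr) auto
    also have "\<dots> = (\<integral>z. (\<lambda>(a, x). \<phi> (case_nat a x) * exp (f (case_nat a x))) z \<partial>(count_space UNIV \<Otimes>\<^sub>M \<mu>))"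
      by (subst integral_density) (auto simp: e_def split_beta' mult.commute)
    also have "\<dots> = (\<integral>x. (\<integral>a. \<phi> (case_nat a x) * exp (f (case_nat a x)) \<partial>count_space UNIV) \<partial>\<mu>)"
      by (rule CM.integral_snd[OF int_pair, symmetric])
    finally have eq: "(\<integral>x. \<phi> x \<partial>\<nu>) = (\<integral>x. ruelle f \<phi> x \<partial>\<mu>)"
      by (simp add: ruelle_int)
    have "integrable \<mu> (ruelle f \<phi>)"
      using CM.integrable_snd[OF int_pair] by (simp add: ruelle_int[abs_def])
    moreover have "(\<lambda>y. \<phi> y * exp (f y)) summable_on {y. shift_map y = x}" for x
      unfolding shift_map_fibre
      by (subst summable_on_reindex[OF inj_case_nat])
        (use infsum_eq_lebesgue_integral_count_space(1)[OF int_a] in \<open>simp add: o_def\<close>)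
    ultimately show ?thesis using eq by blast
  qed
  show ?thesis
    unfolding ruelle_dual_def
  proof (rule the_equality)
    fix M :: "(nat \<Rightarrow> 'a) measure"
    assume M: "finite_measure M \<and> sets M = sets borel \<and>
     (\<forall>\<phi>. continuous_on UNIV \<phi> \<and> bounded (range \<phi>) \<longrightarrow>
        (\<forall>x. (\<lambda>y. \<phi> y * exp (f y)) summable_on {y. shift_map y = x}) \<and>
        integrable \<mu> (ruelle f \<phi>) \<and> (\<integral>x. \<phi> x \<partial>M) = (\<integral>x. ruelle f \<phi> x \<partial>\<mu>))"
    show "M = \<nu>"
    proof (rule measure_eqI_cylinder)
      interpret M: finite_measure M using M by simp
      have spM: "space M = UNIV" using M by (auto dest: sets_eq_imp_space_eq)
      fix w
      have bnd: "bounded (range (indicator (cylinder w) :: (nat \<Rightarrow> 'a) \<Rightarrow> real))"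
        by (auto simp: bounded_iff indicator_def intro!: exI[of _ 1])
      have "(\<integral>x. indicator (cylinder w) x \<partial>M) = (\<integral>x. ruelle f (indicator (cylinder w)) x \<partial>\<mu>)"
        using M continuous_on_indicator_cylinder[of w] bnd by blast
      also have "\<dots> = (\<integral>x. indicator (cylinder w) x \<partial>\<nu>)"
        using dual[OF continuous_on_indicator_cylinder bnd] by simp
      finally have "measure M (cylinder w) = measure \<nu> (cylinder w)"
        by (simp add: spM)
      then show "emeasure M (cylinder w) = emeasure \<nu> (cylinder w)"
        by (simp add: M.emeasure_eq_measure \<nu>.emeasure_eq_measure)
    qed (use M \<nu> in auto)
  qed (use \<nu> dual in auto)
qed

section \<open>Potentials of product type\<close>

locale product_potential =
  fixes g0 :: real and G :: "nat \<Rightarrow> 'a::{countable, discrete_topology} \<Rightarrow> real"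
  assumes g0_pos: "g0 > 0" and G_pos: "G i a > 0"
    and l1_bounded_G: "l1_bounded G" and summable_G0: "summable_potential G"
begin

definition bound :: "nat \<Rightarrow> real" where
  "bound k = (SUP a. \<bar>ln (G (Suc k) a)\<bar>)"

text \<open>Total sup-norm of the logarithms of the factors \<open>G i\<close> with
  \<open>i > m\<close>. The possibly unbounded factor \<open>G 0\<close> never enters.\<close>

definition tail :: "nat \<Rightarrow> real" where
  "tail m = (\<Sum>j. bound (j + m))"

definition pot :: "(nat \<Rightarrow> 'a) \<Rightarrow> real" where
  "pot x = g0 * (\<Prod>i. G i (x i))"

definition pprod :: "nat \<Rightarrow> 'a \<Rightarrow> real" where
  "pprod n a = (\<Prod>i\<le>n. G i a)"

definition pprod_inf :: "'a \<Rightarrow> real" where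
  "pprod_inf a = (\<Prod>i. G i a)"

definition Z :: "nat \<Rightarrow> real" where
  "Z n = (\<Sum>\<^sub>\<infinity>a. pprod n a)"

definition Z_inf :: real where
  "Z_inf = (\<Sum>\<^sub>\<infinity>a. pprod_inf a)"

definition weight :: "nat \<Rightarrow> 'a \<Rightarrow> real" where
  "weight n a = pprod n a / Z n"

definition weight_inf :: "'a \<Rightarrow> real" where
  "weight_inf a = pprod_inf a / Z_inf"

lemma abs_ln_G_le_bound: "\<bar>ln (G (Suc k) a)\<bar> \<le> bound k"
  using l1_bounded_G unfolding l1_bounded_def bound_def by (intro cSUP_upper) auto

lemma bound_nonneg: "0 \<le> bound k"
  using abs_ln_G_le_bound[of k undefined] by linarith

lemma summable_bound: "summable (\<lambda>j. bound (j + m))"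
  using l1_bounded_G unfolding l1_bounded_def bound_def[symmetric]
  by (intro summable_ignore_initial_segment) simp

lemma tail_nonneg: "0 \<le> tail m"
  unfolding tail_def by (intro suminf_nonneg summable_bound bound_nonneg)

lemma tail_tendsto_0: "tail \<longlonglongrightarrow> 0"
proof -
  have b: "summable bound" using summable_bound[of 0] by simp
  have "(\<lambda>m. suminf bound - (\<Sum>i<m. bound i)) \<longlonglongrightarrow> suminf bound - suminf bound"
    by (intro tendsto_diff tendsto_const summable_LIMSEQ b)
  then show ?thesis by (simp add: tail_def[abs_def] suminf_minus_initial_segment[OF b])
qed

text \<open>The sequence \<open>x\<close> is indexed from the start of the tail, so that one
  estimate serves points, shifted points and constant sequences alike.\<close>

lemma
  shows summable_ln_G_tail: "summable (\<lambda>j. ln (G (Suc (j + m)) (x j)))"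
    and abs_suminf_ln_G_tail: "\<bar>\<Sum>j. ln (G (Suc (j + m)) (x j))\<bar> \<le> tail m"
proof -
  have s: "summable (\<lambda>j. \<bar>ln (G (Suc (j + m)) (x j))\<bar>)"
    by (rule summable_comparison_test'[OF summable_bound[of m]]) (simp add: abs_ln_G_le_bound)
  then show "summable (\<lambda>j. ln (G (Suc (j + m)) (x j)))" by (rule summable_rabs_cancel)
  have "\<bar>\<Sum>j. ln (G (Suc (j + m)) (x j))\<bar> \<le> (\<Sum>j. \<bar>ln (G (Suc (j + m)) (x j))\<bar>)"
    by (rule summable_rabs[OF s])
  also have "\<dots> \<le> tail m"
    unfolding tail_def by (intro suminf_le s summable_bound abs_ln_G_le_bound)
  finally show "\<bar>\<Sum>j. ln (G (Suc (j + m)) (x j))\<bar> \<le> tail m" .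
qed

lemma summable_ln_G: "summable (\<lambda>i. ln (G i (x i)))"
  using summable_ln_G_tail[of 0 "\<lambda>j. x (Suc j)"]
  by (subst summable_Suc_iff[symmetric]) simp

lemma suminf_ln_G_split:
  "(\<Sum>i. ln (G i (x i))) = (\<Sum>i\<le>n. ln (G i (x i))) + (\<Sum>j. ln (G (Suc (j + n)) (x (Suc (j + n)))))"
  using suminf_split_initial_segment[OF summable_ln_G[of x], of "Suc n"] by (simp add: lessThan_Suc_atMost)

lemma prodinf_G: "(\<Prod>i. G i (x i)) = exp (\<Sum>i. ln (G i (x i)))"
  using prodinf_exp[OF summable_ln_G[of x]] by (simp add: G_pos)

lemma pprod_inf_pos: "pprod_inf a > 0"
  using prodinf_G[of "\<lambda>_. a"] by (simp add: pprod_inf_def)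

lemma pprod_pos: "pprod n a > 0"
  by (simp add: pprod_def G_pos prod_pos)

lemma ln_pprod: "ln (pprod n a) = (\<Sum>i\<le>n. ln (G i a))"
  unfolding pprod_def by (intro ln_prod) (simp_all add: less_imp_neq[OF G_pos, THEN not_sym])

lemma ln_pprod_inf: "ln (pprod_inf a) = (\<Sum>i. ln (G i a))"
  using prodinf_G[of "\<lambda>_. a"] by (simp add: pprod_inf_def)

text \<open>Only factors with index above \<open>n\<close> separate the two products, and their
  bound is uniform in the letter. This uniformity is what carries summability and the limit of the
  normalising sums from partial to full products.\<close>

lemma abs_ln_pprod_inf_minus: "\<bar>ln (pprod_inf a) - ln (pprod n a)\<bar> \<le> tail n"
  unfolding ln_pprod ln_pprod_inf
  using suminf_ln_G_split[of "\<lambda>_. a" n] abs_suminf_ln_G_tail[of n "\<lambda>_. a"] by simp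

lemma pprod_le: "pprod n a \<le> exp (tail n) * pprod_inf a"
proof -
  have "ln (pprod n a) \<le> tail n + ln (pprod_inf a)" using abs_ln_pprod_inf_minus[of a n] by linarith
  then have "exp (ln (pprod n a)) \<le> exp (tail n + ln (pprod_inf a))" by simp
  then show ?thesis by (simp add: exp_add pprod_pos pprod_inf_pos)
qed

lemma pprod_inf_le: "pprod_inf a \<le> exp (tail n) * pprod n a"
proof -
  have "ln (pprod_inf a) \<le> tail n + ln (pprod n a)" using abs_ln_pprod_inf_minus[of a n] by linarith
  then have "exp (ln (pprod_inf a)) \<le> exp (tail n + ln (pprod n a))" by simp
  then show ?thesis by (simp add: exp_add pprod_pos pprod_inf_pos)
qed

text \<open>At \<open>n = 0\<close> the comparison is with \<open>G 0\<close> itself, the factor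
  whose summability is assumed.\<close>

lemma summable_pprod_inf: "pprod_inf summable_on UNIV"
proof (rule summable_on_comparison_test)
  show "(\<lambda>a. exp (tail 0) * G 0 a) summable_on UNIV"
    using summable_G0 by (intro summable_on_cmult_right) (simp add: summable_potential_def)
  show "pprod_inf a \<le> exp (tail 0) * G 0 a" for a
    using pprod_inf_le[of a 0] by (simp add: pprod_def)
qed (simp add: pprod_inf_pos order_less_imp_le)

lemma summable_pprod: "pprod n summable_on UNIV"
proof (rule summable_on_comparison_test)
  show "(\<lambda>a. exp (tail n) * pprod_inf a) summable_on UNIV"
    by (intro summable_on_cmult_right summable_pprod_inf)
qed (simp_all add: pprod_pos order_less_imp_le pprod_le)

lemma infsum_pos:
  fixes f :: "'a \<Rightarrow> real"
  assumes "f summable_on UNIV" "\<And>a. f a > 0"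
  shows "infsum f UNIV > 0"
proof -
  have "sum f {undefined} \<le> infsum f UNIV"
    using assms by (intro finite_sum_le_infsum) (auto intro: order_less_imp_le)
  then show ?thesis using assms(2)[of undefined] by simp
qed

lemma Z_pos: "Z n > 0"
  unfolding Z_def by (intro infsum_pos summable_pprod pprod_pos)

lemma Z_inf_pos: "Z_inf > 0"
  unfolding Z_inf_def by (intro infsum_pos summable_pprod_inf pprod_inf_pos)

lemma Z_le: "Z n \<le> exp (tail n) * Z_inf"
  unfolding Z_def Z_inf_def infsum_cmult_right'[symmetric]
  by (intro infsum_mono summable_pprod summable_on_cmult_right summable_pprod_inf pprod_le)

lemma Z_inf_le: "Z_inf \<le> exp (tail n) * Z n"
  unfolding Z_def Z_inf_def infsum_cmult_right'[symmetric]
  by (intro infsum_mono summable_pprod summable_on_cmult_right summable_pprod_inf pprod_inf_le)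

lemma Z_tendsto: "Z \<longlonglongrightarrow> Z_inf"
proof (rule tendsto_sandwich[where f = "\<lambda>n. Z_inf / exp (tail n)" and h = "\<lambda>n. exp (tail n) * Z_inf"])
  have e: "(\<lambda>n. exp (tail n)) \<longlonglongrightarrow> 1" using tendsto_exp[OF tail_tendsto_0] by simp
  show "(\<lambda>n. exp (tail n) * Z_inf) \<longlonglongrightarrow> Z_inf"
    using tendsto_mult[OF e tendsto_const[of Z_inf]] by simp
  show "(\<lambda>n. Z_inf / exp (tail n)) \<longlonglongrightarrow> Z_inf"
    using tendsto_divide[OF tendsto_const[of Z_inf] e] by simp
  show "\<forall>\<^sub>F n in sequentially. Z_inf / exp (tail n) \<le> Z n"
    using Z_inf_le by (intro always_eventually allI) (simp add: divide_le_eq mult.commute)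
qed (simp add: Z_le)

sublocale wt: product_weights weight
proof (unfold_locales, goal_cases)
  case (2 n)
  show ?case
    using has_sum_divide_const[OF has_sum_infsum[OF summable_pprod[of n]], of "Z n"] Z_pos[of n]
    by (simp add: weight_def[abs_def] Z_def)
next
  case 1
  show ?case by (simp add: weight_def pprod_pos Z_pos order_less_imp_le)
qed

sublocale wt_inf: product_weights "\<lambda>_. weight_inf"
proof
  show "(weight_inf has_sum 1) UNIV"
    using has_sum_divide_const[OF has_sum_infsum[OF summable_pprod_inf], of Z_inf] Z_inf_pos
    by (simp add: weight_inf_def[abs_def] Z_inf_def)
qed (simp add: weight_inf_def pprod_inf_pos Z_inf_pos order_less_imp_le)

lemma pot_pos: "pot x > 0"
  by (simp add: pot_def prodinf_G g0_pos)

lemma ln_pot: "ln (pot x) = ln g0 + (\<Sum>i. ln (G i (x i)))"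
  using g0_pos by (simp add: pot_def prodinf_G ln_mult)

lemma exp_ln_pot [simp]: "exp (ln (pot x)) = pot x"
  by (simp add: pot_pos)

lemma measurable_of_coord [measurable]:
  "(\<lambda>x. f (x i)) \<in> borel_measurable (borel :: (nat \<Rightarrow> 'a) measure)"
  by (rule measurable_compose[OF measurable_coord]) simp

lemma measurable_ln_pot [measurable]: "(\<lambda>x. ln (pot x)) \<in> borel_measurable borel"
  unfolding ln_pot by measurable

text \<open>Prepending a letter hands every coordinate of \<open>x\<close> over to the next factor;
  the new letter meets \<open>G 0\<close>.\<close>

lemma pot_case_nat: "pot (case_nat a x) = g0 * G 0 a * exp (\<Sum>i. ln (G (Suc i) (x i)))"
proof -
  have "(\<Sum>i. ln (G i (case_nat a x i))) = ln (G 0 a) + (\<Sum>i. ln (G (Suc i) (x i)))"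
    using suminf_split_head[OF summable_ln_G[of "case_nat a x"]] by simp
  then show ?thesis by (simp add: pot_def prodinf_G exp_add G_pos)
qed

lemma weight_Suc: "weight i a * G (Suc i) a = weight (Suc i) a * (Z (Suc i) / Z i)"
  using Z_pos[of i] Z_pos[of "Suc i"] by (simp add: weight_def pprod_def)

lemma nn_integral_factor_G: "(\<integral>\<^sup>+a. ennreal (G (Suc i) a) \<partial>wt.factor i) = ennreal (Z (Suc i) / Z i)"
proof -
  have "(\<integral>\<^sup>+a. ennreal (G (Suc i) a) \<partial>wt.factor i) = (\<integral>\<^sup>+a. ennreal (weight (Suc i) a) * ennreal (Z (Suc i) / Z i) \<partial>count_space UNIV)"
    unfolding wt.nn_integral_factor
    using weight_Suc wt.weight_nonneg G_pos Z_pos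
    by (intro nn_integral_cong) (simp add: ennreal_mult[symmetric] order_less_imp_le)
  also have "\<dots> = (\<integral>\<^sup>+a. ennreal (weight (Suc i) a) \<partial>count_space UNIV) * ennreal (Z (Suc i) / Z i)"
    by (rule nn_integral_multc) simp
  also have "\<dots> = ennreal (Z (Suc i) / Z i)"
    using has_sum_imp_nn_integral_count_space[OF wt.weight_has_sum wt.weight_nonneg] by simp
  finally show ?thesis .
qed

text \<open>Cutting the infinite product at \<open>N\<close> leaves a product of functions of single
  coordinates, so the integral factorises. A site fixed by \<open>w\<close> turns its weight into
  the next one, a free site contributes only the ratio of normalising sums.\<close>

lemma nn_integral_cylinder_partial:
  assumes "length w \<le> N"
  shows "(\<integral>\<^sup>+x. indicator (cylinder w) x * ennreal (\<Prod>i<N. G (Suc i) (x i)) \<partial>wt.P) =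
    ennreal ((\<Prod>i<length w. weight (Suc i) (w ! i)) * (Z N / Z 0))"
proof -
  define f where "f i b = (if i < length w then indicator {w ! i} b else 1) * ennreal (G (Suc i) b)" for i b
  have "indicator (cylinder w) x * ennreal (\<Prod>i<N. G (Suc i) (x i)) = (\<Prod>i<N. f i (x i))" for x
  proof (cases "x \<in> cylinder w")
    case True
    then have "(\<Prod>i<N. f i (x i)) = (\<Prod>i<N. ennreal (G (Suc i) (x i)))"
      by (intro prod.cong) (auto simp: f_def cylinder_def)
    then show ?thesis using True by (simp add: prod_ennreal G_pos order_less_imp_le)
  next
    case False
    then obtain i where "i < length w" "x i \<noteq> w ! i" by (auto simp: cylinder_def)
    then have "i < N" "f i (x i) = 0" using assms by (auto simp: f_def)
    then have "(\<Prod>i<N. f i (x i)) = 0" by (intro prod_zero) auto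
    then show ?thesis using False by simp
  qed
  then have "(\<integral>\<^sup>+x. indicator (cylinder w) x * ennreal (\<Prod>i<N. G (Suc i) (x i)) \<partial>wt.P) =
      (\<Prod>i<N. \<integral>\<^sup>+a. f i a \<partial>wt.factor i)"
    by (simp add: wt.nn_integral_prod_coords)
  also have "\<dots> = (\<Prod>i<N. ennreal ((if i < length w then weight (Suc i) (w ! i) else 1) * (Z (Suc i) / Z i)))"
  proof (intro prod.cong refl)
    fix i
    show "(\<integral>\<^sup>+a. f i a \<partial>wt.factor i) = ennreal ((if i < length w then weight (Suc i) (w ! i) else 1) * (Z (Suc i) / Z i))"
    proof (cases "i < length w")
      case True
      have "(\<integral>\<^sup>+a. f i a \<partial>wt.factor i) = (\<integral>\<^sup>+a. ennreal (weight i a * G (Suc i) a) * indicator {w ! i} a \<partial>count_space UNIV)"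
        unfolding wt.nn_integral_factor using True
        by (intro nn_integral_cong) (auto simp: f_def indicator_def ennreal_mult wt.weight_nonneg G_pos order_less_imp_le)
      then show ?thesis using True by (simp add: weight_Suc)
    qed (simp add: f_def nn_integral_factor_G)
  qed
  also have "\<dots> = ennreal (\<Prod>i<N. (if i < length w then weight (Suc i) (w ! i) else 1) * (Z (Suc i) / Z i))"
    by (intro prod_ennreal mult_nonneg_nonneg divide_nonneg_nonneg)
      (auto simp: wt.weight_nonneg Z_pos order_less_imp_le)
  also have "(\<Prod>i<N. (if i < length w then weight (Suc i) (w ! i) else 1) * (Z (Suc i) / Z i)) =
      (\<Prod>i<N. (if i < length w then weight (Suc i) (w ! i) else 1)) * (\<Prod>i<N. Z (Suc i) / Z i)"
    by (rule prod.distrib)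
  also have "(\<Prod>i<N. (if i < length w then weight (Suc i) (w ! i) else 1)) = (\<Prod>i<length w. weight (Suc i) (w ! i))"
    using assms by (intro prod.mono_neutral_cong_right) auto
  also have "(\<Prod>i<N. Z (Suc i) / Z i) = Z N / Z 0"
  proof (induction N)
    case (Suc N)
    then show ?case using Z_pos[of N] by simp
  qed (use Z_pos[of 0] in simp)
  finally show ?thesis .
qed

text \<open>Limit \<open>N\<close> to infinity of the truncated identity by dominated convergence:
  every truncated product is at most \<open>exp (tail 0)\<close>, a constant, and the measure is a
  probability.\<close>

lemma nn_integral_cylinder:
  "(\<integral>\<^sup>+x. indicator (cylinder w) x * ennreal (exp (\<Sum>i. ln (G (Suc i) (x i)))) \<partial>wt.P) =
    ennreal ((\<Prod>i<length w. weight (Suc i) (w ! i)) * (Z_inf / Z 0))"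
proof (rule LIMSEQ_unique)
  interpret prob_space wt.P by (rule wt.prob_space_product_type_measure)
  note [measurable_cong] = wt.sets_product_type_measure[unfolded sets_PiM_count_space_eq_borel]
  have [measurable]: "cylinder w \<in> sets borel" by (intro borel_open open_cylinder)
  have *: "(\<Prod>i<N. G (Suc i) (x i)) = exp (\<Sum>i<N. ln (G (Suc i) (x i)))" for N x
    by (simp add: exp_sum G_pos)
  show "(\<lambda>N. \<integral>\<^sup>+x. indicator (cylinder w) x * ennreal (\<Prod>i<N. G (Suc i) (x i)) \<partial>wt.P) \<longlonglongrightarrow>
      (\<integral>\<^sup>+x. indicator (cylinder w) x * ennreal (exp (\<Sum>i. ln (G (Suc i) (x i)))) \<partial>wt.P)"
  proof (rule nn_integral_dominated_convergence[where w = "\<lambda>_. ennreal (exp (tail 0))"])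
    show "AE x in wt.P. indicator (cylinder w) x * ennreal (\<Prod>i<N. G (Suc i) (x i)) \<le> ennreal (exp (tail 0))" for N
    proof (rule AE_I2)
      fix x
      have "(\<Sum>i<N. ln (G (Suc i) (x i))) \<le> (\<Sum>i<N. bound i)"
        by (intro sum_mono order_trans[OF abs_ge_self abs_ln_G_le_bound])
      also have "\<dots> \<le> tail 0"
        unfolding tail_def using summable_bound[of 0] by (intro order_trans[OF sum_le_suminf]) (auto simp: bound_nonneg)
      finally have "ennreal (\<Prod>i<N. G (Suc i) (x i)) \<le> ennreal (exp (tail 0))"
        unfolding * by (intro ennreal_leI) simp
      then show "indicator (cylinder w) x * ennreal (\<Prod>i<N. G (Suc i) (x i)) \<le> ennreal (exp (tail 0))"
        by (auto simp: indicator_def)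
    qed
    show "AE x in wt.P. (\<lambda>N. indicator (cylinder w) x * ennreal (\<Prod>i<N. G (Suc i) (x i))) \<longlonglongrightarrow>
        indicator (cylinder w) x * ennreal (exp (\<Sum>i. ln (G (Suc i) (x i))))"
    proof (rule AE_I2)
      fix x
      have "(\<lambda>N. \<Sum>i<N. ln (G (Suc i) (x i))) \<longlonglongrightarrow> (\<Sum>i. ln (G (Suc i) (x i)))"
        using summable_ln_G_tail[of 0 x] by (intro summable_LIMSEQ) simp
      then have "(\<lambda>N. ennreal (\<Prod>i<N. G (Suc i) (x i))) \<longlonglongrightarrow> ennreal (exp (\<Sum>i. ln (G (Suc i) (x i))))"
        unfolding * by (intro tendsto_ennrealI tendsto_exp)
      then show "(\<lambda>N. indicator (cylinder w) x * ennreal (\<Prod>i<N. G (Suc i) (x i))) \<longlonglongrightarrow>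
        indicator (cylinder w) x * ennreal (exp (\<Sum>i. ln (G (Suc i) (x i))))"
        by (cases "x \<in> cylinder w") simp_all
    qed
  qed (simp_all add: emeasure_space_1[unfolded wt.space_product_type_measure] ennreal_less_top)
  have "(\<lambda>N. ennreal ((\<Prod>i<length w. weight (Suc i) (w ! i)) * (Z N / Z 0))) \<longlonglongrightarrow>
      ennreal ((\<Prod>i<length w. weight (Suc i) (w ! i)) * (Z_inf / Z 0))"
    using Z_pos[of 0] by (intro tendsto_ennrealI tendsto_intros Z_tendsto) simp
  then show "(\<lambda>N. \<integral>\<^sup>+x. indicator (cylinder w) x * ennreal (\<Prod>i<N. G (Suc i) (x i)) \<partial>wt.P) \<longlonglongrightarrow>
      ennreal ((\<Prod>i<length w. weight (Suc i) (w ! i)) * (Z_inf / Z 0))"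
    by (rule Lim_transform_eventually)
      (use eventually_ge_at_top[of "length w"] in \<open>eventually_elim, simp add: nn_integral_cylinder_partial\<close>)
qed

theorem ruelle_dual_product_type_measure:
  "ruelle_dual (\<lambda>x. ln (pot x)) (product_type_measure weight) =
    scale_measure (ennreal (g0 * Z_inf)) (product_type_measure weight)"
proof (rule ruelle_dual_eqI)
  interpret prob_space wt.P by (rule wt.prob_space_product_type_measure)
  show "finite_measure wt.P" by (rule finite_measure_axioms)
  show sets_P: "sets wt.P = sets borel"
    by (simp add: wt.sets_product_type_measure sets_PiM_count_space_eq_borel)
  note [measurable_cong] = sets_P
  show "finite_measure (scale_measure (ennreal (g0 * Z_inf)) wt.P)"
    by (rule finite_measureI) (simp add: space_scale_measure emeasure_space_1[unfolded wt.space_product_type_measure] ennreal_mult_eq_top_iff)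
  have [measurable]: "cylinder w \<in> sets borel" for w :: "'a list" by (intro borel_open open_cylinder)
  show "(\<lambda>a. exp (ln (pot (case_nat a x)))) summable_on UNIV" for x
  proof -
    have "(\<lambda>a. (g0 * exp (\<Sum>i. ln (G (Suc i) (x i)))) * G 0 a) summable_on UNIV"
      using summable_G0 unfolding summable_potential_def by (rule summable_on_cmult_right)
    then show ?thesis by (simp only: exp_ln_pot) (simp add: pot_case_nat mult_ac)
  qed
  show "emeasure (scale_measure (ennreal (g0 * Z_inf)) wt.P) (cylinder (a # w)) =
      (\<integral>\<^sup>+x. indicator (cylinder w) x * ennreal (exp (ln (pot (case_nat a x)))) \<partial>wt.P)" for a w
  proof -
    have "(\<integral>\<^sup>+x. indicator (cylinder w) x * ennreal (exp (ln (pot (case_nat a x)))) \<partial>wt.P) =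
        (\<integral>\<^sup>+x. ennreal (g0 * G 0 a) * (indicator (cylinder w) x * ennreal (exp (\<Sum>i. ln (G (Suc i) (x i))))) \<partial>wt.P)"
      by (intro nn_integral_cong) (simp add: pot_case_nat ennreal_mult g0_pos G_pos order_less_imp_le mult_ac)
    also have "\<dots> = ennreal (g0 * G 0 a) * ennreal ((\<Prod>i<length w. weight (Suc i) (w ! i)) * (Z_inf / Z 0))"
      by (subst nn_integral_cmult) (simp_all add: nn_integral_cylinder)
    also have "\<dots> = ennreal ((g0 * G 0 a) * ((\<Prod>i<length w. weight (Suc i) (w ! i)) * (Z_inf / Z 0)))"
      by (rule ennreal_mult[symmetric])
        (auto simp: g0_pos G_pos Z_pos Z_inf_pos wt.weight_nonneg order_less_imp_le intro!: mult_nonneg_nonneg prod_nonneg divide_nonneg_nonneg)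
    \<comment> \<open>\<open>G 0 a / Z 0\<close> is \<open>weight 0 a\<close>, the weight of the
      prepended letter; the letters of \<open>w\<close> already carry the weights of their new
      positions.\<close>
    also have "(g0 * G 0 a) * ((\<Prod>i<length w. weight (Suc i) (w ! i)) * (Z_inf / Z 0)) =
        (g0 * Z_inf) * (\<Prod>i<length (a # w). weight i ((a # w) ! i))"
      by (simp add: prod.lessThan_Suc_shift weight_def[of 0] pprod_def del: prod.lessThan_Suc)
    also have "ennreal \<dots> = ennreal (g0 * Z_inf) * emeasure wt.P (cylinder (a # w))"
      unfolding wt.emeasure_cylinder by (rule ennreal_mult)
        (auto simp: g0_pos Z_inf_pos wt.weight_nonneg order_less_imp_le intro!: mult_nonneg_nonneg prod_nonneg)
    finally show ?thesis by simp
  qed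
qed (simp_all add: wt.sets_product_type_measure sets_PiM_count_space_eq_borel)

end

section \<open>Pressure\<close>

text \<open>Cesaro means of a null sequence. Applied to \<open>tail\<close>, it shows that
  \<open>err n\<close> is \<open>o(n)\<close>.\<close>

lemma averages_tendsto_0:
  fixes a :: "nat \<Rightarrow> real"
  assumes "a \<longlonglongrightarrow> 0" "\<And>k. a k \<ge> 0"
  shows "(\<lambda>n. (\<Sum>k<n. a k) / real n) \<longlonglongrightarrow> 0"
proof (rule LIMSEQ_I)
  fix r :: real assume r: "r > 0"
  then have "\<forall>\<^sub>F k in sequentially. a k < r / 2"
    using order_tendstoD(2)[OF assms(1), of "r / 2"] by simp
  then obtain N where N: "\<And>k. k \<ge> N \<Longrightarrow> a k < r / 2" by (auto simp: eventually_sequentially)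
  define M where "M = (\<Sum>k<N. a k)"
  obtain N' :: nat where N': "real N' > 2 * M / r" using reals_Archimedean2 by blast
  show "\<exists>no. \<forall>n\<ge>no. norm ((\<Sum>k<n. a k) / real n - 0) < r"
  proof (intro exI allI impI)
    fix n assume n: "n \<ge> max (Suc N) N'"
    have "(\<Sum>k<n. a k) = M + (\<Sum>k\<in>{N..<n}. a k)"
      unfolding M_def using n by (subst sum.union_disjoint[symmetric]) (auto intro!: sum.cong)
    also have "(\<Sum>k\<in>{N..<n}. a k) \<le> (\<Sum>k\<in>{N..<n}. r / 2)"
      using N by (intro sum_mono) (auto intro: order_less_imp_le)
    also have "(\<Sum>k\<in>{N..<n}. r / 2) \<le> real n * (r / 2)"
      using r by (simp add: mult_right_mono)
    finally have "(\<Sum>k<n. a k) \<le> M + real n * (r / 2)" by simp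
    moreover have "real n > 2 * M / r" using N' n by simp
    then have "M < real n * (r / 2)" using r by (simp add: field_simps)
    ultimately have "(\<Sum>k<n. a k) < real n * r" by linarith
    moreover have "(\<Sum>k<n. a k) \<ge> 0" using assms(2) by (intro sum_nonneg) auto
    ultimately show "norm ((\<Sum>k<n. a k) / real n - 0) < r"
      using n by (simp add: divide_less_eq mult.commute)
  qed
qed

lemma nn_integral_count_space_imp_has_sum:
  fixes f :: "'a \<Rightarrow> real"
  assumes "\<And>x. x \<in> A \<Longrightarrow> f x \<ge> 0" "s \<ge> 0" "(\<integral>\<^sup>+x. ennreal (f x) \<partial>count_space A) = ennreal s"
  shows "(f has_sum s) A"
proof -
  have int: "integrable (count_space A) f"
    using assms by (intro integrableI_nonneg) (auto simp: AE_count_space ennreal_less_top)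
  then have f: "Infinite_Set_Sum.abs_summable_on f A"
    by (simp add: Infinite_Set_Sum.abs_summable_on_def)
  then have "Infinite_Sum.abs_summable_on f A"
    by (rule abs_summable_equivalent[THEN iffD2])
  then have "f summable_on A" using summable_on_iff_abs_summable_on_real by blast
  moreover have "infsum f A = s"
  proof -
    have "infsum f A = (\<integral>x. f x \<partial>count_space A)"
      using infsetsum_infsum[OF f] by (simp add: infsetsum_def)
    also have "\<dots> = enn2real (\<integral>\<^sup>+x. ennreal (f x) \<partial>count_space A)"
      using assms(1) by (intro integral_eq_nn_integral) (auto simp: AE_count_space)
    finally show ?thesis using assms by simp
  qed
  ultimately show ?thesis using has_sum_infsum by metis
qed

lemma infsum_ennreal_eqI:
  fixes f :: "'a \<Rightarrow> real"
  assumes "(f has_sum s) A" "\<And>x. x \<in> A \<Longrightarrow> f x \<ge> 0"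
  shows "(\<Sum>\<^sub>\<infinity>x\<in>A. ennreal (f x)) = ennreal s"
proof -
  have "(\<Sum>\<^sub>\<infinity>x\<in>A. ennreal (f x)) = (SUP F\<in>{F. finite F \<and> F \<subseteq> A}. \<Sum>x\<in>F. ennreal (f x))"
    by (rule nonneg_infsum_complete) simp
  also have "\<dots> = (SUP F\<in>{F. finite F \<and> F \<subseteq> A}. ennreal (sum f F))"
    using assms(2) by (intro SUP_cong refl sum_ennreal) auto
  also have "\<dots> = ennreal (infsum f A)"
    using assms by (intro infsum_nonneg_is_SUPREMUM_ennreal[symmetric]) (auto simp: summable_on_def)
  finally show ?thesis using infsumI[OF assms(1)] by simp
qed

text \<open>The cylinders of the words of length \<open>n\<close> partition the space, which has
  mass 1.\<close>

lemma (in product_weights) nn_integral_words: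
  "(\<integral>\<^sup>+w. emeasure (product_type_measure p) (cylinder w) \<partial>count_space {w. length w = n}) = 1"
proof -
  have sets: "cylinder w \<in> sets P" for w
  proof -
    have "{x \<in> space (\<Pi>\<^sub>M i\<in>UNIV. count_space UNIV). \<forall>i<length w. x i = w ! i} \<in> sets (\<Pi>\<^sub>M i\<in>UNIV. count_space (UNIV :: 'a set))"
      by measurable
    then show ?thesis by (simp add: cylinder_def space_PiM sets_product_type_measure)
  qed
  have "emeasure P (\<Union>w\<in>{w. length w = n}. cylinder w) =
      (\<integral>\<^sup>+w. emeasure P (cylinder w) \<partial>count_space {w. length w = n})"
  proof (rule emeasure_UN_countable)
    show "disjoint_family_on cylinder {w :: 'a list. length w = n}"
      unfolding disjoint_family_on_def
    proof (intro ballI impI)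
      fix u v :: "'a list" assume "u \<in> {w. length w = n}" "v \<in> {w. length w = n}" "u \<noteq> v"
      then show "cylinder u \<inter> cylinder v = {}" by (subst cylinder_Int) auto
    qed
  qed (simp_all add: sets)
  moreover have "(\<Union>w\<in>{w. length w = n}. cylinder w) = (UNIV :: (nat \<Rightarrow> 'a) set)"
  proof -
    have "x \<in> cylinder (map x [0..<n])" for x :: "nat \<Rightarrow> 'a" by (simp add: cylinder_def)
    then show ?thesis by (auto intro!: exI[of _ "map _ [0..<n]"])
  qed
  moreover have "emeasure P UNIV = 1"
    using prob_space.emeasure_space_1[OF prob_space_product_type_measure] by simp
  ultimately show ?thesis by simp
qed

lemma cylinder_nonempty: "cylinder w \<noteq> {}"
proof -
  have "(\<lambda>i. w ! i) \<in> cylinder w" by (simp add: cylinder_def)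
  then show ?thesis by blast
qed

section \<open>Birkhoff sums, partition functions and the value of the pressure\<close>

context product_potential
begin

definition site :: "'a \<Rightarrow> real" where
  "site a = g0 * pprod_inf a"

abbreviation lam :: real where
  "lam \<equiv> g0 * Z_inf"

definition err :: "nat \<Rightarrow> real" where
  "err n = (\<Sum>k<n. tail k)"

lemma site_pos: "site a > 0"
  by (simp add: site_def g0_pos pprod_inf_pos)

lemma lam_pos: "lam > 0"
  by (simp add: g0_pos Z_inf_pos)

lemma site_eq: "site a = lam * weight_inf a"
  using Z_inf_pos by (simp add: site_def weight_inf_def)

text \<open>
  Up to \<open>2 * err n = o(n)\<close>, the Birkhoff sum is a sum over the sites \<open>k < n\<close>, where every site has collected
  its complete product \<open>g0 * pprod_inf (x k)\<close>.
\<close>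

lemma birkhoff_sum_ln_pot:
  "\<bar>(\<Sum>i<n. ln (pot ((shift_map ^^ i) x))) - (\<Sum>k<n. ln (site (x k)))\<bar> \<le> 2 * err n"
proof -
  \<comment> \<open>For \<open>i < n\<close>, the part of the \<open>i\<close>-th summand that looks
    at sites \<open>i + j >= n\<close>, beyond the word under consideration.\<close>
  define D where "D i = (\<Sum>j. ln (G j (x (j + i)))) - (\<Sum>j\<le>n - Suc i. ln (G j (x (j + i))))" for i
  have D: "\<bar>D i\<bar> \<le> tail (n - Suc i)" for i
    unfolding D_def
    using suminf_ln_G_split[of "\<lambda>j. x (j + i)" "n - Suc i"]
      abs_suminf_ln_G_tail[of "n - Suc i" "\<lambda>j. x (Suc (j + (n - Suc i)) + i)"] by simp
  \<comment> \<open>Regroup the triangle \<open>i + j < n\<close> by the site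
    \<open>k = i + j\<close>: within these \<open>n\<close> shifts, site \<open>k\<close> meets
    exactly the factors \<open>G 0\<close>, ..., \<open>G k\<close>.\<close>
  have "(\<Sum>i<n. \<Sum>j\<le>n - Suc i. ln (G j (x (j + i)))) = (\<Sum>(i, j)\<in>Sigma {..<n} (\<lambda>i. {..n - Suc i}). ln (G j (x (j + i))))"
    by (rule sum.Sigma) auto
  also have "Sigma {..<n} (\<lambda>i. {..n - Suc i}) = {(i, j). i + j < n}" by auto
  also have "(\<Sum>(i, j)\<in>{(i, j). i + j < n}. ln (G j (x (j + i)))) = (\<Sum>k<n. \<Sum>i\<le>k. ln (G (k - i) (x (k - i + i))))"
    by (rule sum.triangle_reindex)
  also have "\<dots> = (\<Sum>k<n. \<Sum>j\<le>k. ln (G j (x k)))"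
  proof (rule sum.cong[OF refl])
    fix k
    have "(\<Sum>i\<le>k. ln (G (k - i) (x (k - i + i)))) = (\<Sum>i\<le>k. ln (G (k - i) (x k)))"
      by (intro sum.cong) auto
    also have "\<dots> = (\<Sum>j\<le>k. ln (G j (x k)))"
      by (rule sum.reindex_bij_witness[where i = "\<lambda>i. k - i" and j = "\<lambda>i. k - i"]) auto
    finally show "(\<Sum>i\<le>k. ln (G (k - i) (x (k - i + i)))) = (\<Sum>j\<le>k. ln (G j (x k)))" .
  qed
  finally have triangle: "(\<Sum>i<n. \<Sum>j\<le>n - Suc i. ln (G j (x (j + i)))) = (\<Sum>k<n. ln (pprod k (x k)))"
    by (simp add: ln_pprod)
  have "(\<Sum>i<n. ln (pot ((shift_map ^^ i) x))) = (\<Sum>i<n. ln g0 + ((\<Sum>j\<le>n - Suc i. ln (G j (x (j + i)))) + D i))"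
    by (simp add: ln_pot funpow_shift_map D_def)
  also have "\<dots> = (\<Sum>i<n. ln g0) + ((\<Sum>k<n. ln (pprod k (x k))) + (\<Sum>i<n. D i))"
    by (simp add: sum.distrib triangle)
  finally have 1: "(\<Sum>i<n. ln (pot ((shift_map ^^ i) x))) = (\<Sum>i<n. ln g0) + ((\<Sum>k<n. ln (pprod k (x k))) + (\<Sum>i<n. D i))" .
  have 2: "(\<Sum>k<n. ln (site (x k))) = (\<Sum>k<n. ln g0) + (\<Sum>k<n. ln (pprod_inf (x k)))"
    by (simp add: site_def ln_mult_pos[OF g0_pos pprod_inf_pos] sum.distrib)
  have "\<bar>\<Sum>i<n. D i\<bar> \<le> (\<Sum>i<n. tail (n - Suc i))"
    by (intro order_trans[OF sum_abs] sum_mono D)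
  also have "\<dots> = err n" unfolding err_def by (rule sum.nat_diff_reindex)
  finally have 3: "\<bar>\<Sum>i<n. D i\<bar> \<le> err n" .
  \<comment> \<open>The second error of size \<open>err n\<close>: site \<open>k\<close> has
    collected \<open>pprod k\<close> instead of \<open>pprod_inf\<close>. Together with
    \<open>D\<close> this explains the factor 2 in the bound.\<close>
  have "\<bar>\<Sum>k<n. ln (pprod_inf (x k)) - ln (pprod k (x k))\<bar> \<le> (\<Sum>k<n. tail k)"
    by (intro order_trans[OF sum_abs] sum_mono abs_ln_pprod_inf_minus)
  then have 4: "\<bar>(\<Sum>k<n. ln (pprod_inf (x k))) - (\<Sum>k<n. ln (pprod k (x k)))\<bar> \<le> err n"
    by (simp add: err_def sum_subtractf)
  from 1 2 3 4 show ?thesis by linarith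
qed

text \<open>After division by \<open>lam\<close> each site carries the probability
  \<open>weight_inf\<close>, so the sum over words is \<open>lam ^ n\<close> times a total mass of
  1. Infinite alphabets are covered by the same argument.\<close>

lemma has_sum_words: "((\<lambda>w. \<Prod>k<n. site (w ! k)) has_sum lam ^ n) {w. length w = n}"
proof -
  have "((\<lambda>w. \<Prod>k<length w. weight_inf (w ! k)) has_sum 1) {w. length w = n}"
    using wt_inf.nn_integral_words[of n]
    by (intro nn_integral_count_space_imp_has_sum)
      (simp_all add: wt_inf.emeasure_cylinder wt_inf.weight_nonneg prod_nonneg)
  then have "((\<lambda>w. lam ^ n * (\<Prod>k<length w. weight_inf (w ! k))) has_sum lam ^ n * 1) {w. length w = n}"
    by (rule has_sum_cmult_right)
  also have "((\<lambda>w. lam ^ n * (\<Prod>k<length w. weight_inf (w ! k))) has_sum lam ^ n * 1) {w. length w = n} \<longleftrightarrow>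
      ((\<lambda>w. \<Prod>k<n. site (w ! k)) has_sum lam ^ n * 1) {w. length w = n}"
    by (intro has_sum_cong) (auto simp: site_eq prod.distrib)
  finally show ?thesis by simp
qed

text \<open>The product of the \<open>site\<close> values depends on the word alone, so the Birkhoff
  estimate controls the supremum over the whole cylinder; for the lower bound one point of the
  cylinder is enough.\<close>

lemma partition_function_bounds:
  "ennreal (exp (- 2 * err n) * lam ^ n) \<le> partition_function (\<lambda>x. ln (pot x)) n"
  "partition_function (\<lambda>x. ln (pot x)) n \<le> ennreal (exp (2 * err n) * lam ^ n)"
proof -
  let ?S = "\<lambda>w. SUP x\<in>cylinder w. ennreal (\<Prod>i<n. exp (ln (pot ((shift_map ^^ i) x))))"
  have site: "(\<Prod>k<n. site (w ! k)) = exp (\<Sum>k<n. ln (site (x k)))"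
    if "x \<in> cylinder w" "length w = n" for x w
    using that by (simp add: exp_sum site_pos cylinder_def)
  have sc: "((\<lambda>w. c * (\<Prod>k<n. site (w ! k))) has_sum c * lam ^ n) {w. length w = n}" for c
    by (intro has_sum_cmult_right has_sum_words)
  have nn: "0 \<le> exp c * (\<Prod>k<n. site (w ! k))" for c w
    by (simp add: prod_nonneg site_pos order_less_imp_le)
  have "(\<Sum>\<^sub>\<infinity>w\<in>{w. length w = n}. ennreal (exp (- 2 * err n) * (\<Prod>k<n. site (w ! k)))) \<le> (\<Sum>\<^sub>\<infinity>w\<in>{w. length w = n}. ?S w)"
  proof (rule infsum_mono)
    fix w :: "'a list" assume w: "w \<in> {w. length w = n}"
    obtain x where x: "x \<in> cylinder w" using cylinder_nonempty by blast
    have "- 2 * err n + (\<Sum>k<n. ln (site (x k))) \<le> (\<Sum>i<n. ln (pot ((shift_map ^^ i) x)))"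
      using birkhoff_sum_ln_pot[where n = n and x = x] by linarith
    then have "exp (- 2 * err n + (\<Sum>k<n. ln (site (x k)))) \<le> exp (\<Sum>i<n. ln (pot ((shift_map ^^ i) x)))"
      by (simp only: exp_le_cancel_iff)
    then have "exp (- 2 * err n) * (\<Prod>k<n. site (w ! k)) \<le> (\<Prod>i<n. exp (ln (pot ((shift_map ^^ i) x))))"
      using site[OF x] w by (simp only: exp_add exp_sum[symmetric] finite_lessThan mem_Collect_eq)
    then show "ennreal (exp (- 2 * err n) * (\<Prod>k<n. site (w ! k))) \<le> ?S w"
      by (intro SUP_upper2[OF x] ennreal_leI)
  qed (rule nonneg_summable_on_complete, simp)+
  then show "ennreal (exp (- 2 * err n) * lam ^ n) \<le> partition_function (\<lambda>x. ln (pot x)) n"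
    unfolding partition_function_def by (subst (asm) infsum_ennreal_eqI[OF sc nn])
  have "(\<Sum>\<^sub>\<infinity>w\<in>{w. length w = n}. ?S w) \<le> (\<Sum>\<^sub>\<infinity>w\<in>{w. length w = n}. ennreal (exp (2 * err n) * (\<Prod>k<n. site (w ! k))))"
  proof (rule infsum_mono)
    fix w :: "'a list" assume w: "w \<in> {w. length w = n}"
    show "?S w \<le> ennreal (exp (2 * err n) * (\<Prod>k<n. site (w ! k)))"
    proof (rule SUP_least)
      fix x assume x: "x \<in> cylinder w"
      have "(\<Sum>i<n. ln (pot ((shift_map ^^ i) x))) \<le> 2 * err n + (\<Sum>k<n. ln (site (x k)))"
        using birkhoff_sum_ln_pot[where n = n and x = x] by linarith
      then have "exp (\<Sum>i<n. ln (pot ((shift_map ^^ i) x))) \<le> exp (2 * err n + (\<Sum>k<n. ln (site (x k))))"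
        by (simp only: exp_le_cancel_iff)
      then have "(\<Prod>i<n. exp (ln (pot ((shift_map ^^ i) x)))) \<le> exp (2 * err n) * (\<Prod>k<n. site (w ! k))"
        using site[OF x] w by (simp only: exp_add exp_sum[symmetric] finite_lessThan mem_Collect_eq)
      then show "ennreal (\<Prod>i<n. exp (ln (pot ((shift_map ^^ i) x)))) \<le> ennreal (exp (2 * err n) * (\<Prod>k<n. site (w ! k)))"
        by (rule ennreal_leI)
    qed
  qed (rule nonneg_summable_on_complete, simp)+
  then show "partition_function (\<lambda>x. ln (pot x)) n \<le> ennreal (exp (2 * err n) * lam ^ n)"
    unfolding partition_function_def by (subst (asm) infsum_ennreal_eqI[OF sc nn])
qed

theorem pressure_seq_tendsto: "pressure_seq (\<lambda>x. ln (pot x)) \<longlonglongrightarrow> ereal (ln lam)"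
proof -
  define z where "z n = enn2real (partition_function (\<lambda>x. ln (pot x)) n)" for n
  have fin: "partition_function (\<lambda>x. ln (pot x)) n = ennreal (z n)" for n
    unfolding z_def using partition_function_bounds(2)[of n]
    by (metis ennreal_enn2real ennreal_less_top le_less_trans)
  have z_nonneg: "z n \<ge> 0" for n by (simp add: z_def)
  have lo: "exp (- 2 * err n) * lam ^ n \<le> z n" for n
    using partition_function_bounds(1)[of n] z_nonneg[of n] unfolding fin by (simp add: ennreal_le_iff)
  have hi: "z n \<le> exp (2 * err n) * lam ^ n" for n
    using partition_function_bounds(2)[of n] lam_pos unfolding fin by (subst (asm) ennreal_le_iff) auto
  have z_pos: "z n > 0" for n
    using lo[of n] lam_pos by (intro less_le_trans[OF _ lo]) simp
  have "- 2 * err n + real n * ln lam \<le> ln (z n)" for n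
  proof -
    have "ln (exp (- 2 * err n) * lam ^ n) \<le> ln (z n)"
      using lo[of n] z_pos[of n] lam_pos by (subst ln_le_cancel_iff) simp_all
    then show ?thesis using lam_pos by (simp add: ln_mult_pos ln_realpow)
  qed
  moreover have "ln (z n) \<le> 2 * err n + real n * ln lam" for n
  proof -
    have "ln (z n) \<le> ln (exp (2 * err n) * lam ^ n)"
      using hi[of n] z_pos[of n] lam_pos by (subst ln_le_cancel_iff) simp_all
    then show ?thesis using lam_pos by (simp add: ln_mult_pos ln_realpow)
  qed
  ultimately have *: "\<bar>ln (z n) - real n * ln lam\<bar> \<le> 2 * err n" for n
    by (smt (verit))
  have "(\<lambda>n. ln (z n) / real n - ln lam) \<longlonglongrightarrow> 0"
  proof (rule Lim_null_comparison)
    show "(\<lambda>n. 2 * (err n / real n)) \<longlonglongrightarrow> 0"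
      unfolding err_def using averages_tendsto_0[OF tail_tendsto_0 tail_nonneg] by (rule tendsto_mult_right_zero)
    show "\<forall>\<^sub>F n in sequentially. norm (ln (z n) / real n - ln lam) \<le> 2 * (err n / real n)"
      using eventually_gt_at_top[of "0::nat"]
    proof eventually_elim
      case (elim n)
      have "ln (z n) / real n - ln lam = (ln (z n) - real n * ln lam) / real n"
        using elim by (simp add: field_simps)
      then have "norm (ln (z n) / real n - ln lam) = \<bar>ln (z n) - real n * ln lam\<bar> / real n"
        by simp
      also have "\<dots> \<le> 2 * err n / real n" using * by (intro divide_right_mono) auto
      finally show ?case by simp
    qed
  qed
  then have "(\<lambda>n. ln (z n) / real n) \<longlonglongrightarrow> ln lam" by (simp add: LIM_zero_iff)
  then have "(\<lambda>n. ereal (ln (z n) / real n)) \<longlonglongrightarrow> ereal (ln lam)" by simp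
  moreover have "pressure_seq (\<lambda>x. ln (pot x)) = (\<lambda>n. ereal (ln (z n) / real n))"
  proof (intro ext)
    fix n
    have "partition_function (\<lambda>x. ln (pot x)) n \<noteq> 0" "partition_function (\<lambda>x. ln (pot x)) n \<noteq> \<infinity>"
      using z_pos[of n] by (simp_all add: fin)
    then have "ln_ennreal (partition_function (\<lambda>x. ln (pot x)) n) = ereal (ln (z n))"
      by (simp add: ln_ennreal_def z_def)
    then show "pressure_seq (\<lambda>x. ln (pot x)) n = ereal (ln (z n) / real n)"
      by (simp add: pressure_seq_def)
  qed
  ultimately show ?thesis by simp
qed

end

section \<open>Entropy of finite partitions\<close>

text \<open>Fekete's lemma on subadditive sequences, with limit \<open>L\<close> the infimum of
  \<open>a n / n\<close>. It guarantees that the \<open>lim\<close> in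
  \<open>partition_ks_entropy\<close> is a genuine limit.\<close>

lemma fekete:
  fixes a :: "nat \<Rightarrow> real"
  assumes sub: "\<And>m n. a (m + n) \<le> a m + a n" and nonneg: "\<And>n. 0 \<le> a n"
  shows "convergent (\<lambda>n. a n / real n)"
proof -
  define L where "L = (INF n\<in>{1..}. a n / real n)"
  have bdd: "bdd_below ((\<lambda>n. a n / real n) ` {1..})"
    using nonneg by (intro bdd_belowI[of _ 0]) auto
  have lower: "L \<le> a n / real n" if "n \<ge> 1" for n
    unfolding L_def using that by (intro cINF_lower bdd) auto
  \<comment> \<open>Prepares the division \<open>n = q * k + r\<close> by a nearly optimal block
    length \<open>k\<close>.\<close>
  have mult: "a (q * k + r) \<le> real q * a k + a r" for q k r
  proof (induction q)
    case (Suc q)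
    have "a (Suc q * k + r) \<le> a k + a (q * k + r)" using sub[of k "q * k + r"] by (simp add: add.assoc)
    with Suc show ?case by (simp add: algebra_simps)
  qed simp
  have "(\<lambda>n. a n / real n) \<longlonglongrightarrow> L"
  proof (rule LIMSEQ_I)
    fix e :: real assume e: "e > 0"
    have "\<exists>k\<in>{1..}. a k / real k < L + e / 2"
      unfolding L_def using e by (intro cINF_less_iff[THEN iffD1] bdd) (auto simp: L_def[symmetric])
    then obtain k where k: "k \<ge> 1" "a k / real k < L + e / 2" by auto
    \<comment> \<open>A bound for all remainder terms \<open>a r\<close> with \<open>r < k\<close>,
      independent of \<open>n\<close>.\<close>
    define C where "C = (\<Sum>r<k. a r)"
    have C: "a r \<le> C" if "r < k" for r
      unfolding C_def using that nonneg by (intro member_le_sum) auto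
    have C0: "C \<ge> 0" unfolding C_def by (intro sum_nonneg nonneg)
    obtain N :: nat where N: "real N > 2 * C / e" using reals_Archimedean2 by blast
    show "\<exists>no. \<forall>n\<ge>no. norm (a n / real n - L) < e"
    proof (intro exI allI impI)
      fix n assume n: "n \<ge> max 1 N"
      have "a n \<le> real (n div k) * a k + a (n mod k)"
        using mult[of "n div k" k "n mod k"] by simp
      also have "a (n mod k) \<le> C" using k by (intro C) simp
      finally have 1: "a n \<le> real (n div k) * a k + C" by simp
      have "real (n div k * k) \<le> real n" by (intro of_nat_mono) simp
      then have "real (n div k) \<le> real n / real k" using k by (simp add: le_divide_eq)
      then have "real (n div k) * a k \<le> (real n / real k) * a k" by (intro mult_right_mono nonneg)
      also have "\<dots> = real n * (a k / real k)" by simp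
      also have "\<dots> \<le> real n * (L + e / 2)" using k by (intro mult_left_mono) auto
      finally have 2: "a n \<le> real n * (L + e / 2) + C" using 1 by simp
      have "real n > 2 * C / e" using N n by simp
      then have "C < real n * (e / 2)" using e by (simp add: field_simps)
      with 2 have "a n < real n * (L + e)" by (simp add: algebra_simps)
      then have "a n / real n < L + e" using n by (simp add: divide_less_eq mult.commute)
      with lower[of n] n show "norm (a n / real n - L) < e" by simp
    qed
  qed
  then show ?thesis by (auto simp: convergent_def)
qed

context prob_space
begin

definition law :: "('a \<Rightarrow> 'l) \<Rightarrow> 'l \<Rightarrow> real" where
  "law \<xi> z = measure M (\<xi> -` {z} \<inter> space M)"

lemma law_nonneg: "0 \<le> law \<xi> z"
  by (simp add: law_def)

lemma law_le_1: "law \<xi> z \<le> 1"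
  by (simp add: law_def)

lemma
  fixes f :: "'l \<Rightarrow> real"
  assumes "simple_function M \<xi>"
  shows integrable_simple: "integrable M (\<lambda>x. f (\<xi> x))"
    and integral_simple: "(\<integral>x. f (\<xi> x) \<partial>M) = (\<Sum>z\<in>\<xi> ` space M. f z * law \<xi> z)"
proof -
  have fin: "finite (\<xi> ` space M)" using assms by (rule simple_functionD)
  have [measurable]: "\<xi> -` {z} \<inter> space M \<in> sets M" for z using assms by (rule simple_functionD)
  have eq: "f (\<xi> x) = (\<Sum>z\<in>\<xi> ` space M. f z * indicator (\<xi> -` {z} \<inter> space M) x)" if "x \<in> space M" for x
  proof -
    have "(\<Sum>z\<in>\<xi> ` space M. f z * indicator (\<xi> -` {z} \<inter> space M) x) = (\<Sum>z\<in>{\<xi> x}. f z * indicator (\<xi> -` {z} \<inter> space M) x)"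
      using that fin by (intro sum.mono_neutral_right) (auto simp: indicator_def)
    then show ?thesis using that by simp
  qed
  have int: "integrable M (\<lambda>x. f z * indicator (\<xi> -` {z} \<inter> space M) x)" for z
    by (intro integrable_mult_right integrable_real_indicator) (auto simp: less_top[symmetric])
  have "integrable M (\<lambda>x. \<Sum>z\<in>\<xi> ` space M. f z * indicator (\<xi> -` {z} \<inter> space M) x)"
    by (intro Bochner_Integration.integrable_sum int)
  then show "integrable M (\<lambda>x. f (\<xi> x))"
    using eq by (subst Bochner_Integration.integrable_cong[OF refl]) auto
  have "(\<integral>x. f (\<xi> x) \<partial>M) = (\<integral>x. (\<Sum>z\<in>\<xi> ` space M. f z * indicator (\<xi> -` {z} \<inter> space M) x) \<partial>M)"
    using eq by (intro Bochner_Integration.integral_cong) auto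
  also have "\<dots> = (\<Sum>z\<in>\<xi> ` space M. \<integral>x. f z * indicator (\<xi> -` {z} \<inter> space M) x \<partial>M)"
    by (intro Bochner_Integration.integral_sum int)
  also have "\<dots> = (\<Sum>z\<in>\<xi> ` space M. f z * law \<xi> z)"
    by (simp add: law_def)
  finally show "(\<integral>x. f (\<xi> x) \<partial>M) = (\<Sum>z\<in>\<xi> ` space M. f z * law \<xi> z)" .
qed

lemma sum_law: "simple_function M \<xi> \<Longrightarrow> (\<Sum>z\<in>\<xi> ` space M. law \<xi> z) = 1"
  using integral_simple[of \<xi> "\<lambda>_. 1"] by (simp add: prob_space)

lemma labelling_entropy_sum:
  assumes "simple_function M \<xi>"
  shows "labelling_entropy M \<xi> = - (\<Sum>z\<in>\<xi> ` space M. law \<xi> z * ln (law \<xi> z))"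
proof -
  interpret information_space M "exp 1" by unfold_locales simp
  have "simple_distributed M \<xi> (law \<xi>)"
    by (rule simple_distributedI[OF assms]) (simp_all add: law_def)
  then show ?thesis
    unfolding labelling_entropy_def by (subst entropy_simple_distributed) (simp_all add: log_def)
qed

lemma labelling_entropy_eq:
  assumes "simple_function M \<xi>"
  shows "labelling_entropy M \<xi> = (\<integral>x. - ln (law \<xi> (\<xi> x)) \<partial>M)"
  unfolding labelling_entropy_sum[OF assms] integral_simple[OF assms, where f = "\<lambda>z. - ln (law \<xi> z)"]
  by (simp add: sum_negf[symmetric] mult.commute)

lemma labelling_entropy_nonneg: "simple_function M \<xi> \<Longrightarrow> 0 \<le> labelling_entropy M \<xi>"
  unfolding labelling_entropy_sum sum_negf[symmetric]
  by (intro sum_nonneg) (use law_le_1 law_nonneg ln_le_zero_iff in \<open>auto simp: mult_le_0_iff not_le less_le\<close>)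

text \<open>Gibbs' inequality, from \<open>ln t <= t - 1\<close> at
  \<open>t = q z / law \<xi> z\<close>. Mass at most 1 is allowed for \<open>q\<close>, so
  comparison weights can be defined by explicit formulas without normalisation. Both subadditivity
  and the general entropy bound are instances of it.\<close>

lemma labelling_entropy_le_cross:
  assumes \<xi>: "simple_function M \<xi>" and nonneg: "\<And>z. 0 \<le> q z"
    and pos: "\<And>z. 0 < law \<xi> z \<Longrightarrow> 0 < q z" and sum: "(\<Sum>z\<in>\<xi> ` space M. q z) \<le> 1"
  shows "labelling_entropy M \<xi> \<le> (\<integral>x. - ln (q (\<xi> x)) \<partial>M)"
proof -
  have "law \<xi> z * ln (q z) - law \<xi> z * ln (law \<xi> z) \<le> q z - law \<xi> z" for z
  proof (cases "law \<xi> z = 0")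
    case False
    then have p: "law \<xi> z > 0" using law_nonneg[of \<xi> z] by simp
    then have "ln (q z / law \<xi> z) \<le> q z / law \<xi> z - 1"
      using pos by (intro ln_le_minus_one) simp
    then have "law \<xi> z * ln (q z / law \<xi> z) \<le> law \<xi> z * (q z / law \<xi> z - 1)"
      using p by (intro mult_left_mono) auto
    then show ?thesis using p pos[OF p] by (simp add: ln_div algebra_simps)
  qed (simp add: nonneg)
  then have "(\<Sum>z\<in>\<xi> ` space M. law \<xi> z * ln (q z) - law \<xi> z * ln (law \<xi> z)) \<le> (\<Sum>z\<in>\<xi> ` space M. q z - law \<xi> z)"
    by (rule sum_mono)
  also have "\<dots> \<le> 0" using sum sum_law[OF \<xi>] by (simp add: sum_subtractf)
  finally show ?thesis
    unfolding labelling_entropy_sum[OF \<xi>] integral_simple[OF \<xi>, where f = "\<lambda>z. - ln (q z)"]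
    by (simp add: sum_subtractf sum_negf mult.commute)
qed

end

section \<open>Itineraries under a measure-preserving map and subadditivity of their entropy\<close>

locale measure_preserving_map = prob_space M for M :: "'x measure" +
  fixes S :: "'x \<Rightarrow> 'x"
  assumes measurable_S [measurable]: "S \<in> M \<rightarrow>\<^sub>M M" and distr_S: "distr M M S = M"
begin

lemma measurable_S_pow [measurable]: "(S ^^ n) \<in> M \<rightarrow>\<^sub>M M"
  by (rule measurable_compose_n) (rule measurable_S)

lemma distr_S_pow: "distr M M (S ^^ n) = M"
proof (induction n)
  case (Suc n)
  have "distr M M (S ^^ Suc n) = distr (distr M M (S ^^ n)) M S"
    by (subst distr_distr) (auto simp: o_def)
  then show ?case by (simp only: Suc distr_S)
qed (simp add: distr_id2)

lemma integral_S_pow: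
  fixes f :: "'x \<Rightarrow> real"
  assumes [measurable]: "f \<in> borel_measurable M"
  shows "(\<integral>x. f ((S ^^ n) x) \<partial>M) = (\<integral>x. f x \<partial>M)"
  by (subst (2) distr_S_pow[of n, symmetric]) (simp add: integral_distr)

lemma integrable_S_pow:
  fixes f :: "'x \<Rightarrow> real"
  assumes "integrable M f"
  shows "integrable M (\<lambda>x. f ((S ^^ n) x))"
  by (rule integrable_distr[OF measurable_S_pow]) (simp add: distr_S_pow assms)

lemma S_pow_in_space: "x \<in> space M \<Longrightarrow> (S ^^ n) x \<in> space M"
  using measurable_space[OF measurable_S_pow] .

lemma itinerary_add: "itinerary S \<xi> (m + n) x = itinerary S \<xi> m x @ itinerary S \<xi> n ((S ^^ m) x)"
proof (rule nth_equalityI)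
  show "itinerary S \<xi> (m + n) x ! i = (itinerary S \<xi> m x @ itinerary S \<xi> n ((S ^^ m) x)) ! i"
    if "i < length (itinerary S \<xi> (m + n) x)" for i
  proof (cases "i < m")
    case False
    then obtain j where "i = m + j" using le_Suc_ex not_less by blast
    moreover have "(S ^^ (m + j)) x = (S ^^ j) ((S ^^ m) x)"
      by (subst add.commute) (simp add: funpow_add)
    ultimately show ?thesis using that by (simp add: itinerary_def nth_append)
  qed (simp add: itinerary_def nth_append)
qed (simp add: itinerary_def)

lemma simple_function_S_pow: "simple_function M \<xi> \<Longrightarrow> simple_function M (\<lambda>x. \<xi> ((S ^^ n) x))"
  by (rule simple_function_comp[OF measurable_S_pow])

lemma simple_function_itinerary:
  assumes "simple_function M \<xi>"
  shows "simple_function M (itinerary S \<xi> n)"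
proof (induction n)
  case (Suc n)
  have "itinerary S \<xi> (Suc n) = (\<lambda>x. itinerary S \<xi> n x @ [\<xi> ((S ^^ n) x)])"
    by (simp add: itinerary_def fun_eq_iff)
  then show ?case
    using simple_function_compose2[OF Suc simple_function_S_pow[OF assms, of n], where h = "\<lambda>v z. v @ [z]"] by simp
qed (simp add: itinerary_def)

lemma law_S_pow: 
  assumes "simple_function M \<xi>"
  shows "law (\<lambda>x. \<xi> ((S ^^ n) x)) z = law \<xi> z"
proof -
  have [measurable]: "\<xi> -` {z} \<inter> space M \<in> sets M" using assms by (rule simple_functionD)
  have "law \<xi> z = measure (distr M M (S ^^ n)) (\<xi> -` {z} \<inter> space M)"
    by (simp add: law_def distr_S_pow)
  also have "\<dots> = measure M ((S ^^ n) -` (\<xi> -` {z} \<inter> space M) \<inter> space M)"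
    by (rule measure_distr) measurable
  also have "(S ^^ n) -` (\<xi> -` {z} \<inter> space M) \<inter> space M = (\<lambda>x. \<xi> ((S ^^ n) x)) -` {z} \<inter> space M"
    using S_pow_in_space by auto
  finally show ?thesis by (simp add: law_def)
qed

lemma length_itinerary [simp]: "length (itinerary S \<xi> n x) = n"
  by (simp add: itinerary_def)

text \<open>Gibbs' inequality with \<open>q\<close> the product of the laws of the first
  \<open>m\<close> and of the last \<open>n\<close> labels. By invariance the last \<open>n\<close>
  labels have the law of \<open>itinerary S \<xi> n\<close>, so the cross entropy is at most the sum
  of the two entropies.\<close>

lemma labelling_entropy_itinerary_subadditive:
  assumes \<xi>: "simple_function M \<xi>"
  shows "labelling_entropy M (itinerary S \<xi> (m + n)) \<le>
    labelling_entropy M (itinerary S \<xi> m) + labelling_entropy M (itinerary S \<xi> n)"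
proof -
  let ?I = "itinerary S \<xi>"
  note sf = simple_function_itinerary[OF \<xi>]
  define q where "q v = law (?I m) (take m v) * law (?I n) (drop m v)" for v
  have split: "take m (?I (m + n) x) = ?I m x" "drop m (?I (m + n) x) = ?I n ((S ^^ m) x)" for x
    by (simp_all add: itinerary_add)
  have q_pos: "0 < q z" if z: "0 < law (?I (m + n)) z" for z
  proof -
    have "law (?I (m + n)) z \<le> law (?I m) (take m z)"
      unfolding law_def using split sf by (intro finite_measure_mono) (auto simp: simple_functionD)
    moreover have "law (?I (m + n)) z \<le> law (\<lambda>x. ?I n ((S ^^ m) x)) (drop m z)"
      unfolding law_def using split simple_function_S_pow[OF sf]
      by (intro finite_measure_mono) (auto simp: simple_functionD)
    ultimately show ?thesis using z by (simp add: q_def law_S_pow[OF sf])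
  qed
  have "(\<Sum>z\<in>?I (m + n) ` space M. q z) \<le> 1"
  proof -
    \<comment> \<open>A word is determined by its two pieces, so the sum of \<open>q\<close> is part
      of the double sum over pairs, which equals 1.\<close>
    have inj: "inj_on (\<lambda>z. (take m z, drop m z)) (?I (m + n) ` space M)"
      by (intro inj_onI) (metis append_take_drop_id prod.inject)
    have "(\<Sum>z\<in>?I (m + n) ` space M. q z) =
        (\<Sum>(u, v)\<in>(\<lambda>z. (take m z, drop m z)) ` ?I (m + n) ` space M. law (?I m) u * law (?I n) v)"
      by (subst sum.reindex[OF inj]) (simp add: q_def o_def)
    also have "\<dots> \<le> (\<Sum>(u, v)\<in>?I m ` space M \<times> ?I n ` space M. law (?I m) u * law (?I n) v)"
      using sf by (intro sum_mono2) (auto simp: simple_functionD split law_nonneg S_pow_in_space)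
    also have "\<dots> = (\<Sum>u\<in>?I m ` space M. law (?I m) u) * (\<Sum>v\<in>?I n ` space M. law (?I n) v)"
      by (simp add: sum_product sum.cartesian_product)
    finally show ?thesis by (simp add: sum_law[OF sf])
  qed
  then have "labelling_entropy M (?I (m + n)) \<le> (\<integral>x. - ln (q (?I (m + n) x)) \<partial>M)"
    using q_pos by (intro labelling_entropy_le_cross sf) (auto simp: q_def law_nonneg)
  also have "\<dots> \<le> (\<integral>x. - ln (law (?I m) (?I m x)) + - ln (law (?I n) (?I n ((S ^^ m) x))) \<partial>M)"
  proof (rule integral_mono)
    show "integrable M (\<lambda>x. - ln (q (?I (m + n) x)))"
      by (rule integrable_simple[OF sf, where f = "\<lambda>v. - ln (q v)"])
    show "integrable M (\<lambda>x. - ln (law (?I m) (?I m x)) + - ln (law (?I n) (?I n ((S ^^ m) x))))"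
      by (intro Bochner_Integration.integrable_add integrable_simple[OF sf, where f = "\<lambda>v. - ln (law _ v)"]
          integrable_simple[OF simple_function_S_pow[OF sf], where f = "\<lambda>v. - ln (law _ v)"])
    fix x
    have "q (?I (m + n) x) = law (?I m) (?I m x) * law (?I n) (?I n ((S ^^ m) x))"
      by (simp add: q_def split)
    moreover have "law (?I m) (?I m x) \<le> 1" "law (?I n) (?I n ((S ^^ m) x)) \<le> 1"
      by (simp_all add: law_le_1)
    moreover have "0 \<le> law (?I m) (?I m x)" "0 \<le> law (?I n) (?I n ((S ^^ m) x))"
      by (simp_all add: law_nonneg)
    ultimately show "- ln (q (?I (m + n) x)) \<le> - ln (law (?I m) (?I m x)) + - ln (law (?I n) (?I n ((S ^^ m) x)))"
      \<comment> \<open>When one of the laws vanishes, the left side is 0 because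
        \<open>ln 0 = 0\<close>, and the right side is a sum of nonnegative terms.\<close>
      by (cases "law (?I m) (?I m x) = 0"; cases "law (?I n) (?I n ((S ^^ m) x)) = 0")
        (auto simp: ln_mult ln_le_zero_iff less_le)
  qed
  also have "\<dots> = (\<integral>x. - ln (law (?I m) (?I m x)) \<partial>M) + (\<integral>x. - ln (law (?I n) (?I n ((S ^^ m) x))) \<partial>M)"
    by (intro Bochner_Integration.integral_add integrable_simple[OF sf, where f = "\<lambda>v. - ln (law _ v)"]
          integrable_simple[OF simple_function_S_pow[OF sf], where f = "\<lambda>v. - ln (law _ v)"])
  also have "(\<integral>x. - ln (law (?I n) (?I n ((S ^^ m) x))) \<partial>M) = (\<integral>x. - ln (law (?I n) (?I n x)) \<partial>M)"
    by (intro integral_S_pow borel_measurable_integrable integrable_simple[OF sf, where f = "\<lambda>v. - ln (law _ v)"])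
  finally show ?thesis by (simp add: labelling_entropy_eq[OF sf])
qed

lemma partition_ks_entropy_LIMSEQ:
  assumes "simple_function M \<xi>"
  shows "(\<lambda>n. labelling_entropy M (itinerary S \<xi> n) / real n) \<longlonglongrightarrow> partition_ks_entropy M S \<xi>"
  unfolding partition_ks_entropy_def
  using fekete[of "\<lambda>n. labelling_entropy M (itinerary S \<xi> n)"] labelling_entropy_itinerary_subadditive[OF assms]
    labelling_entropy_nonneg[OF simple_function_itinerary[OF assms]]
  by (simp add: convergent_LIMSEQ_iff)

end

section \<open>Entropy of invariant measures on the shift\<close>

definition depends_on_first :: "nat \<Rightarrow> ((nat \<Rightarrow> 'a) \<Rightarrow> 'b) \<Rightarrow> bool" where
  "depends_on_first n f \<longleftrightarrow> (\<forall>x y. (\<forall>i<n. x i = y i) \<longrightarrow> f x = f y)"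

lemma depends_on_firstD: "depends_on_first n f \<Longrightarrow> (\<And>i. i < n \<Longrightarrow> x i = y i) \<Longrightarrow> f x = f y"
  unfolding depends_on_first_def by blast

lemma depends_on_first_mono: "depends_on_first m f \<Longrightarrow> m \<le> n \<Longrightarrow> depends_on_first n f"
  unfolding depends_on_first_def by (meson less_le_trans)

lemma measurable_depends_on_first:
  fixes f :: "(nat \<Rightarrow> 'a::{countable, discrete_topology}) \<Rightarrow> 'b"
  assumes "depends_on_first n f"
  shows "f \<in> borel \<rightarrow>\<^sub>M count_space UNIV"
  using depends_on_firstD[OF assms] by (rule measurable_finite_dependence[where n = n]) simp_all

lemma borel_set_depends_on_first:
  fixes B :: "(nat \<Rightarrow> 'a::{countable, discrete_topology}) set"
  assumes "depends_on_first n (\<lambda>x. x \<in> B)"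
  shows "B \<in> sets borel"
  using measurable_sets[OF measurable_depends_on_first[OF assms], of "{True}"] by (simp add: vimage_def)

text \<open>Induction over the sigma-algebra generated by cylinders. Complementation keeps the
  symmetric difference; a countable union is first cut to finitely many sets at cost below
  \<open>e / 2\<close>, and these are then approximated with the other half of the budget.\<close>

lemma approximate_set_by_depends_on_first:
  fixes m :: "(nat \<Rightarrow> 'a::{countable, discrete_topology}) measure"
  assumes "finite_measure m" and sets: "sets m = sets borel" and A: "A \<in> sets borel" and "e > 0"
  shows "\<exists>n B. depends_on_first n (\<lambda>x. x \<in> B) \<and> measure m ((A - B) \<union> (B - A)) < e"
proof -
  interpret finite_measure m by fact
  have sp: "space m = UNIV" using sets by (auto dest: sets_eq_imp_space_eq)
  have "A \<in> sigma_sets UNIV (insert {} (range cylinder))" using A by (simp add: sets_borel_eq_sigma_cylinders)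
  then show ?thesis using \<open>e > 0\<close>
  proof (induction A arbitrary: e rule: sigma_sets.induct)
    case (Basic A)
    then consider "A = {}" | w where "A = cylinder w" by auto
    then show ?case
    proof cases
      case 1
      then show ?thesis using Basic
        by (intro exI[of _ 0] exI[of _ "{}"]) (auto simp: depends_on_first_def)
    next
      case 2
      then show ?thesis using Basic
        by (intro exI[of _ "length w"] exI[of _ "cylinder w"]) (auto simp: depends_on_first_def cylinder_def)
    qed
  next
    case Empty
    then show ?case by (intro exI[of _ 0] exI[of _ "{}"]) (auto simp: depends_on_first_def)
  next
    case (Compl A)
    then obtain n B where "depends_on_first n (\<lambda>x. x \<in> B)" "measure m ((A - B) \<union> (B - A)) < e" by blast
    moreover have "((UNIV - A) - (UNIV - B)) \<union> ((UNIV - B) - (UNIV - A)) = (A - B) \<union> (B - A)" by auto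
    ultimately show ?case
      by (intro exI[of _ n] exI[of _ "UNIV - B"]) (auto simp: depends_on_first_def)
  next
    case (Union A)
    have A_sets [measurable]: "A i \<in> sets m" for i
      using Union.hyps by (simp add: sets sets_borel_eq_sigma_cylinders)
    have "(\<lambda>N. measure m (\<Union>i<N. A i)) \<longlonglongrightarrow> measure m (\<Union>N. \<Union>i<N. A i)"
      by (rule finite_Lim_measure_incseq) (auto simp: incseq_def intro: less_le_trans)
    also have "(\<Union>N. \<Union>i<N. A i) = (\<Union>i. A i)" by auto
    finally have "\<forall>\<^sub>F N in sequentially. measure m (\<Union>i. A i) - e / 2 < measure m (\<Union>i<N. A i)"
      using Union.prems by (intro order_tendstoD(1)) auto
    then obtain N where N: "measure m (\<Union>i. A i) - e / 2 < measure m (\<Union>i<N. A i)"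
      by (auto simp: eventually_sequentially)
    \<comment> \<open>Budget \<open>e / 2\<close> for the \<open>N\<close> sets;
      \<open>N + 1\<close> avoids division by zero.\<close>
    define d where "d = e / (2 * real (N + 1))"
    have d: "d > 0" using Union.prems by (simp add: d_def)
    have "\<forall>i. \<exists>n B. depends_on_first n (\<lambda>x. x \<in> B) \<and> measure m ((A i - B) \<union> (B - A i)) < d"
      using Union.IH[OF d] by blast
    then obtain n B where B: "\<And>i. depends_on_first (n i) (\<lambda>x. x \<in> B i)"
        "\<And>i. measure m ((A i - B i) \<union> (B i - A i)) < d"
      by metis
    have B_sets [measurable]: "B i \<in> sets m" for i
      using borel_set_depends_on_first[OF B(1)] by (simp add: sets)
    define k where "k = (\<Sum>i<N. n i)"
    have "depends_on_first k (\<lambda>x. x \<in> B i)" if "i < N" for i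
      using that by (intro depends_on_first_mono[OF B(1)]) (auto simp: k_def intro: member_le_sum)
    then have "depends_on_first k (\<lambda>x. x \<in> (\<Union>i<N. B i))"
      unfolding depends_on_first_def by blast
    moreover have "measure m (((\<Union>i. A i) - (\<Union>i<N. B i)) \<union> ((\<Union>i<N. B i) - (\<Union>i. A i))) < e"
    proof -
      have "measure m (((\<Union>i. A i) - (\<Union>i<N. B i)) \<union> ((\<Union>i<N. B i) - (\<Union>i. A i))) \<le>
          measure m (((\<Union>i. A i) - (\<Union>i<N. A i)) \<union> (\<Union>i<N. (A i - B i) \<union> (B i - A i)))"
        by (intro finite_measure_mono) auto
      also have "\<dots> \<le> measure m ((\<Union>i. A i) - (\<Union>i<N. A i)) + measure m (\<Union>i<N. (A i - B i) \<union> (B i - A i))"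
        by (intro measure_Un_le) auto
      also have "measure m ((\<Union>i. A i) - (\<Union>i<N. A i)) = measure m (\<Union>i. A i) - measure m (\<Union>i<N. A i)"
        by (intro finite_measure_Diff) auto
      also have "measure m (\<Union>i<N. (A i - B i) \<union> (B i - A i)) \<le> (\<Sum>i<N. measure m ((A i - B i) \<union> (B i - A i)))"
        by (intro finite_measure_subadditive_finite) auto
      also have "\<dots> \<le> (\<Sum>i<N. d)" using B(2) by (intro sum_mono order_less_imp_le) auto
      also have "\<dots> \<le> e / 2" using Union.prems by (simp add: d_def field_simps)
      finally show ?thesis using N by simp
    qed
    ultimately show ?case by blast
  qed
qed

text \<open>Each of the \<open>k\<close> atoms is approximated by a set \<open>B j\<close> to within
  \<open>e / k\<close>. Off the union of the symmetric differences a point lies in exactly one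
  \<open>B j\<close> with \<open>j < k\<close>, the one of its true label.\<close>

lemma approximate_labelling_by_depends_on_first:
  fixes m :: "(nat \<Rightarrow> 'a::{countable, discrete_topology}) measure" and \<xi> :: "(nat \<Rightarrow> 'a) \<Rightarrow> nat"
  assumes "finite_measure m" and sets: "sets m = sets borel"
    and \<xi> [measurable]: "\<xi> \<in> borel \<rightarrow>\<^sub>M count_space UNIV" and k: "\<And>x. \<xi> x < k" and e: "e > 0"
  shows "\<exists>n \<eta>. depends_on_first n (\<eta> :: _ \<Rightarrow> nat) \<and> measure m {x. \<xi> x \<noteq> \<eta> x} < e"
proof -
  interpret finite_measure m by fact
  have k0: "k > 0" using k[of undefined] by simp
  define A where "A j = {x. \<xi> x = j}" for j
  have A_sets: "A j \<in> sets borel" for j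
    using measurable_sets[OF \<xi>, of "{j}"] by (simp add: A_def vimage_def)
  have "\<forall>j. \<exists>n B. depends_on_first n (\<lambda>x. x \<in> B) \<and> measure m ((A j - B) \<union> (B - A j)) < e / real k"
    using approximate_set_by_depends_on_first[OF assms(1) sets A_sets] e k0 by simp
  then obtain n B where B: "\<And>j. depends_on_first (n j) (\<lambda>x. x \<in> B j)"
      "\<And>j. measure m ((A j - B j) \<union> (B j - A j)) < e / real k"
    by metis
  have B_sets: "B j \<in> sets borel" for j
    by (rule borel_set_depends_on_first[OF B(1)])
  \<comment> \<open>The \<open>B j\<close> may overlap or fail to cover; \<open>LEAST\<close> and
    the default 0 make a labelling of them and only matter on the exceptional set.\<close>
  define \<eta> where "\<eta> x = (if \<exists>j<k. x \<in> B j then LEAST j. j < k \<and> x \<in> B j else 0)" for x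
  define N where "N = (\<Sum>j<k. n j)"
  have dep: "depends_on_first N (\<lambda>x. x \<in> B j)" if "j < k" for j
    using that by (intro depends_on_first_mono[OF B(1)]) (auto simp: N_def intro: member_le_sum)
  have \<eta>_dep: "depends_on_first N \<eta>"
    unfolding depends_on_first_def
  proof (intro allI impI)
    fix x y :: "nat \<Rightarrow> 'a" assume xy: "\<forall>i<N. x i = y i"
    have "(x \<in> B j) = (y \<in> B j)" if "j < k" for j
      using depends_on_firstD[OF dep[OF that], of x y] xy by simp
    then have eq: "(j < k \<and> x \<in> B j) = (j < k \<and> y \<in> B j)" for j by blast
    show "\<eta> x = \<eta> y" unfolding \<eta>_def eq ..
  qed
  have "measure m {x. \<xi> x \<noteq> \<eta> x} < e"
  proof -
    have "\<xi> x = \<eta> x" if x: "x \<notin> (\<Union>j<k. (A j - B j) \<union> (B j - A j))" for x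
    proof -
      have iff: "x \<in> B j \<longleftrightarrow> \<xi> x = j" if "j < k" for j
      proof -
        have "x \<notin> (A j - B j) \<union> (B j - A j)" using x that by blast
        then show ?thesis by (auto simp: A_def)
      qed
      then have "\<exists>j<k. x \<in> B j" using k[of x] by blast
      moreover have "(LEAST j. j < k \<and> x \<in> B j) = \<xi> x"
        using iff k[of x] by (intro Least_equality) auto
      ultimately show ?thesis by (simp add: \<eta>_def)
    qed
    then have "{x. \<xi> x \<noteq> \<eta> x} \<subseteq> (\<Union>j<k. (A j - B j) \<union> (B j - A j))" by blast
    then have "measure m {x. \<xi> x \<noteq> \<eta> x} \<le> measure m (\<Union>j<k. (A j - B j) \<union> (B j - A j))"
      by (intro finite_measure_mono sets.finite_UN sets.Un sets.Diff) (simp_all add: sets A_sets B_sets)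
    also have "\<dots> \<le> (\<Sum>j<k. measure m ((A j - B j) \<union> (B j - A j)))"
      using A_sets B_sets by (intro finite_measure_subadditive_finite) (auto simp: sets)
    also have "\<dots> < (\<Sum>j<k. e / real k)"
      using B(2) k0 by (intro sum_strict_mono) auto
    also have "\<dots> = e" using k0 by simp
    finally show ?thesis .
  qed
  then show ?thesis using \<eta>_dep by blast
qed

text \<open>A product of subprobability vectors has mass at most 1, by splitting off the first
  letter. Since this shifts the index of \<open>c\<close>, the induction keeps \<open>c\<close>
  arbitrary.\<close>

lemma sum_words_prod_le_1:
  fixes c :: "nat \<Rightarrow> 'b \<Rightarrow> real"
  assumes "finite A" "\<And>i a. 0 \<le> c i a" "\<And>i. (\<Sum>a\<in>A. c i a) \<le> 1"
  shows "(\<Sum>v\<in>{v. set v \<subseteq> A \<and> length v = n}. \<Prod>i<n. c i (v ! i)) \<le> 1"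
  using assms(2,3)
proof (induction n arbitrary: c)
  case 0
  have "{v. set v \<subseteq> A \<and> length v = 0} = {[]}" by auto
  then show ?case by simp
next
  case (Suc n)
  have inj: "inj_on (\<lambda>(xs, n). n # xs) ({xs. set xs \<subseteq> A \<and> length xs = n} \<times> A)"
    by (auto simp: inj_on_def)
  have "(\<Sum>v\<in>{v. set v \<subseteq> A \<and> length v = Suc n}. \<Prod>i<Suc n. c i (v ! i)) =
      (\<Sum>(v, a)\<in>{v. set v \<subseteq> A \<and> length v = n} \<times> A. c 0 a * (\<Prod>i<n. c (Suc i) (v ! i)))"
    unfolding lists_length_Suc_eq
    by (subst sum.reindex[OF inj]) (auto simp: prod.lessThan_Suc_shift simp del: prod.lessThan_Suc intro!: sum.cong)
  also have "\<dots> = (\<Sum>a\<in>A. c 0 a) * (\<Sum>v\<in>{v. set v \<subseteq> A \<and> length v = n}. \<Prod>i<n. c (Suc i) (v ! i))"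
    by (subst sum.cartesian_product[symmetric], subst sum.swap) (simp add: sum_product)
  also have "\<dots> \<le> 1 * 1"
    using Suc.prems by (intro mult_mono Suc.IH sum_nonneg prod_nonneg) auto
  finally show ?case by simp
qed

lemma measure_preserving_shift:
  assumes "m \<in> invariant_probabilities"
  shows "measure_preserving_map m (shift_map :: (nat \<Rightarrow> 'a::{countable, discrete_topology}) \<Rightarrow> _)"
proof -
  have sets: "sets m = sets borel" and "prob_space m" and d: "distr m m shift_map = m"
    using assms by (auto simp: invariant_probabilities_def)
  interpret prob_space m by fact
  have "shift_map \<in> m \<rightarrow>\<^sub>M m"
    using measurable_shift_map measurable_cong_sets[OF sets sets] by blast
  then show ?thesis using d by unfold_locales
qed

lemma weights_le_1:
  fixes p :: "'a \<Rightarrow> real"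
  assumes "(p has_sum 1) UNIV" "\<And>a. p a \<ge> 0"
  shows "p a \<le> 1"
proof -
  have "sum p {a} \<le> infsum p UNIV"
    using assms by (intro finite_sum_le_infsum) (auto simp: summable_on_def)
  then show ?thesis using infsumI[OF assms(1)] by simp
qed

text \<open>
  The cross entropy is taken against the law of a random word: draw a point from the Bernoulli
  measure \<open>p\<close>, read off the itinerary of an approximation \<open>\<eta>\<close> of the labelling \<open>\<xi>\<close> that depends on finitely
  many coordinates, and resample each letter uniformly with the small probability \<open>d\<close>.
\<close>

lemma ks_entropy_le:
  fixes m :: "(nat \<Rightarrow> 'a::{countable, discrete_topology}) measure" and p :: "'a \<Rightarrow> real"
  assumes m: "m \<in> invariant_probabilities" and p_sum: "(p has_sum 1) UNIV" and p_pos: "\<And>a. p a > 0"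
  shows "ks_entropy m shift_map \<le> enn2ereal (\<integral>\<^sup>+x. ennreal (- ln (p (x 0))) \<partial>m)"
proof (cases "(\<integral>\<^sup>+x. ennreal (- ln (p (x 0))) \<partial>m) = \<infinity>")
  case False
  interpret m: measure_preserving_map m shift_map by (rule measure_preserving_shift[OF m])
  have sets: "sets m = sets borel" using m by (simp add: invariant_probabilities_def)
  note [measurable_cong] = sets
  have sp: "space m = UNIV" using sets by (auto dest: sets_eq_imp_space_eq)
  have p_le: "p a \<le> 1" for a using p_sum p_pos by (intro weights_le_1) (auto intro: order_less_imp_le)
  have p_meas [measurable]: "(\<lambda>x. - ln (p (x j))) \<in> borel_measurable (borel :: (nat \<Rightarrow> 'a) measure)" for j
    by (rule measurable_compose[OF measurable_coord[of j], of "\<lambda>a. - ln (p a)"]) simp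
  define I where "I = (\<integral>x. - ln (p (x 0)) \<partial>m)"
  have int0: "integrable m (\<lambda>x. - ln (p (x 0)))"
    using False p_le p_pos by (intro integrableI_nonneg) (auto simp: less_top)
  have int_j: "integrable m (\<lambda>x. - ln (p (x j)))" for j
    using m.integrable_S_pow[OF int0, of j] by (simp add: funpow_shift_map)
  have I_j: "(\<integral>x. - ln (p (x j)) \<partial>m) = I" for j
    using m.integral_S_pow[of "\<lambda>x. - ln (p (x 0))" j] int0 by (simp add: funpow_shift_map I_def)
  have I_eq: "(\<integral>\<^sup>+x. ennreal (- ln (p (x 0))) \<partial>m) = ennreal I"
    unfolding I_def using p_le p_pos by (intro nn_integral_eq_integral int0) auto
  have I0: "I \<ge> 0" unfolding I_def using p_le p_pos by (intro Bochner_Integration.integral_nonneg) auto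
  interpret B: product_weights "\<lambda>_. p"
    using p_sum p_pos by unfold_locales (auto intro: order_less_imp_le)
  interpret BP: prob_space B.P by (rule B.prob_space_product_type_measure)
  have sets_B: "sets B.P = sets borel"
    by (simp add: B.sets_product_type_measure sets_PiM_count_space_eq_borel)
  note [measurable_cong] = sets_B
  have "partition_ks_entropy m shift_map \<xi> \<le> I" if \<xi>: "simple_function m \<xi>" for \<xi> :: "_ \<Rightarrow> nat"
  proof (rule field_le_epsilon)
    fix e :: real assume "e > 0"
    \<comment> \<open>Two errors of size \<delta> will be paid per label: one for the noise where
      \<xi> and \<eta> agree, one for the places where they disagree.\<close>
    define \<delta> where "\<delta> = e / 2"
    have \<delta>: "\<delta> > 0" using \<open>e > 0\<close> by (simp add: \<delta>_def)
    have \<xi>_meas: "\<xi> \<in> borel \<rightarrow>\<^sub>M count_space UNIV"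
      using measurable_simple_function[OF \<xi>] measurable_cong_sets[OF sets refl] by blast
    have "finite (\<xi> ` UNIV)" using \<xi> by (simp add: simple_function_def sp)
    then obtain k where "\<forall>z\<in>\<xi> ` UNIV. z < k" using finite_nat_set_iff_bounded by blast
    then have k: "\<xi> x < k" for x by blast
    have k0: "k > 0" using k[of undefined] by simp
    \<comment> \<open>A label is passed on correctly with weight \<open>exp (- \<delta>)\<close>,
      which costs \<delta> in the logarithm; the remaining mass \<open>d\<close> is spread over the
      \<open>k\<close> labels, so that a wrong label costs the finite amount
      \<open>C\<close>.\<close>
    define d where "d = 1 - exp (- \<delta>)"
    have d: "0 < d" "d < 1" using \<delta> by (simp_all add: d_def)
    define C where "C = - ln (d / real k)"
    have C: "C \<ge> 0"
    proof -
      have "d / real k \<le> 1" using d k0 by (simp add: divide_le_eq)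
      moreover have "d / real k > 0" using d k0 by simp
      ultimately show ?thesis by (simp add: C_def)
    qed
    \<comment> \<open>\<open>C\<close> depends on \<delta> and \<open>k\<close> only, so \<eta> can
      be chosen after it, with disagreement so rare that its expected cost is at most \<delta>. The
      \<open>+ 1\<close> covers \<open>C = 0\<close>.\<close>
    have "\<delta> / (C + 1) > 0" using \<delta> C by simp
    from approximate_labelling_by_depends_on_first[OF m.finite_measure_axioms sets \<xi>_meas k this]
    obtain L and \<eta> :: "(nat \<Rightarrow> 'a) \<Rightarrow> nat" where \<eta>: "depends_on_first L \<eta>" "measure m {x. \<xi> x \<noteq> \<eta> x} < \<delta> / (C + 1)"
      by blast
    have \<eta>_meas [measurable]: "\<eta> \<in> borel \<rightarrow>\<^sub>M count_space UNIV"
      by (rule measurable_depends_on_first[OF \<eta>(1)])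
    note \<xi>_meas [measurable]
    define \<kappa> where "\<kappa> a b = (if a = b then exp (- \<delta>) else d / real k)" for a b :: nat
    have \<kappa>_pos: "\<kappa> a b > 0" for a b using d k0 by (simp add: \<kappa>_def)
    have \<kappa>_le: "\<kappa> a b \<le> 1" for a b using d k0 \<delta> by (simp add: \<kappa>_def divide_le_eq)
    have \<kappa>_sum: "(\<Sum>a<k. \<kappa> a b) \<le> 1" for b
    proof -
      have "(\<Sum>a<k. \<kappa> a b) \<le> (\<Sum>a<k. (if a = b then exp (- \<delta>) else 0) + d / real k)"
        using d by (intro sum_mono) (auto simp: \<kappa>_def)
      also have "\<dots> \<le> exp (- \<delta>) + d"
        using k0 by (simp add: sum.distrib)
      finally show ?thesis by (simp add: d_def)
    qed
    have \<kappa>_meas: "(\<lambda>x. \<kappa> a (\<eta> ((shift_map ^^ i) x))) \<in> borel_measurable borel" for a i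
      by (rule measurable_compose[OF measurable_compose[OF measurable_funpow_shift_map[of i] \<eta>_meas], of "\<kappa> a"]) simp
    define J where "J = (\<integral>x. - ln (\<kappa> (\<xi> x) (\<eta> x)) \<partial>m)"
    have J_meas: "(\<lambda>x. - ln (\<kappa> (\<xi> x) (\<eta> x))) \<in> borel_measurable m"
      by measurable
    have set_ne: "{x. \<xi> x \<noteq> \<eta> x} \<in> sets m"
    proof -
      have "{x \<in> space borel. \<xi> x \<noteq> \<eta> x} \<in> sets borel" by measurable
      then show ?thesis by (simp add: sets)
    qed
    have J_bound: "- ln (\<kappa> (\<xi> x) (\<eta> x)) \<le> \<delta> + C * indicator {x. \<xi> x \<noteq> \<eta> x} x" for x
      using C \<delta> by (auto simp: \<kappa>_def C_def)
    have J_nonneg: "0 \<le> - ln (\<kappa> (\<xi> x) (\<eta> x))" for x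
      using \<kappa>_pos \<kappa>_le by simp
    have int_bound: "integrable m (\<lambda>x. \<delta> + C * indicator {x. \<xi> x \<noteq> \<eta> x} x)"
      using set_ne by (intro Bochner_Integration.integrable_add integrable_mult_right integrable_real_indicator) (auto simp: less_top[symmetric])
    have int_J: "integrable m (\<lambda>x. - ln (\<kappa> (\<xi> x) (\<eta> x)))"
    proof (rule Bochner_Integration.integrable_bound[OF int_bound J_meas])
      have "norm (- ln (\<kappa> (\<xi> x) (\<eta> x))) \<le> norm (\<delta> + C * indicator {x. \<xi> x \<noteq> \<eta> x} x)" for x
        using J_bound[of x] J_nonneg[of x] by simp
      then show "AE x in m. norm (- ln (\<kappa> (\<xi> x) (\<eta> x))) \<le> norm (\<delta> + C * indicator {x. \<xi> x \<noteq> \<eta> x} x)" by simp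
    qed
    have "J \<le> (\<integral>x. \<delta> + C * indicator {x. \<xi> x \<noteq> \<eta> x} x \<partial>m)"
      unfolding J_def by (rule integral_mono[OF int_J int_bound J_bound])
    also have "\<dots> = \<delta> + C * measure m {x. \<xi> x \<noteq> \<eta> x}"
      using set_ne by (subst Bochner_Integration.integral_add) (auto simp: m.prob_space[unfolded sp] sp less_top[symmetric])
    also have "\<dots> \<le> \<delta> + \<delta>"
    proof -
      have "C * measure m {x. \<xi> x \<noteq> \<eta> x} \<le> C * (\<delta> / (C + 1))"
        using \<eta>(2) C by (intro mult_left_mono) auto
      also have "\<dots> \<le> \<delta>" using C \<delta> by (simp add: divide_le_eq)
      finally show ?thesis by simp
    qed
    finally have J_le: "J \<le> e" by (simp add: \<delta>_def)
    have H_le: "labelling_entropy m (itinerary shift_map \<xi> n) \<le> real (n + L) * I + real n * J" for n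
    proof -
      \<comment> \<open>The weight with which noise turns the \<eta>-itinerary of \<open>y\<close>
        into the word \<open>v\<close>. Averaging over the Bernoulli measure gives the comparison
        weight \<open>q v\<close>.\<close>
      define F where "F v y = (\<Prod>i<n. \<kappa> (v ! i) (\<eta> ((shift_map ^^ i) y)))" for v y
      have F_nonneg: "0 \<le> F v y" for v y by (simp add: F_def prod_nonneg \<kappa>_pos order_less_imp_le)
      have F_pos: "0 < F v y" for v y by (simp add: F_def prod_pos \<kappa>_pos)
      have F_le: "F v y \<le> 1" for v y
        unfolding F_def by (intro prod_le_1) (auto simp: \<kappa>_pos \<kappa>_le order_less_imp_le)
      have F_meas: "F v \<in> borel_measurable B.P" for v
        unfolding F_def[abs_def] using \<kappa>_meas by (intro borel_measurable_prod) (simp add: measurable_cong_sets[OF sets_B refl])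
      have F_int: "integrable B.P (F v)" for v
        using F_nonneg F_le by (intro BP.integrable_const_bound[of _ 1] F_meas) auto
      define q where "q v = (\<integral>y. F v y \<partial>B.P)" for v
      have q_nonneg: "0 \<le> q v" for v unfolding q_def by (intro Bochner_Integration.integral_nonneg F_nonneg)
      \<comment> \<open>Keep in the average only the points that share the first
        \<open>n + L\<close> coordinates with \<open>x\<close>. The \<open>i\<close>-th label of
        \<eta> reads coordinates below \<open>i + L\<close>, so all these points have the same
        \<eta>-itinerary of length \<open>n\<close> as \<open>x\<close>.\<close>
      have q_lower: "(\<Prod>j<n + L. p (x j)) * F (itinerary shift_map \<xi> n x) x \<le> q (itinerary shift_map \<xi> n x)" for x
      proof -
        let ?w = "map x [0..<n + L]" and ?v = "itinerary shift_map \<xi> n x"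
        have cyl: "cylinder ?w \<in> sets B.P" unfolding sets_B by (intro borel_open open_cylinder)
        have "emeasure B.P (cylinder ?w) = ennreal (\<Prod>j<n + L. p (x j))"
          unfolding B.emeasure_cylinder by simp
        then have meas: "measure B.P (cylinder ?w) = (\<Prod>j<n + L. p (x j))"
          using p_pos by (simp add: measure_def prod_nonneg order_less_imp_le)
        have le: "F ?v x * indicator (cylinder ?w) y \<le> F ?v y" for y
        proof (cases "y \<in> cylinder ?w")
          case True
          have "\<eta> ((shift_map ^^ i) x) = \<eta> ((shift_map ^^ i) y)" if "i < n" for i
            by (rule depends_on_firstD[OF \<eta>(1)]) (use True that in \<open>simp add: funpow_shift_map cylinder_def\<close>)
          then have "F ?v x = F ?v y" by (simp add: F_def)
          then show ?thesis using True by simp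
        qed (simp add: F_nonneg)
        have "(\<integral>y. F ?v x * indicator (cylinder ?w) y \<partial>B.P) \<le> q ?v"
          unfolding q_def using cyl
          by (intro integral_mono F_int le integrable_mult_right integrable_real_indicator) (auto simp: less_top[symmetric])
        then show ?thesis using meas by (simp add: mult.commute)
      qed
      have q_pos: "0 < q (itinerary shift_map \<xi> n x)" for x
        using F_pos p_pos by (intro less_le_trans[OF _ q_lower] mult_pos_pos prod_pos) auto
      have sf: "simple_function m (itinerary shift_map \<xi> n)" by (rule m.simple_function_itinerary[OF \<xi>])
      have "labelling_entropy m (itinerary shift_map \<xi> n) \<le> (\<integral>x. - ln (q (itinerary shift_map \<xi> n x)) \<partial>m)"
      proof (rule m.labelling_entropy_le_cross[OF sf q_nonneg])
        fix z assume "0 < m.law (itinerary shift_map \<xi> n) z"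
        then have "itinerary shift_map \<xi> n -` {z} \<inter> space m \<noteq> {}"
          unfolding m.law_def by (metis measure_empty less_irrefl)
        then show "0 < q z" using q_pos by blast
      next
        let ?W = "{v. set v \<subseteq> {..<k} \<and> length v = n}"
        have fin: "finite ?W" by (rule finite_lists_length_eq) simp
        have "(\<Sum>z\<in>itinerary shift_map \<xi> n ` space m. q z) \<le> (\<Sum>z\<in>?W. q z)"
          using fin by (intro sum_mono2 q_nonneg) (auto simp: itinerary_def k)
        also have "\<dots> = (\<integral>y. (\<Sum>z\<in>?W. F z y) \<partial>B.P)"
          unfolding q_def by (rule Bochner_Integration.integral_sum[symmetric]) (rule F_int)
        also have "\<dots> \<le> (\<integral>y. 1 \<partial>B.P)"
          unfolding F_def
          by (intro integral_mono Bochner_Integration.integrable_sum F_int[unfolded F_def] integrable_const sum_words_prod_le_1[where c = "\<lambda>i a. \<kappa> a (\<eta> ((shift_map ^^ i) _))"] \<kappa>_sum)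
            (auto simp: \<kappa>_pos order_less_imp_le)
        also have "\<dots> = 1" using BP.prob_space by simp
        finally show "(\<Sum>z\<in>itinerary shift_map \<xi> n ` space m. q z) \<le> 1" .
      qed
      also have "\<dots> \<le> (\<integral>x. (\<Sum>j<n + L. - ln (p (x j))) + (\<Sum>i<n. - ln (\<kappa> (\<xi> ((shift_map ^^ i) x)) (\<eta> ((shift_map ^^ i) x)))) \<partial>m)"
      proof (rule integral_mono)
        show "integrable m (\<lambda>x. - ln (q (itinerary shift_map \<xi> n x)))"
          by (rule m.integrable_simple[OF sf, where f = "\<lambda>v. - ln (q v)"])
        show "integrable m (\<lambda>x. (\<Sum>j<n + L. - ln (p (x j))) + (\<Sum>i<n. - ln (\<kappa> (\<xi> ((shift_map ^^ i) x)) (\<eta> ((shift_map ^^ i) x)))))"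
          by (intro Bochner_Integration.integrable_add Bochner_Integration.integrable_sum int_j m.integrable_S_pow[OF int_J])
        fix x
        have F_eq: "F (itinerary shift_map \<xi> n x) x = (\<Prod>i<n. \<kappa> (\<xi> ((shift_map ^^ i) x)) (\<eta> ((shift_map ^^ i) x)))"
          by (simp add: F_def itinerary_def)
        have "ln ((\<Prod>j<n + L. p (x j)) * F (itinerary shift_map \<xi> n x) x) \<le> ln (q (itinerary shift_map \<xi> n x))"
          using F_pos p_pos q_pos by (subst ln_le_cancel_iff) (auto intro!: mult_pos_pos prod_pos q_lower)
        also have "ln ((\<Prod>j<n + L. p (x j)) * F (itinerary shift_map \<xi> n x) x) =
            ln (\<Prod>j<n + L. p (x j)) + ln (F (itinerary shift_map \<xi> n x) x)"
          by (intro ln_mult_pos F_pos prod_pos) (rule p_pos)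
        also have "ln (\<Prod>j<n + L. p (x j)) = (\<Sum>j<n + L. ln (p (x j)))"
          by (intro ln_prod) (simp_all add: less_imp_neq[OF p_pos, THEN not_sym])
        also have "ln (F (itinerary shift_map \<xi> n x) x) = (\<Sum>i<n. ln (\<kappa> (\<xi> ((shift_map ^^ i) x)) (\<eta> ((shift_map ^^ i) x))))"
          unfolding F_eq by (intro ln_prod) (simp_all add: less_imp_neq[OF \<kappa>_pos, THEN not_sym])
        finally show "- ln (q (itinerary shift_map \<xi> n x)) \<le>
            (\<Sum>j<n + L. - ln (p (x j))) + (\<Sum>i<n. - ln (\<kappa> (\<xi> ((shift_map ^^ i) x)) (\<eta> ((shift_map ^^ i) x))))"
          by (simp add: sum_negf)
      qed
      also have "\<dots> = (\<integral>x. (\<Sum>j<n + L. - ln (p (x j))) \<partial>m) + (\<integral>x. (\<Sum>i<n. - ln (\<kappa> (\<xi> ((shift_map ^^ i) x)) (\<eta> ((shift_map ^^ i) x)))) \<partial>m)"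
        by (intro Bochner_Integration.integral_add Bochner_Integration.integrable_sum int_j m.integrable_S_pow[OF int_J])
      also have "(\<integral>x. (\<Sum>j<n + L. - ln (p (x j))) \<partial>m) = (\<Sum>j<n + L. \<integral>x. - ln (p (x j)) \<partial>m)"
        by (rule Bochner_Integration.integral_sum) (rule int_j)
      also have "\<dots> = real (n + L) * I" by (simp only: I_j sum_constant card_lessThan)
      also have "(\<integral>x. (\<Sum>i<n. - ln (\<kappa> (\<xi> ((shift_map ^^ i) x)) (\<eta> ((shift_map ^^ i) x)))) \<partial>m) =
          (\<Sum>i<n. \<integral>x. - ln (\<kappa> (\<xi> ((shift_map ^^ i) x)) (\<eta> ((shift_map ^^ i) x))) \<partial>m)"
        by (rule Bochner_Integration.integral_sum) (rule m.integrable_S_pow[OF int_J])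
      also have "\<dots> = real n * J"
        by (simp only: m.integral_S_pow[OF J_meas] J_def[symmetric] sum_constant card_lessThan)
      finally show ?thesis .
    qed
    have "partition_ks_entropy m shift_map \<xi> \<le> I + J"
    proof (rule LIMSEQ_le)
      show "(\<lambda>n. labelling_entropy m (itinerary shift_map \<xi> n) / real n) \<longlonglongrightarrow> partition_ks_entropy m shift_map \<xi>"
        by (rule m.partition_ks_entropy_LIMSEQ[OF \<xi>])
      \<comment> \<open>The surplus of \<open>L\<close> coordinates read by the last labels costs
        \<open>L * I\<close> once, which disappears on division by \<open>n\<close>.\<close>
      show "(\<lambda>n. I + J + (real L * I) / real n) \<longlonglongrightarrow> I + J"
        using tendsto_add[OF tendsto_const lim_const_over_n[of "real L * I"], of "I + J"] by simp
      have "labelling_entropy m (itinerary shift_map \<xi> n) / real n \<le> I + J + (real L * I) / real n" if "n \<ge> 1" for n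
      proof -
        have "labelling_entropy m (itinerary shift_map \<xi> n) / real n \<le> (real (n + L) * I + real n * J) / real n"
          by (intro divide_right_mono H_le) simp
        also have "\<dots> = I + J + (real L * I) / real n" using that by (simp add: field_simps)
        finally show ?thesis .
      qed
      then show "\<exists>N. \<forall>n\<ge>N. labelling_entropy m (itinerary shift_map \<xi> n) / real n \<le> I + J + (real L * I) / real n"
        by blast
    qed
    with J_le show "partition_ks_entropy m shift_map \<xi> \<le> I + e" by simp
  qed
  then show ?thesis
    unfolding ks_entropy_def I_eq using I0 by (intro SUP_least) (simp add: enn2ereal_ennreal)
qed simp

section \<open>Entropy of Bernoulli measures\<close>

lemma bernoulli_invariant:
  fixes p :: "'a::{countable, discrete_topology} \<Rightarrow> real"
  assumes "(p has_sum 1) UNIV" and "\<And>a. p a \<ge> 0"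
  shows "bernoulli_measure p \<in> invariant_probabilities"
proof -
  interpret B: product_weights "\<lambda>_. p" using assms by unfold_locales auto
  interpret BP: prob_space B.P by (rule B.prob_space_product_type_measure)
  have sets_B: "sets B.P = sets borel"
    by (simp add: B.sets_product_type_measure sets_PiM_count_space_eq_borel)
  note [measurable_cong] = sets_B
  have shift: "shift_map \<in> B.P \<rightarrow>\<^sub>M B.P"
    using measurable_shift_map measurable_cong_sets[OF sets_B sets_B] by blast
  have "distr B.P B.P shift_map = B.P"
  proof (rule measure_eqI_cylinder)
    show "finite_measure (distr B.P B.P shift_map)"
      using BP.prob_space_distr[OF shift] by (simp add: prob_space_def)
    fix w :: "'a list"
    have "emeasure (distr B.P B.P shift_map) (cylinder w) = emeasure B.P (shift_map -` cylinder w \<inter> space B.P)"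
      by (rule emeasure_distr[OF shift]) (simp add: sets_B borel_open open_cylinder)
    \<comment> \<open>The preimage leaves coordinate 0 free and moves every constraint one place to
      the right; the free factor has mass 1.\<close>
    also have "shift_map -` cylinder w \<inter> space B.P = {x. \<forall>i<Suc (length w). x i \<in> (case i of 0 \<Rightarrow> UNIV | Suc j \<Rightarrow> {w ! j})}"
      by (auto simp: cylinder_def shift_map_def split: nat.splits)
    also have "emeasure B.P \<dots> = (\<Prod>i<Suc (length w). emeasure (B.factor i) (case i of 0 \<Rightarrow> UNIV | Suc j \<Rightarrow> {w ! j}))"
      by (rule B.emeasure_coords)
    also have "\<dots> = (\<Prod>i<length w. emeasure (B.factor i) {w ! i})"
      using prob_space.emeasure_space_1[OF B.prob_space_factor]
      by (simp add: prod.lessThan_Suc_shift space_point_measure del: prod.lessThan_Suc)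
    also have "\<dots> = emeasure B.P (cylinder w)"
      by (simp add: B.emeasure_factor_singleton B.emeasure_cylinder prod_ennreal assms)
    finally show "emeasure (distr B.P B.P shift_map) (cylinder w) = emeasure B.P (cylinder w)" .
  qed (simp_all add: sets_B)
  then show ?thesis
    using BP.prob_space_axioms sets_B by (simp add: invariant_probabilities_def bernoulli_measure_def)
qed

text \<open>Lump all letters with code at least \<open>K\<close> into one label. The labels along
  the orbit are then independent and identically distributed, so itineraries of length
  \<open>n\<close> have entropy exactly \<open>n * h\<close>. A letter that is not lumped is an atom
  of its own, whence \<open>h\<close> dominates its part of the integral; monotone convergence in
  \<open>K\<close> gives the full integral, finite or not.\<close>

lemma ks_entropy_bernoulli_ge:
  fixes p :: "'a::{countable, discrete_topology} \<Rightarrow> real"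
  assumes p_sum: "(p has_sum 1) UNIV" and p_pos: "\<And>a. p a > 0"
  shows "enn2ereal (\<integral>\<^sup>+x. ennreal (- ln (p (x 0))) \<partial>bernoulli_measure p) \<le> ks_entropy (bernoulli_measure p) shift_map"
proof -
  define m where "m = bernoulli_measure p"
  have m: "m \<in> invariant_probabilities"
    unfolding m_def using p_pos by (intro bernoulli_invariant[OF p_sum]) (rule order_less_imp_le)
  interpret m: measure_preserving_map m shift_map by (rule measure_preserving_shift[OF m])
  interpret B: product_weights "\<lambda>_. p"
    using p_sum p_pos by unfold_locales (auto intro: order_less_imp_le)
  have m_eq: "m = B.P" by (simp add: m_def bernoulli_measure_def)
  have sets: "sets m = sets borel" using m by (simp add: invariant_probabilities_def)
  note [measurable_cong] = sets
  have sp: "space m = UNIV" using sets by (auto dest: sets_eq_imp_space_eq)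
  have p_le: "p a \<le> 1" for a using p_sum p_pos by (intro weights_le_1) (auto intro: order_less_imp_le)
  define f where "f K x = (if to_nat (x 0) < K then ennreal (- ln (p (x 0))) else 0)" for K :: nat and x :: "nat \<Rightarrow> 'a"
  have f_meas: "f K \<in> borel_measurable m" for K
    unfolding f_def[abs_def] measurable_cong_sets[OF sets refl]
    by (rule measurable_compose[OF measurable_coord[of 0], of "\<lambda>a. if to_nat a < K then ennreal (- ln (p a)) else 0"]) simp
  have le: "enn2ereal (\<integral>\<^sup>+x. f K x \<partial>m) \<le> ks_entropy m shift_map" for K
  proof -
    define \<xi> where "\<xi> x = min (to_nat (x 0)) K" for x :: "nat \<Rightarrow> 'a"
    have \<xi>_meas: "\<xi> \<in> borel \<rightarrow>\<^sub>M count_space UNIV"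
      unfolding \<xi>_def by (rule measurable_compose[OF measurable_coord[of 0], of "\<lambda>a. min (to_nat a) K"]) simp
    have \<xi>: "simple_function m \<xi>"
      unfolding simple_function_def
    proof (intro conjI ballI)
      show "finite (\<xi> ` space m)"
        by (rule finite_subset[of _ "{..K}"]) (auto simp: \<xi>_def)
      show "\<xi> -` {z} \<inter> space m \<in> sets m" for z
        using measurable_sets[OF \<xi>_meas, of "{z}"] by (simp add: sets sp)
    qed
    define A where "A j = {a :: 'a. min (to_nat a) K = j}" for j
    define r where "r j = emeasure (B.factor 0) (A j)" for j
    have law_\<xi>: "ennreal (m.law \<xi> j) = r j" for j
    proof -
      have "ennreal (m.law \<xi> j) = emeasure m (\<xi> -` {j} \<inter> space m)"
        by (simp add: m.law_def m.emeasure_eq_measure)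
      also have "\<xi> -` {j} \<inter> space m = {x. \<forall>i<(1::nat). x i \<in> A j}"
        by (auto simp: \<xi>_def A_def sp)
      also have "emeasure m \<dots> = r j"
        unfolding m_eq B.emeasure_coords by (simp add: r_def)
      finally show ?thesis .
    qed
    have law_pos: "m.law \<xi> (\<xi> x) > 0" for x
    proof -
      have "ennreal (p (x 0)) = emeasure (B.factor 0) {x 0}" by (simp add: B.emeasure_factor_singleton)
      also have "\<dots> \<le> r (\<xi> x)"
        unfolding r_def by (rule emeasure_mono) (auto simp: A_def \<xi>_def sets_point_measure)
      finally have "ennreal (p (x 0)) \<le> ennreal (m.law \<xi> (\<xi> x))" by (simp add: law_\<xi>)
      then have "p (x 0) \<le> m.law \<xi> (\<xi> x)" by (simp add: m.law_nonneg)
      then show ?thesis using p_pos[of "x 0"] by simp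
    qed
    have law_itinerary: "m.law (itinerary shift_map \<xi> n) (itinerary shift_map \<xi> n x) = (\<Prod>i<n. m.law \<xi> (\<xi> ((shift_map ^^ i) x)))" for n x
    proof -
      let ?v = "itinerary shift_map \<xi> n x"
      have "ennreal (m.law (itinerary shift_map \<xi> n) ?v) = emeasure m (itinerary shift_map \<xi> n -` {?v} \<inter> space m)"
        by (simp add: m.law_def m.emeasure_eq_measure)
      also have "itinerary shift_map \<xi> n -` {?v} \<inter> space m = {y. \<forall>i<n. y i \<in> A (\<xi> ((shift_map ^^ i) x))}"
        by (auto simp: itinerary_def A_def sp \<xi>_def funpow_shift_map)
      also have "emeasure m \<dots> = (\<Prod>i<n. r (\<xi> ((shift_map ^^ i) x)))"
        unfolding m_eq B.emeasure_coords by (simp add: r_def)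
      also have "\<dots> = ennreal (\<Prod>i<n. m.law \<xi> (\<xi> ((shift_map ^^ i) x)))"
        by (simp add: law_\<xi>[symmetric] prod_ennreal m.law_nonneg)
      finally show ?thesis by (simp add: m.law_nonneg prod_nonneg)
    qed
    define h where "h = (\<integral>x. - ln (m.law \<xi> (\<xi> x)) \<partial>m)"
    have int: "integrable m (\<lambda>x. - ln (m.law \<xi> (\<xi> x)))"
      by (rule m.integrable_simple[OF \<xi>, where f = "\<lambda>z. - ln (m.law \<xi> z)"])
    have H: "labelling_entropy m (itinerary shift_map \<xi> n) = real n * h" for n
    proof -
      have "labelling_entropy m (itinerary shift_map \<xi> n) =
          (\<integral>x. - ln (m.law (itinerary shift_map \<xi> n) (itinerary shift_map \<xi> n x)) \<partial>m)"
        by (rule m.labelling_entropy_eq[OF m.simple_function_itinerary[OF \<xi>]])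
      also have "\<dots> = (\<integral>x. (\<Sum>i<n. - ln (m.law \<xi> (\<xi> ((shift_map ^^ i) x)))) \<partial>m)"
      proof (rule Bochner_Integration.integral_cong[OF refl])
        fix x
        have "ln (\<Prod>i<n. m.law \<xi> (\<xi> ((shift_map ^^ i) x))) = (\<Sum>i<n. ln (m.law \<xi> (\<xi> ((shift_map ^^ i) x))))"
          by (intro ln_prod) (simp_all add: less_imp_neq[OF law_pos, THEN not_sym])
        then show "- ln (m.law (itinerary shift_map \<xi> n) (itinerary shift_map \<xi> n x)) =
            (\<Sum>i<n. - ln (m.law \<xi> (\<xi> ((shift_map ^^ i) x))))"
          by (simp add: law_itinerary sum_negf)
      qed
      also have "\<dots> = (\<Sum>i<n. \<integral>x. - ln (m.law \<xi> (\<xi> ((shift_map ^^ i) x))) \<partial>m)"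
        by (rule Bochner_Integration.integral_sum) (rule m.integrable_S_pow[OF int])
      also have "\<dots> = real n * h"
        by (simp only: m.integral_S_pow[OF borel_measurable_integrable[OF int]] h_def[symmetric] sum_constant card_lessThan)
      finally show ?thesis .
    qed
    have "(\<lambda>n. labelling_entropy m (itinerary shift_map \<xi> n) / real n) \<longlonglongrightarrow> h"
      by (rule tendsto_eventually) (use eventually_gt_at_top[of "0::nat"] in \<open>eventually_elim, simp add: H\<close>)
    then have ks: "partition_ks_entropy m shift_map \<xi> = h"
      using m.partition_ks_entropy_LIMSEQ[OF \<xi>] by (rule LIMSEQ_unique[symmetric])
    have nonneg: "0 \<le> - ln (m.law \<xi> (\<xi> x))" for x
      using law_pos[of x] m.law_le_1[of \<xi> "\<xi> x"] by simp
    have "(\<integral>\<^sup>+x. f K x \<partial>m) \<le> (\<integral>\<^sup>+x. ennreal (- ln (m.law \<xi> (\<xi> x))) \<partial>m)"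
    proof (rule nn_integral_mono)
      fix x
      show "f K x \<le> ennreal (- ln (m.law \<xi> (\<xi> x)))"
      proof (cases "to_nat (x 0) < K")
        case True
        then have "A (\<xi> x) = {x 0}" by (auto simp: A_def \<xi>_def min_def split: if_splits)
        then have "ennreal (m.law \<xi> (\<xi> x)) = ennreal (p (x 0))"
          by (simp add: law_\<xi> r_def B.emeasure_factor_singleton)
        then have "m.law \<xi> (\<xi> x) = p (x 0)" using p_pos[of "x 0"] by (simp add: m.law_nonneg)
        then show ?thesis using True by (simp add: f_def)
      qed (simp add: f_def)
    qed
    also have "\<dots> = ennreal h"
      unfolding h_def by (rule nn_integral_eq_integral[OF int AE_I2[OF nonneg]])
    finally have "(\<integral>\<^sup>+x. f K x \<partial>m) \<le> ennreal h" .
    moreover have "0 \<le> h"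
      unfolding h_def by (rule Bochner_Integration.integral_nonneg[OF nonneg])
    ultimately have "enn2ereal (\<integral>\<^sup>+x. f K x \<partial>m) \<le> ereal h"
      by (simp only: less_eq_ennreal.rep_eq enn2ereal_ennreal)
    also have "\<dots> \<le> ks_entropy m shift_map"
      unfolding ks_entropy_def ks[symmetric] using \<xi> by (intro SUP_upper) simp
    finally show ?thesis .
  qed
  \<comment> \<open>For \<open>K = 0\<close> the truncated integral vanishes. Nonnegativity makes
    the passage from \<open>ereal\<close> to \<open>ennreal\<close> and back, used for the supremum
    over \<open>K\<close>, faithful.\<close>
  have "0 \<le> ks_entropy m shift_map"
    using le[of 0] by (simp add: f_def zero_ennreal.rep_eq)
  have "(\<integral>\<^sup>+x. ennreal (- ln (p (x 0))) \<partial>m) = (\<integral>\<^sup>+x. (SUP K. f K x) \<partial>m)"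
  proof (rule nn_integral_cong)
    fix x
    show "ennreal (- ln (p (x 0))) = (SUP K. f K x)"
    proof (rule antisym)
      show "ennreal (- ln (p (x 0))) \<le> (SUP K. f K x)"
        by (rule SUP_upper2[of "Suc (to_nat (x 0))"]) (auto simp: f_def)
      show "(SUP K. f K x) \<le> ennreal (- ln (p (x 0)))"
        by (rule SUP_least) (auto simp: f_def)
    qed
  qed
  also have "\<dots> = (SUP K. \<integral>\<^sup>+x. f K x \<partial>m)"
    by (rule nn_integral_monotone_convergence_SUP[OF _ f_meas]) (auto simp: incseq_def le_fun_def f_def)
  also have "\<dots> \<le> e2ennreal (ks_entropy m shift_map)"
  proof (rule SUP_least)
    fix K
    have "e2ennreal (enn2ereal (\<integral>\<^sup>+x. f K x \<partial>m)) \<le> e2ennreal (ks_entropy m shift_map)"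
      by (rule e2ennreal_mono[OF le])
    then show "(\<integral>\<^sup>+x. f K x \<partial>m) \<le> e2ennreal (ks_entropy m shift_map)" by simp
  qed
  finally have "enn2ereal (\<integral>\<^sup>+x. ennreal (- ln (p (x 0))) \<partial>m) \<le> enn2ereal (e2ennreal (ks_entropy m shift_map))"
    by (simp add: less_eq_ennreal.rep_eq)
  also have "\<dots> = ks_entropy m shift_map" using \<open>0 \<le> ks_entropy m shift_map\<close> by (rule enn2ereal_e2ennreal)
  finally show ?thesis by (simp add: m_def)
qed

section \<open>Almost sure convergence of independent centred sums\<close>

text \<open>\<open>comb_seq n\<close> glues the first \<open>n\<close> coordinates of one sample to
  the whole of an independent second one and preserves the Bernoulli measure. After gluing,
  \<open>F\<close> sees only the first sample and \<open>f\<close> only the initial letter of the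
  second, so Fubini separates them.\<close>

lemma bernoulli_integral_mult:
  fixes p :: "'a::{countable, discrete_topology} \<Rightarrow> real"
  assumes "(p has_sum 1) UNIV" and "\<And>a. p a \<ge> 0"
    and F: "depends_on_first n F" "\<And>x. \<bar>F x\<bar> \<le> (C :: real)" and f: "\<And>a. \<bar>f a\<bar> \<le> (D :: real)"
  shows "(\<integral>x. F x * f (x n) \<partial>bernoulli_measure p) =
    (\<integral>x. F x \<partial>bernoulli_measure p) * (\<integral>x. f (x 0) \<partial>bernoulli_measure p)"
proof -
  interpret B: product_weights "\<lambda>_. p" using assms(1,2) by unfold_locales auto
  interpret BP: prob_space B.P by (rule B.prob_space_product_type_measure)
  interpret BB: pair_prob_space B.P B.P ..
  interpret seq: sequence_space "B.factor 0" ..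
  have sets_B: "sets B.P = sets borel"
    by (simp add: B.sets_product_type_measure sets_PiM_count_space_eq_borel)
  note [measurable_cong] = sets_B
  have [measurable]: "F \<in> borel_measurable borel"
    by (rule measurable_compose[OF measurable_depends_on_first[OF F(1)], of "\<lambda>z. z"]) simp
  have f_meas [measurable]: "(\<lambda>x. f (x i)) \<in> borel_measurable (borel :: (nat \<Rightarrow> 'a) measure)" for i
    by (rule measurable_compose[OF measurable_coord[of i], of f]) simp
  have distr: "distr (B.P \<Otimes>\<^sub>M B.P) B.P (\<lambda>(\<omega>, \<omega>'). comb_seq n \<omega> \<omega>') = B.P"
    using seq.PiM_comb_seq[of n] by (simp add: product_type_measure_def)
  have comb [measurable]: "(\<lambda>(\<omega>, \<omega>'). comb_seq n \<omega> \<omega>') \<in> B.P \<Otimes>\<^sub>M B.P \<rightarrow>\<^sub>M B.P"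
    unfolding product_type_measure_def by (rule measurable_comb_seq)
  have FC: "norm (F x * f y) \<le> C * D" for x y
    using F(2)[of x] f[of y] by (simp add: abs_mult mult_mono order_trans[OF abs_ge_zero])
  have "(\<integral>x. F x * f (x n) \<partial>B.P) = (\<integral>x. F x * f (x n) \<partial>distr (B.P \<Otimes>\<^sub>M B.P) B.P (\<lambda>(\<omega>, \<omega>'). comb_seq n \<omega> \<omega>'))"
    by (simp only: distr)
  also have "\<dots> = (\<integral>z. F (case z of (\<omega>, \<omega>') \<Rightarrow> comb_seq n \<omega> \<omega>') * f ((case z of (\<omega>, \<omega>') \<Rightarrow> comb_seq n \<omega> \<omega>') n) \<partial>(B.P \<Otimes>\<^sub>M B.P))"
    by (rule integral_distr[OF comb]) measurable
  also have "\<dots> = (\<integral>z. (\<lambda>(\<omega>, \<omega>'). F \<omega> * f (\<omega>' 0)) z \<partial>(B.P \<Otimes>\<^sub>M B.P))"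
  proof (rule Bochner_Integration.integral_cong[OF refl])
    fix z :: "(nat \<Rightarrow> 'a) \<times> (nat \<Rightarrow> 'a)"
    obtain \<omega> \<omega>' where z: "z = (\<omega>, \<omega>')" by force
    have "F (comb_seq n \<omega> \<omega>') = F \<omega>"
      by (rule depends_on_firstD[OF F(1)]) (rule comb_seq_less)
    moreover have "comb_seq n \<omega> \<omega>' n = \<omega>' 0" using comb_seq_add[of n \<omega> \<omega>' 0] by simp
    ultimately show "F (case z of (\<omega>, \<omega>') \<Rightarrow> comb_seq n \<omega> \<omega>') * f ((case z of (\<omega>, \<omega>') \<Rightarrow> comb_seq n \<omega> \<omega>') n) =
        (\<lambda>(\<omega>, \<omega>'). F \<omega> * f (\<omega>' 0)) z"
      by (simp add: z)
  qed
  also have "\<dots> = (\<integral>\<omega>. (\<integral>\<omega>'. F \<omega> * f (\<omega>' 0) \<partial>B.P) \<partial>B.P)"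
  proof (rule BB.integral_fst[symmetric])
    show "integrable (B.P \<Otimes>\<^sub>M B.P) (\<lambda>(\<omega>, \<omega>'). F \<omega> * f (\<omega>' 0))"
    proof (rule BB.P.integrable_const_bound[of _ "C * D"])
      show "AE z in B.P \<Otimes>\<^sub>M B.P. norm (case z of (\<omega>, \<omega>') \<Rightarrow> F \<omega> * f (\<omega>' 0)) \<le> C * D"
        using FC by (simp add: split_beta')
    qed measurable
  qed
  also have "\<dots> = (\<integral>\<omega>. F \<omega> * (\<integral>\<omega>'. f (\<omega>' 0) \<partial>B.P) \<partial>B.P)" by simp
  also have "\<dots> = (\<integral>x. F x \<partial>B.P) * (\<integral>x. f (x 0) \<partial>B.P)" by simp
  finally show ?thesis by (simp add: bernoulli_measure_def)
qed

text \<open>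
  Stopping turns the event that some partial sum reaches the level \<open>e\<close> into an event about the last
  term alone, while the increments stay orthogonal, so that Chebyshev's inequality gives
  Kolmogorov's maximal inequality.
\<close>

primrec stopped_sum :: "real \<Rightarrow> (nat \<Rightarrow> 'a \<Rightarrow> real) \<Rightarrow> nat \<Rightarrow> nat \<Rightarrow> (nat \<Rightarrow> 'a) \<Rightarrow> real" where
  "stopped_sum e f m 0 x = 0"
| "stopped_sum e f m (Suc n) x =
    (if e \<le> \<bar>stopped_sum e f m n x\<bar> then stopped_sum e f m n x
     else stopped_sum e f m n x + f (m + n) (x (m + n)))"

text \<open>Once the level is reached the stopped sum is frozen there, so a final value below the
  level means that stopping never occurred.\<close>

lemma stopped_sum_below_level:
  assumes "\<bar>stopped_sum e f m n x\<bar> < e" "e > 0"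
  shows "stopped_sum e f m n x = (\<Sum>i<n. f (m + i) (x (m + i))) \<and> (\<forall>k\<le>n. \<bar>\<Sum>i<k. f (m + i) (x (m + i))\<bar> < e)"
  using assms(1)
proof (induction n)
  case (Suc n)
  then have "\<bar>stopped_sum e f m n x\<bar> < e" by (auto split: if_splits)
  with Suc show ?case by (auto simp: le_Suc_eq)
qed (simp add: \<open>e > 0\<close>)

lemma depends_on_first_stopped_sum: "depends_on_first (m + n) (stopped_sum e f m n)"
proof (induction n)
  case (Suc n)
  show ?case
    unfolding depends_on_first_def
  proof (intro allI impI)
    fix x y :: "nat \<Rightarrow> 'a" assume xy: "\<forall>i<m + Suc n. x i = y i"
    then have "stopped_sum e f m n x = stopped_sum e f m n y" by (intro depends_on_firstD[OF Suc]) simp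
    then show "stopped_sum e f m (Suc n) x = stopped_sum e f m (Suc n) y" using xy by simp
  qed
qed (simp add: depends_on_first_def)

lemma bounded_stopped_sum:
  assumes "\<And>i. \<exists>C. \<forall>a. \<bar>f i a\<bar> \<le> C"
  shows "\<exists>C. \<forall>x. \<bar>stopped_sum e f m n x\<bar> \<le> C"
proof (induction n)
  case (Suc n)
  then obtain C where C: "\<And>x. \<bar>stopped_sum e f m n x\<bar> \<le> C" by blast
  obtain D where D: "\<And>a. \<bar>f (m + n) a\<bar> \<le> D" using assms by blast
  have "\<bar>stopped_sum e f m (Suc n) x\<bar> \<le> C + D" for x
    using C[of x] D[of "x (m + n)"] by auto
  then show ?case by blast
qed auto

text \<open>\<open>c\<close> is any summable majorant of the variances; this fits the supremum over
  letters in the hypothesis of part (2).\<close>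

locale centred_bernoulli_sums =
  fixes p :: "'a::{countable, discrete_topology} \<Rightarrow> real" and f :: "nat \<Rightarrow> 'a \<Rightarrow> real" and c :: "nat \<Rightarrow> real"
  assumes p_sum: "(p has_sum 1) UNIV" and p_nonneg: "\<And>a. p a \<ge> 0"
    and f_bounded: "\<And>i. \<exists>C. \<forall>a. \<bar>f i a\<bar> \<le> C"
    and centred: "\<And>i. (\<integral>x. f i (x 0) \<partial>bernoulli_measure p) = 0"
    and second_moment: "\<And>i. (\<integral>x. (f i (x 0))\<^sup>2 \<partial>bernoulli_measure p) \<le> c i"
    and summable_c: "summable c"
begin

abbreviation B :: "(nat \<Rightarrow> 'a) measure" where
  "B \<equiv> bernoulli_measure p"

sublocale prob_space B
  using bernoulli_invariant[OF p_sum p_nonneg] by (simp add: invariant_probabilities_def)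

lemma sets_B: "sets B = sets borel"
  using bernoulli_invariant[OF p_sum p_nonneg] by (simp add: invariant_probabilities_def)

lemma space_B: "space B = UNIV"
  using sets_B by (auto dest: sets_eq_imp_space_eq)

lemma integrable_depends_on_first:
  fixes F :: "(nat \<Rightarrow> 'a) \<Rightarrow> real"
  assumes "depends_on_first n F" "\<And>x. \<bar>F x\<bar> \<le> C"
  shows "integrable B F"
proof (rule integrable_const_bound[of _ C])
  have "F \<in> borel_measurable borel"
    by (rule measurable_compose[OF measurable_depends_on_first[OF assms(1)], of "\<lambda>z. z"]) simp
  then show "F \<in> borel_measurable B" using measurable_cong_sets[OF sets_B refl] by blast
qed (use assms(2) in simp)

lemma c_nonneg: "0 \<le> c i"
proof -
  have "0 \<le> (\<integral>x. (f i (x 0))\<^sup>2 \<partial>B)" by (rule Bochner_Integration.integral_nonneg) simp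
  then show ?thesis using second_moment[of i] by linarith
qed

text \<open>The increment is \<open>I x * f ?k (x ?k)\<close>, where \<open>I\<close> indicates that
  stopping has not occurred yet and depends on earlier coordinates only. By independence the mixed
  term has mean zero, and the square contributes at most the variance.\<close>

lemma stopped_sum_second_moment:
  "(\<integral>x. (stopped_sum e f m n x)\<^sup>2 \<partial>B) \<le> (\<Sum>i<n. c (m + i))"
proof (induction n)
  case (Suc n)
  let ?Y = "stopped_sum e f m n" and ?k = "m + n"
  obtain C where C: "\<And>x. \<bar>?Y x\<bar> \<le> C" using bounded_stopped_sum[of f e m n, OF f_bounded] by blast
  obtain D where D: "\<And>a. \<bar>f ?k a\<bar> \<le> D" using f_bounded by blast
  have C0: "0 \<le> C" "0 \<le> D" using order_trans[OF abs_ge_zero C] order_trans[OF abs_ge_zero D] by auto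
  have D2: "\<bar>(f ?k a)\<^sup>2\<bar> \<le> D\<^sup>2" for a
    using D[of a] by (simp add: abs_le_square_iff[symmetric] C0)
  have C2: "\<bar>(?Y x)\<^sup>2\<bar> \<le> C\<^sup>2" for x
    using C[of x] by (simp add: abs_le_square_iff[symmetric] C0)
  define I where "I x = (if e \<le> \<bar>?Y x\<bar> then 0 else 1 :: real)" for x
  note dY = depends_on_first_stopped_sum[of m n e f]
  have dI: "depends_on_first ?k I" using dY unfolding depends_on_first_def I_def by metis
  have dIY: "depends_on_first ?k (\<lambda>x. 2 * I x * ?Y x)" using dY dI unfolding depends_on_first_def by metis
  have dY2: "depends_on_first ?k (\<lambda>x. (?Y x)\<^sup>2)" using dY unfolding depends_on_first_def by metis
  have I1: "\<bar>I x\<bar> \<le> 1" for x by (simp add: I_def)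
  have IY: "\<bar>2 * I x * ?Y x\<bar> \<le> 2 * C" for x using C[of x] C0 by (auto simp: I_def abs_mult)
  have int1: "integrable B (\<lambda>x. (?Y x)\<^sup>2)" by (rule integrable_depends_on_first[OF dY2 C2])
  have int2: "integrable B (\<lambda>x. (2 * I x * ?Y x) * f ?k (x ?k))"
  proof (rule integrable_depends_on_first)
    show "depends_on_first (Suc ?k) (\<lambda>x. (2 * I x * ?Y x) * f ?k (x ?k))"
      unfolding depends_on_first_def
    proof (intro allI impI)
      fix x y :: "nat \<Rightarrow> 'a" assume xy: "\<forall>i<Suc ?k. x i = y i"
      then have "2 * I x * ?Y x = 2 * I y * ?Y y" by (intro depends_on_firstD[OF dIY]) simp
      then show "(2 * I x * ?Y x) * f ?k (x ?k) = (2 * I y * ?Y y) * f ?k (y ?k)" using xy by simp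
    qed
    show "\<bar>(2 * I x * ?Y x) * f ?k (x ?k)\<bar> \<le> (2 * C) * D" for x
      unfolding abs_mult[of "2 * I x * ?Y x"] using C0 by (intro mult_mono IY D) auto
  qed
  have int3: "integrable B (\<lambda>x. I x * (f ?k (x ?k))\<^sup>2)"
  proof (rule integrable_depends_on_first)
    show "depends_on_first (Suc ?k) (\<lambda>x. I x * (f ?k (x ?k))\<^sup>2)"
      unfolding depends_on_first_def
    proof (intro allI impI)
      fix x y :: "nat \<Rightarrow> 'a" assume xy: "\<forall>i<Suc ?k. x i = y i"
      then have "I x = I y" by (intro depends_on_firstD[OF dI]) simp
      then show "I x * (f ?k (x ?k))\<^sup>2 = I y * (f ?k (y ?k))\<^sup>2" using xy by simp
    qed
    show "\<bar>I x * (f ?k (x ?k))\<^sup>2\<bar> \<le> 1 * D\<^sup>2" for x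
      unfolding abs_mult[of "I x"] by (intro mult_mono I1 D2) auto
  qed
  have "(stopped_sum e f m (Suc n) x)\<^sup>2 = ((?Y x)\<^sup>2 + (2 * I x * ?Y x) * f ?k (x ?k)) + I x * (f ?k (x ?k))\<^sup>2" for x
    by (simp add: I_def power2_eq_square algebra_simps)
  then have "(\<integral>x. (stopped_sum e f m (Suc n) x)\<^sup>2 \<partial>B) =
      (\<integral>x. ((?Y x)\<^sup>2 + (2 * I x * ?Y x) * f ?k (x ?k)) + I x * (f ?k (x ?k))\<^sup>2 \<partial>B)"
    by (simp only:)
  also have "\<dots> = (\<integral>x. (?Y x)\<^sup>2 \<partial>B) + (\<integral>x. (2 * I x * ?Y x) * f ?k (x ?k) \<partial>B) + (\<integral>x. I x * (f ?k (x ?k))\<^sup>2 \<partial>B)"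
    by (simp only: Bochner_Integration.integral_add[OF Bochner_Integration.integrable_add[OF int1 int2] int3]
        Bochner_Integration.integral_add[OF int1 int2])
  also have "(\<integral>x. (2 * I x * ?Y x) * f ?k (x ?k) \<partial>B) = 0"
    by (subst bernoulli_integral_mult[OF p_sum p_nonneg dIY IY D]) (simp add: centred)
  also have "(\<integral>x. I x * (f ?k (x ?k))\<^sup>2 \<partial>B) = (\<integral>x. I x \<partial>B) * (\<integral>x. (f ?k (x 0))\<^sup>2 \<partial>B)"
    by (rule bernoulli_integral_mult[OF p_sum p_nonneg dI I1 D2])
  also have "\<dots> \<le> 1 * c ?k"
  proof (intro mult_mono second_moment)
    have "(\<integral>x. I x \<partial>B) \<le> (\<integral>x. 1 \<partial>B)"
      by (intro integral_mono integrable_depends_on_first[OF dI I1]) (auto simp: I_def)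
    then show "(\<integral>x. I x \<partial>B) \<le> 1" by (simp add: prob_space)
  qed (auto intro!: Bochner_Integration.integral_nonneg)
  finally show ?case using Suc by simp
qed simp

lemma kolmogorov_inequality:
  assumes "e > 0"
  shows "measure B {x. \<exists>k\<le>n. e \<le> \<bar>\<Sum>i<k. f (m + i) (x (m + i))\<bar>} \<le> (\<Sum>i<n. c (m + i)) / e\<^sup>2"
proof -
  let ?Y = "stopped_sum e f m n"
  note dY = depends_on_first_stopped_sum[of m n e f]
  obtain C where C: "\<And>x. \<bar>?Y x\<bar> \<le> C" using bounded_stopped_sum[of f e m n, OF f_bounded] by blast
  have C0: "0 \<le> C" using order_trans[OF abs_ge_zero C] by auto
  have C2: "\<bar>(?Y x)\<^sup>2\<bar> \<le> C\<^sup>2" for x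
    using C[of x] by (simp add: abs_le_square_iff[symmetric] C0)
  have dY2: "depends_on_first (m + n) (\<lambda>x. (?Y x)\<^sup>2)" using dY unfolding depends_on_first_def by metis
  have "depends_on_first (m + n) (\<lambda>x. x \<in> {x. e \<le> \<bar>?Y x\<bar>})"
    using dY unfolding depends_on_first_def mem_Collect_eq by metis
  then have sets: "{x. e \<le> \<bar>?Y x\<bar>} \<in> sets B"
    unfolding sets_B by (rule borel_set_depends_on_first)
  have "{x. \<exists>k\<le>n. e \<le> \<bar>\<Sum>i<k. f (m + i) (x (m + i))\<bar>} \<subseteq> {x. e \<le> \<bar>?Y x\<bar>}"
    using stopped_sum_below_level[OF _ assms] by (force simp: not_le[symmetric])
  then have "measure B {x. \<exists>k\<le>n. e \<le> \<bar>\<Sum>i<k. f (m + i) (x (m + i))\<bar>} \<le> measure B {x. e \<le> \<bar>?Y x\<bar>}"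
    by (rule finite_measure_mono[OF _ sets])
  moreover have "e\<^sup>2 * measure B {x. e \<le> \<bar>?Y x\<bar>} \<le> (\<Sum>i<n. c (m + i))"
  proof -
    have "e\<^sup>2 * measure B {x. e \<le> \<bar>?Y x\<bar>} = (\<integral>x. e\<^sup>2 * indicator {x. e \<le> \<bar>?Y x\<bar>} x \<partial>B)"
      by (simp add: space_B)
    also have "\<dots> \<le> (\<integral>x. (?Y x)\<^sup>2 \<partial>B)"
    proof (rule integral_mono)
      show "integrable B (\<lambda>x. e\<^sup>2 * indicator {x. e \<le> \<bar>?Y x\<bar>} x)"
        using sets by (intro integrable_mult_right integrable_real_indicator) (auto simp: less_top[symmetric])
      show "integrable B (\<lambda>x. (?Y x)\<^sup>2)" by (rule integrable_depends_on_first[OF dY2 C2])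
      show "e\<^sup>2 * indicator {x. e \<le> \<bar>?Y x\<bar>} x \<le> (?Y x)\<^sup>2" for x
        using assms by (auto simp: indicator_def abs_le_square_iff[symmetric])
    qed
    also have "\<dots> \<le> (\<Sum>i<n. c (m + i))" by (rule stopped_sum_second_moment)
    finally show ?thesis .
  qed
  then have "measure B {x. e \<le> \<bar>?Y x\<bar>} \<le> (\<Sum>i<n. c (m + i)) / e\<^sup>2"
    using assms by (simp add: pos_le_divide_eq mult.commute)
  ultimately show ?thesis by linarith
qed

text \<open>For fixed \<open>m\<close>, the bound of Kolmogorov's inequality passes to the
  increasing union over \<open>n\<close> as the tail of the series of \<open>c\<close> from
  \<open>m\<close>, divided by \<open>e\<close> squared. The exceptional points lie in these unions
  for every \<open>m\<close>, hence in a null set.\<close>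

lemma AE_eventually_small:
  assumes "e > 0"
  shows "AE x in B. \<exists>m. \<forall>k. \<bar>\<Sum>i<k. f (m + i) (x (m + i))\<bar> < e"
proof -
  define A where "A m n = {x. \<exists>k\<le>n. e \<le> \<bar>\<Sum>i<k. f (m + i) (x (m + i))\<bar>}" for m n
  have A_sets: "A m n \<in> sets B" for m n
  proof -
    have "depends_on_first (m + n) (\<lambda>x. x \<in> A m n)"
      unfolding depends_on_first_def A_def mem_Collect_eq
    proof (intro allI impI)
      fix x y :: "nat \<Rightarrow> 'a" assume xy: "\<forall>i<m + n. x i = y i"
      have "(\<Sum>i<k. f (m + i) (x (m + i))) = (\<Sum>i<k. f (m + i) (y (m + i)))" if "k \<le> n" for k
        using xy that by (intro sum.cong) auto
      then show "(\<exists>k\<le>n. e \<le> \<bar>\<Sum>i<k. f (m + i) (x (m + i))\<bar>) = (\<exists>k\<le>n. e \<le> \<bar>\<Sum>i<k. f (m + i) (y (m + i))\<bar>)"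
        by (intro ex_cong1 conj_cong refl) simp
    qed
    then show ?thesis unfolding sets_B by (rule borel_set_depends_on_first)
  qed
  have summable_shift: "summable (\<lambda>i. c (m + i))" for m
    using summable_ignore_initial_segment[OF summable_c, of m] by (simp add: add.commute)
  have A_le: "measure B (\<Union>n. A m n) \<le> (\<Sum>i. c (m + i)) / e\<^sup>2" for m
  proof (rule LIMSEQ_le_const2)
    show "(\<lambda>n. measure B (A m n)) \<longlonglongrightarrow> measure B (\<Union>n. A m n)"
    proof (rule finite_Lim_measure_incseq)
      show "incseq (A m)" unfolding incseq_def A_def by (auto intro: order_trans)
    qed (use A_sets in auto)
    have "measure B (A m n) \<le> (\<Sum>i. c (m + i)) / e\<^sup>2" for n
    proof -
      have "measure B (A m n) \<le> (\<Sum>i<n. c (m + i)) / e\<^sup>2"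
        unfolding A_def by (rule kolmogorov_inequality[OF assms])
      also have "\<dots> \<le> (\<Sum>i. c (m + i)) / e\<^sup>2"
        by (intro divide_right_mono sum_le_suminf summable_shift) (auto simp: c_nonneg)
      finally show ?thesis .
    qed
    then show "\<exists>N. \<forall>n\<ge>N. measure B (A m n) \<le> (\<Sum>i. c (m + i)) / e\<^sup>2" by blast
  qed
  define N where "N = (\<Inter>m. \<Union>n. A m n)"
  have N_sets: "N \<in> sets B" unfolding N_def using A_sets by auto
  have "measure B N \<le> 0"
  proof (rule LIMSEQ_le_const)
    have "(\<lambda>m. (\<Sum>i. c (i + m)) / e\<^sup>2) \<longlonglongrightarrow> 0 / e\<^sup>2"
    proof (intro tendsto_divide tendsto_const)
      have "(\<lambda>m. suminf c - (\<Sum>i<m. c i)) \<longlonglongrightarrow> suminf c - suminf c"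
        by (intro tendsto_diff tendsto_const summable_LIMSEQ summable_c)
      then show "(\<lambda>m. \<Sum>i. c (i + m)) \<longlonglongrightarrow> 0" by (simp add: suminf_minus_initial_segment[OF summable_c])
    qed (use assms in simp)
    then show "(\<lambda>m. (\<Sum>i. c (m + i)) / e\<^sup>2) \<longlonglongrightarrow> 0" by (simp add: add.commute)
    have "measure B N \<le> (\<Sum>i. c (m + i)) / e\<^sup>2" for m
      using A_sets by (intro order_trans[OF finite_measure_mono A_le]) (auto simp: N_def)
    then show "\<exists>K. \<forall>m\<ge>K. measure B N \<le> (\<Sum>i. c (m + i)) / e\<^sup>2" by blast
  qed
  then have "emeasure B N = 0" using measure_nonneg[of B N] by (simp add: emeasure_eq_measure)
  then show ?thesis
  proof (rule AE_I[rotated])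
    show "{x \<in> space B. \<not> (\<exists>m. \<forall>k. \<bar>\<Sum>i<k. f (m + i) (x (m + i))\<bar> < e)} \<subseteq> N"
    proof
      fix x assume "x \<in> {x \<in> space B. \<not> (\<exists>m. \<forall>k. \<bar>\<Sum>i<k. f (m + i) (x (m + i))\<bar> < e)}"
      then have *: "\<exists>k. e \<le> \<bar>\<Sum>i<k. f (m + i) (x (m + i))\<bar>" for m by (simp add: not_less)
      have "x \<in> (\<Union>n. A m n)" for m
      proof -
        obtain k where "e \<le> \<bar>\<Sum>i<k. f (m + i) (x (m + i))\<bar>" using * by blast
        then have "x \<in> A m k" unfolding A_def by blast
        then show ?thesis by blast
      qed
      then show "x \<in> N" by (simp only: N_def INT_I)
    qed
  qed (rule N_sets)
qed

text \<open>The smallness statement is used for the countably many levels \<open>1 / Suc j\<close>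
  at once, which yields the Cauchy criterion outside one null set.\<close>

theorem AE_summable: "AE x in B. summable (\<lambda>i. f i (x i))"
proof -
  have "AE x in B. \<forall>j. \<exists>m. \<forall>k. \<bar>\<Sum>i<k. f (m + i) (x (m + i))\<bar> < 1 / real (Suc j)"
    unfolding AE_all_countable by (intro allI AE_eventually_small) simp
  then show ?thesis
  proof eventually_elim
    case (elim x)
    show ?case
      unfolding summable_Cauchy
    proof (intro allI impI)
      fix e :: real assume "e > 0"
      \<comment> \<open>Half of \<open>e\<close>, because a block sum is the difference of two
        partial sums that both start at \<open>M\<close>.\<close>
      then obtain j where j: "inverse (real (Suc j)) < e / 2" using reals_Archimedean[of "e / 2"] by auto
      obtain M where M: "\<And>k. \<bar>\<Sum>i<k. f (M + i) (x (M + i))\<bar> < 1 / real (Suc j)" using elim by blast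
      have "norm (\<Sum>i\<in>{m..<n}. f i (x i)) < e" if m: "m \<ge> M" for m n
      proof (cases "m \<le> n")
        case True
        have eq: "(\<Sum>i\<in>{M..<l}. f i (x i)) = (\<Sum>i<l - M. f (M + i) (x (M + i)))" for l
          by (rule sum.reindex_bij_witness[of _ "\<lambda>i. M + i" "\<lambda>i. i - M"]) auto
        have "(\<Sum>i\<in>{M..<n}. f i (x i)) = (\<Sum>i\<in>{M..<m}. f i (x i)) + (\<Sum>i\<in>{m..<n}. f i (x i))"
          by (rule sum.atLeastLessThan_concat[symmetric]) (use m True in auto)
        then have "(\<Sum>i\<in>{m..<n}. f i (x i)) = (\<Sum>i<n - M. f (M + i) (x (M + i))) - (\<Sum>i<m - M. f (M + i) (x (M + i)))"
          by (simp add: eq)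
        then show ?thesis
          using M[of "n - M"] M[of "m - M"] j unfolding real_norm_def inverse_eq_divide by linarith
      qed (use \<open>e > 0\<close> in simp)
      then show "\<exists>N. \<forall>m\<ge>N. \<forall>n. norm (\<Sum>i\<in>{m..<n}. f i (x i)) < e" by blast
    qed
  qed
qed

end

section \<open>Equilibrium and eigenfunction\<close>

text \<open>If \<open>u\<close> has infinite integral, the positive part of the integrand is still
  bounded by \<open>\<bar>c\<bar> + C\<close>, so its negative part must have infinite integral and
  the formula reads -\<infinity> on both sides. Otherwise everything is integrable and linearity
  applies.\<close>

lemma ext_integral_const_minus_plus:
  fixes u d :: "'x \<Rightarrow> real"
  assumes "prob_space m" and u [measurable]: "u \<in> borel_measurable m" and d [measurable]: "d \<in> borel_measurable m"
    and u_nonneg: "\<And>x. 0 \<le> u x" and d_bounded: "\<And>x. \<bar>d x\<bar> \<le> C" and d_zero: "(\<integral>x. d x \<partial>m) = 0"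
  shows "ext_integral m (\<lambda>x. c - u x + d x) = ereal c - enn2ereal (\<integral>\<^sup>+x. ennreal (u x) \<partial>m)"
proof -
  interpret prob_space m by fact
  have int_d: "integrable m d" using d_bounded by (intro integrable_const_bound[of _ C]) auto
  show ?thesis
  proof (cases "(\<integral>\<^sup>+x. ennreal (u x) \<partial>m) = \<infinity>")
    case False
    then have int_u: "integrable m u" by (intro integrableI_nonneg) (auto simp: u_nonneg less_top)
    have int: "integrable m (\<lambda>x. c - u x + d x)"
      by (intro Bochner_Integration.integrable_add Bochner_Integration.integrable_diff int_u int_d integrable_const)
    have fin: "(\<integral>\<^sup>+x. ennreal (c - u x + d x) \<partial>m) \<noteq> \<infinity>" "(\<integral>\<^sup>+x. ennreal (- (c - u x + d x)) \<partial>m) \<noteq> \<infinity>"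
      using int by (simp_all add: real_integrable_def)
    obtain a where a: "(\<integral>\<^sup>+x. ennreal (c - u x + d x) \<partial>m) = ennreal a" "a \<ge> 0"
      using fin(1) by (cases "\<integral>\<^sup>+x. ennreal (c - u x + d x) \<partial>m" rule: ennreal_cases) auto
    obtain b where b: "(\<integral>\<^sup>+x. ennreal (- (c - u x + d x)) \<partial>m) = ennreal b" "b \<ge> 0"
      using fin(2) by (cases "\<integral>\<^sup>+x. ennreal (- (c - u x + d x)) \<partial>m" rule: ennreal_cases) auto
    note ab = a b
    have "(\<integral>x. c - u x + d x \<partial>m) = c - (\<integral>x. u x \<partial>m)"
      using int_u int_d by (simp add: d_zero prob_space)
    moreover have "(\<integral>x. c - u x + d x \<partial>m) = a - b"
      unfolding real_lebesgue_integral_def[OF int] ab using ab by simp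
    moreover have "(\<integral>\<^sup>+x. ennreal (u x) \<partial>m) = ennreal (\<integral>x. u x \<partial>m)"
      by (rule nn_integral_eq_integral[OF int_u]) (simp add: u_nonneg)
    moreover have "0 \<le> (\<integral>x. u x \<partial>m)" by (rule Bochner_Integration.integral_nonneg[OF u_nonneg])
    ultimately show ?thesis
      unfolding ext_integral_def ab using ab by (simp add: enn2ereal_ennreal)
  next
    case True
    have "(\<integral>\<^sup>+x. ennreal (c - u x + d x) \<partial>m) \<le> (\<integral>\<^sup>+x. ennreal (\<bar>c\<bar> + C) \<partial>m)"
    proof (intro nn_integral_mono ennreal_leI)
      show "c - u x + d x \<le> \<bar>c\<bar> + C" for x using u_nonneg[of x] d_bounded[of x] by linarith
    qed
    also have "\<dots> < \<infinity>" by (simp add: emeasure_space_1)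
    finally have 1: "(\<integral>\<^sup>+x. ennreal (c - u x + d x) \<partial>m) < \<infinity>" .
    have "\<infinity> = (\<integral>\<^sup>+x. ennreal (u x) \<partial>m)" using True by simp
    also have "\<dots> \<le> (\<integral>\<^sup>+x. ennreal (- (c - u x + d x)) + ennreal (\<bar>c\<bar> + C) \<partial>m)"
    proof (intro nn_integral_mono)
      fix x
      have "0 \<le> \<bar>c\<bar> + C" using d_bounded[of x] by linarith
      moreover have "u x \<le> max 0 (- (c - u x + d x)) + (\<bar>c\<bar> + C)" using d_bounded[of x] by linarith
      ultimately have "ennreal (u x) \<le> ennreal (max 0 (- (c - u x + d x))) + ennreal (\<bar>c\<bar> + C)"
        unfolding ennreal_plus[OF max.cobounded1 \<open>0 \<le> \<bar>c\<bar> + C\<close>, symmetric] by (intro ennreal_leI)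
      then show "ennreal (u x) \<le> ennreal (- (c - u x + d x)) + ennreal (\<bar>c\<bar> + C)"
        by (simp only: ennreal_max_0)
    qed
    also have "\<dots> = (\<integral>\<^sup>+x. ennreal (- (c - u x + d x)) \<partial>m) + ennreal (\<bar>c\<bar> + C)"
      by (subst nn_integral_add) (auto simp: emeasure_space_1)
    finally have 2: "(\<integral>\<^sup>+x. ennreal (- (c - u x + d x)) \<partial>m) = \<infinity>"
      by (simp add: top_unique)
    obtain a where a: "(\<integral>\<^sup>+x. ennreal (c - u x + d x) \<partial>m) = ennreal a" "a \<ge> 0"
      using 1 by (cases "\<integral>\<^sup>+x. ennreal (c - u x + d x) \<partial>m" rule: ennreal_cases) auto
    show ?thesis
      unfolding ext_integral_def 2 True a(1) by (simp add: enn2ereal_ennreal a(2))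
  qed
qed

lemma bernoulli_integral_coord_finite:
  fixes p :: "'a::{countable, discrete_topology} \<Rightarrow> real" and f :: "'a \<Rightarrow> real"
  assumes "(p has_sum 1) UNIV" "\<And>a. p a \<ge> 0" and fin: "finite (UNIV :: 'a set)"
  shows "(\<integral>x. f (x 0) \<partial>bernoulli_measure p) = (\<Sum>a\<in>UNIV. f a * p a)"
proof -
  interpret B: product_weights "\<lambda>_. p" using assms(1,2) by unfold_locales auto
  interpret BP: prob_space B.P by (rule B.prob_space_product_type_measure)
  have sets_B: "sets B.P = sets borel"
    by (simp add: B.sets_product_type_measure sets_PiM_count_space_eq_borel)
  have cyl: "cylinder w \<in> sets B.P" for w unfolding sets_B by (intro borel_open open_cylinder)
  have meas: "measure B.P (cylinder [a]) = p a" for a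
    using B.emeasure_cylinder[of "[a]"] assms(2) by (simp add: measure_def)
  have eq: "f (x 0) = (\<Sum>a\<in>UNIV. f a * indicator (cylinder [a]) x)" for x :: "nat \<Rightarrow> 'a"
  proof -
    have "(\<Sum>a\<in>UNIV. f a * indicator (cylinder [a]) x) = (\<Sum>a\<in>{x 0}. f a * indicator (cylinder [a]) x)"
      using fin by (intro sum.mono_neutral_right) (auto simp: cylinder_def)
    then show ?thesis by (simp add: cylinder_def)
  qed
  have "(\<integral>x. f (x 0) \<partial>B.P) = (\<integral>x. (\<Sum>a\<in>UNIV. f a * indicator (cylinder [a]) x) \<partial>B.P)"
    by (simp only: eq)
  also have "\<dots> = (\<Sum>a\<in>UNIV. \<integral>x. f a * indicator (cylinder [a]) x \<partial>B.P)"
    using cyl by (intro Bochner_Integration.integral_sum integrable_mult_right integrable_real_indicator) (auto simp: less_top[symmetric])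
  also have "\<dots> = (\<Sum>a\<in>UNIV. f a * p a)" by (simp add: meas)
  finally show ?thesis by (simp add: bernoulli_measure_def)
qed

section \<open>The variational identity and the equilibrium state\<close>

context product_potential
begin

lemma weight_inf_pos: "weight_inf a > 0"
  by (simp add: weight_inf_def pprod_inf_pos Z_inf_pos)

lemma weight_inf_le_1: "weight_inf a \<le> 1"
  using wt_inf.weight_has_sum weight_inf_pos by (intro weights_le_1) (auto intro: order_less_imp_le)

text \<open>The transfer weight of a letter is its probability, whatever the point behind it, so
  prepending reproduces the product measure.\<close>

theorem ruelle_dual_bernoulli:
  "ruelle_dual (\<lambda>x. ln (weight_inf (x 0))) (bernoulli_measure weight_inf) = bernoulli_measure weight_inf"
proof (rule ruelle_dual_eqI)
  interpret prob_space wt_inf.P by (rule wt_inf.prob_space_product_type_measure)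
  show "finite_measure (bernoulli_measure weight_inf)" "finite_measure (bernoulli_measure weight_inf)"
    unfolding bernoulli_measure_def by (rule finite_measure_axioms)+
  show sets: "sets (bernoulli_measure weight_inf) = sets borel" "sets (bernoulli_measure weight_inf) = sets borel"
    by (simp_all add: bernoulli_measure_def wt_inf.sets_product_type_measure sets_PiM_count_space_eq_borel)
  show "(\<lambda>x. ln (weight_inf (x 0))) \<in> borel_measurable (borel :: (nat \<Rightarrow> 'a) measure)"
    by (rule measurable_of_coord[of "\<lambda>a. ln (weight_inf a)"])
  show "(\<lambda>a. exp (ln (weight_inf (case_nat a x 0)))) summable_on UNIV" for x :: "nat \<Rightarrow> 'a"
    using wt_inf.weight_has_sum by (auto simp: weight_inf_pos summable_on_def)
  show "emeasure (bernoulli_measure weight_inf) (cylinder (a # w)) =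
      (\<integral>\<^sup>+x. indicator (cylinder w) x * ennreal (exp (ln (weight_inf (case_nat a x 0)))) \<partial>bernoulli_measure weight_inf)" for a w
  proof -
    have cyl: "cylinder w \<in> sets wt_inf.P"
      using sets(1) by (simp add: bernoulli_measure_def borel_open open_cylinder)
    have "(\<integral>\<^sup>+x. indicator (cylinder w) x * ennreal (exp (ln (weight_inf (case_nat a x 0)))) \<partial>wt_inf.P) =
        emeasure wt_inf.P (cylinder w) * ennreal (weight_inf a)"
      using cyl by (simp add: weight_inf_pos nn_integral_multc)
    also have "\<dots> = emeasure wt_inf.P (cylinder (a # w))"
      by (simp add: wt_inf.emeasure_cylinder prod.lessThan_Suc_shift ennreal_mult[symmetric] prod_nonneg wt_inf.weight_nonneg mult.commute del: prod.lessThan_Suc)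
    finally show ?thesis by (simp add: bernoulli_measure_def)
  qed
qed

text \<open>
  The potential \<open>ln pot\<close> differs from the one-site potential \<open>ln lam + ln weight_inf (x 0)\<close> by a bounded function
  that has mean zero for every invariant measure.
\<close>

definition drift :: "(nat \<Rightarrow> 'a) \<Rightarrow> real" where
  "drift x = (\<Sum>j. ln (G (Suc j) (x (Suc j)))) - (\<Sum>j. ln (G (Suc j) (x 0)))"

lemma ln_pot_eq_drift: "ln (pot x) = ln lam - (- ln (weight_inf (x 0))) + drift x"
proof -
  have "ln (pot x) = ln g0 + (ln (G 0 (x 0)) + (\<Sum>j. ln (G (Suc j) (x (Suc j)))))"
    using suminf_ln_G_split[of x 0] by (simp add: ln_pot)
  moreover have "ln (pprod_inf (x 0)) = ln (G 0 (x 0)) + (\<Sum>j. ln (G (Suc j) (x 0)))"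
    using suminf_ln_G_split[of "\<lambda>_. x 0" 0] by (simp add: ln_pprod_inf)
  moreover have "ln (weight_inf (x 0)) = ln (pprod_inf (x 0)) - ln Z_inf"
    unfolding weight_inf_def using pprod_inf_pos Z_inf_pos by (rule ln_divide_pos)
  moreover have "ln lam = ln g0 + ln Z_inf" using g0_pos Z_inf_pos by (rule ln_mult_pos)
  ultimately show ?thesis by (simp add: drift_def)
qed

lemma abs_drift_le: "\<bar>drift x\<bar> \<le> 2 * tail 0"
  using abs_suminf_ln_G_tail[of 0 "\<lambda>j. x (Suc j)"] abs_suminf_ln_G_tail[of 0 "\<lambda>_. x 0"]
  by (simp add: drift_def)

lemma measurable_drift: "drift \<in> borel_measurable borel"
  unfolding drift_def[abs_def] by measurable

text \<open>Invariance gives \<open>x (Suc j)\<close> and \<open>x 0\<close> the same law, so the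
  two series cancel term by term after integration; the summable \<open>bound\<close> justifies
  integrating termwise.\<close>

lemma integral_drift:
  assumes "m \<in> invariant_probabilities"
  shows "(\<integral>x. drift x \<partial>m) = 0"
proof -
  interpret m: measure_preserving_map m shift_map by (rule measure_preserving_shift[OF assms])
  have sets: "sets m = sets borel" using assms by (simp add: invariant_probabilities_def)
  note [measurable_cong] = sets
  have int: "integrable m (\<lambda>x. ln (G (Suc j) (x i)))" for i j
    using abs_ln_G_le_bound by (intro m.integrable_const_bound[of _ "bound j"]) auto
  have norm_le: "(\<integral>x. norm (ln (G (Suc j) (x i))) \<partial>m) \<le> bound j" for i j
  proof -
    have "(\<integral>x. norm (ln (G (Suc j) (x i))) \<partial>m) \<le> (\<integral>x. bound j \<partial>m)"
      using abs_ln_G_le_bound by (intro integral_mono integrable_norm int) auto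
    then show ?thesis by (simp add: m.prob_space)
  qed
  have b: "summable bound" using summable_bound[of 0] by simp
  \<comment> \<open>The index map \<open>i\<close> treats both series of \<open>drift\<close>
    together: \<open>Suc\<close> for the first, the constant 0 for the second.\<close>
  have "summable (\<lambda>j. norm (ln (G (Suc j) (x (i j)))))" for x and i :: "nat \<Rightarrow> nat"
    by (rule summable_comparison_test'[OF b, of 0]) (simp add: abs_ln_G_le_bound)
  then have summable_norm: "AE x in m. summable (\<lambda>j. norm (ln (G (Suc j) (x (i j)))))" for i
    by (rule AE_I2)
  have summable_int: "summable (\<lambda>j. \<integral>x. norm (ln (G (Suc j) (x (i j)))) \<partial>m)" for i
  proof (rule summable_comparison_test'[OF b, of 0])
    show "norm (\<integral>x. norm (ln (G (Suc j) (x (i j)))) \<partial>m) \<le> bound j" for j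
      using norm_le[of j "i j"] Bochner_Integration.integral_nonneg[of m "\<lambda>x. norm (ln (G (Suc j) (x (i j))))"]
      by (simp only: real_norm_def abs_of_nonneg abs_ge_zero)
  qed
  have sums: "(\<integral>x. (\<Sum>j. ln (G (Suc j) (x (i j)))) \<partial>m) = (\<Sum>j. \<integral>x. ln (G (Suc j) (x (i j))) \<partial>m)" for i
    by (rule integral_suminf[OF int summable_norm summable_int])
  have int_sum: "integrable m (\<lambda>x. \<Sum>j. ln (G (Suc j) (x (i j))))" for i
    by (rule integrable_suminf[OF int summable_norm summable_int])
  have "(\<integral>x. ln (G (Suc j) (x i)) \<partial>m) = (\<integral>x. ln (G (Suc j) (x 0)) \<partial>m)" for i j
    using m.integral_S_pow[of "\<lambda>x. ln (G (Suc j) (x 0))" i] by (simp add: funpow_shift_map)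
  then have eq: "(\<integral>x. ln (G (Suc j) (x (Suc j))) \<partial>m) = (\<integral>x. ln (G (Suc j) (x 0)) \<partial>m)" for j .
  have "(\<integral>x. drift x \<partial>m) = (\<integral>x. (\<Sum>j. ln (G (Suc j) (x (Suc j)))) \<partial>m) - (\<integral>x. (\<Sum>j. ln (G (Suc j) (x 0))) \<partial>m)"
    unfolding drift_def
    by (rule Bochner_Integration.integral_diff[OF int_sum[of Suc] int_sum[of "\<lambda>_. 0"]])
  also have "\<dots> = 0"
    unfolding sums[of Suc] sums[of "\<lambda>_. 0"] eq by simp
  finally show ?thesis .
qed

lemma ext_integral_ln_pot:
  assumes m: "m \<in> invariant_probabilities"
  shows "ext_integral m (\<lambda>x. ln (pot x)) = ereal (ln lam) - enn2ereal (\<integral>\<^sup>+x. ennreal (- ln (weight_inf (x 0))) \<partial>m)"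
proof -
  have sets: "sets m = sets borel" using m by (simp add: invariant_probabilities_def)
  have "(\<lambda>x. - ln (weight_inf (x 0))) \<in> borel_measurable (borel :: (nat \<Rightarrow> 'a) measure)"
    by (rule measurable_of_coord[of "\<lambda>a. - ln (weight_inf a)"])
  then show ?thesis
    unfolding ln_pot_eq_drift using m measurable_drift abs_drift_le integral_drift[OF m] weight_inf_pos weight_inf_le_1
    by (intro ext_integral_const_minus_plus[where C = "2 * tail 0"])
      (simp_all add: invariant_probabilities_def measurable_cong_sets[OF sets refl])
qed

lemma weight_inf_invariant: "bernoulli_measure weight_inf \<in> invariant_probabilities"
  using wt_inf.weight_has_sum wt_inf.weight_nonneg by (rule bernoulli_invariant)

lemma ks_entropy_weight_inf:
  "ks_entropy (bernoulli_measure weight_inf) shift_map =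
    enn2ereal (\<integral>\<^sup>+x. ennreal (- ln (weight_inf (x 0))) \<partial>bernoulli_measure weight_inf)"
  by (intro antisym ks_entropy_le ks_entropy_bernoulli_ge weight_inf_invariant wt_inf.weight_has_sum weight_inf_pos)

text \<open>Entropy and integral are \<open>I\<close> and \<open>ln lam - I\<close> for the same
  \<open>I\<close>. Since \<open>ln lam\<close> is finite, \<open>ln lam - (ln lam - I) = I\<close>
  survives \<open>I = \<infinity>\<close>, unlike the sum of the two terms.\<close>

lemma ks_entropy_eq_pressure_minus:
  "ks_entropy (bernoulli_measure weight_inf) shift_map =
    ereal (ln lam) - ext_integral (bernoulli_measure weight_inf) (\<lambda>x. ln (pot x))"
  unfolding ks_entropy_weight_inf ext_integral_ln_pot[OF weight_inf_invariant]
  by (cases "\<integral>\<^sup>+x. ennreal (- ln (weight_inf (x 0))) \<partial>bernoulli_measure weight_inf" rule: ennreal_cases)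
    (simp_all add: enn2ereal_ennreal)

lemma pressure_eq_entropy_plus_integral:
  assumes "ks_entropy (bernoulli_measure weight_inf) shift_map \<noteq> \<infinity> \<or>
    ext_integral (bernoulli_measure weight_inf) (\<lambda>x. ln (pot x)) \<noteq> - \<infinity>"
  shows "ereal (ln lam) = ks_entropy (bernoulli_measure weight_inf) shift_map +
    ext_integral (bernoulli_measure weight_inf) (\<lambda>x. ln (pot x))"
  using assms unfolding ks_entropy_weight_inf ext_integral_ln_pot[OF weight_inf_invariant]
  by (cases "\<integral>\<^sup>+x. ennreal (- ln (weight_inf (x 0))) \<partial>bernoulli_measure weight_inf" rule: ennreal_cases)
    (simp_all add: enn2ereal_ennreal)

text \<open>With \<open>p = weight_inf\<close> in \<open>ks_entropy_le\<close>, the integral that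
  bounds the entropy is the one subtracted in \<open>ext_integral_ln_pot\<close>, so
  \<open>ln lam\<close> bounds the functional at every invariant measure. A finite alphabet makes
  that integral finite, so that it may be cancelled.\<close>

lemma equilibrium_state_bernoulli:
  assumes fin: "finite (UNIV :: 'a set)"
  shows "equilibrium_state (\<lambda>x. ln (pot x)) (bernoulli_measure weight_inf)"
proof -
  have finite_N: "(\<integral>\<^sup>+x. ennreal (- ln (weight_inf (x 0))) \<partial>m) < \<infinity>" if "m \<in> invariant_probabilities" for m
  proof -
    interpret prob_space m using that by (simp add: invariant_probabilities_def)
    have "bdd_above (range (\<lambda>a. - ln (weight_inf a)))"
      by (intro bdd_above_finite finite_imageI fin)
    then obtain C where C: "\<And>a. - ln (weight_inf a) \<le> C" by (auto simp: bdd_above_def)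
    have "(\<integral>\<^sup>+x. ennreal (- ln (weight_inf (x 0))) \<partial>m) \<le> (\<integral>\<^sup>+x. ennreal C \<partial>m)"
      by (intro nn_integral_mono ennreal_leI C)
    also have "\<dots> < \<infinity>" by (simp add: emeasure_space_1)
    finally show ?thesis .
  qed
  have le: "ks_entropy m shift_map + ext_integral m (\<lambda>x. ln (pot x)) \<le> ereal (ln lam)"
    if m: "m \<in> invariant_probabilities" for m
  proof -
    obtain r where r: "(\<integral>\<^sup>+x. ennreal (- ln (weight_inf (x 0))) \<partial>m) = ennreal r" "r \<ge> 0"
      using finite_N[OF m] by (cases "\<integral>\<^sup>+x. ennreal (- ln (weight_inf (x 0))) \<partial>m" rule: ennreal_cases) auto
    have "ks_entropy m shift_map \<le> ereal r"
      using ks_entropy_le[OF m wt_inf.weight_has_sum weight_inf_pos] r by (simp add: enn2ereal_ennreal)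
    then have "ks_entropy m shift_map + (ereal (ln lam) - ereal r) \<le> ereal r + (ereal (ln lam) - ereal r)"
      by (rule add_right_mono)
    then show ?thesis unfolding ext_integral_ln_pot[OF m] r(1) by (simp add: enn2ereal_ennreal r(2))
  qed
  have "ks_entropy (bernoulli_measure weight_inf) shift_map \<noteq> \<infinity>"
    using finite_N[OF weight_inf_invariant] unfolding ks_entropy_weight_inf
    by (cases "\<integral>\<^sup>+x. ennreal (- ln (weight_inf (x 0))) \<partial>bernoulli_measure weight_inf" rule: ennreal_cases)
      (auto simp: enn2ereal_ennreal)
  then have eq: "ks_entropy (bernoulli_measure weight_inf) shift_map +
      ext_integral (bernoulli_measure weight_inf) (\<lambda>x. ln (pot x)) = ereal (ln lam)"
    by (intro pressure_eq_entropy_plus_integral[symmetric] disjI1)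
  have "(SUP m\<in>invariant_probabilities. ks_entropy m shift_map + ext_integral m (\<lambda>x. ln (pot x))) = ereal (ln lam)"
    using weight_inf_invariant eq by (intro antisym SUP_least le) (auto intro: SUP_upper2)
  then show ?thesis
    using eq weight_inf_invariant by (simp add: equilibrium_state_def)
qed

section \<open>The eigenfunction of part (2), through the logarithms of its factors\<close>

definition ln_density :: "nat \<Rightarrow> 'a \<Rightarrow> real" where
  "ln_density i a = (\<Sum>j. ln (G (Suc (j + i)) a))"

lemma prodinf_G_offset: "(\<Prod>k. G (i + 1 + k) a) = exp (ln_density i a)"
  using prodinf_exp[OF summable_ln_G_tail[of i "\<lambda>_. a"]] by (simp add: ln_density_def G_pos add.commute)

text \<open>\<open>convergent_prod\<close> asks for a nonzero limit, so for positive factors it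
  corresponds exactly to convergence of the series of logarithms.\<close>

lemma convergent_density_iff:
  "convergent_prod (\<lambda>i. exp (ln_density i (x i))) \<longleftrightarrow> summable (\<lambda>i. ln_density i (x i))"
  using summable_ln_real[of "\<lambda>i. exp (ln_density i (x i))"] convergent_prod_exp[of "\<lambda>i. ln_density i (x i)"] by auto

lemma ln_density_Suc: "ln_density (Suc i) a = ln_density i a - ln (G (Suc i) a)"
  using suminf_split_head[OF summable_ln_G_tail[of i "\<lambda>_. a"]] by (simp add: ln_density_def)

lemma ln_density_0: "ln (pprod_inf a) = ln (G 0 a) + ln_density 0 a"
  using suminf_ln_G_split[of "\<lambda>_. a" 0] by (simp add: ln_density_def ln_pprod_inf)

text \<open>In a preimage of \<open>x\<close> the coordinate \<open>x i\<close> meets factor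
  \<open>Suc i\<close> instead of \<open>i\<close> and thereby loses
  \<open>ln (G (Suc i) (x i))\<close>. These losses form a convergent series, so convergence at
  \<open>x\<close> passes to all its preimages.\<close>

lemma
  assumes "summable (\<lambda>i. ln_density i (x i))"
  shows summable_ln_density_case_nat: "summable (\<lambda>i. ln_density i (case_nat a x i))"
    and suminf_ln_density_case_nat: "(\<Sum>i. ln_density i (case_nat a x i)) =
      ln_density 0 a + (\<Sum>i. ln_density i (x i)) - (\<Sum>i. ln (G (Suc i) (x i)))"
proof -
  have G: "summable (\<lambda>i. ln (G (Suc i) (x i)))" using summable_ln_G_tail[of 0 x] by simp
  have s: "(\<lambda>i. ln_density (Suc i) (x i)) sums ((\<Sum>i. ln_density i (x i)) - (\<Sum>i. ln (G (Suc i) (x i))))"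
    unfolding ln_density_Suc by (intro sums_diff summable_sums assms G)
  then have "summable (\<lambda>i. ln_density (Suc i) (case_nat a x (Suc i)))" by (simp add: summable_def exI)
  then show 1: "summable (\<lambda>i. ln_density i (case_nat a x i))"
    by (subst (asm) summable_Suc_iff)
  show "(\<Sum>i. ln_density i (case_nat a x i)) =
      ln_density 0 a + (\<Sum>i. ln_density i (x i)) - (\<Sum>i. ln (G (Suc i) (x i)))"
    using suminf_split_head[OF 1] sums_unique[OF s] by simp
qed

text \<open>What the density loses at a preimage is exactly what the potential supplies there. Each
  summand becomes \<open>g0 * pprod_inf a\<close> times the density at \<open>x\<close>, and only
  the sum over the letter \<open>a\<close> is left.\<close>

lemma ruelle_density:
  assumes x: "summable (\<lambda>i. ln_density i (x i))"
  shows "ruelle (\<lambda>x. ln (pot x)) (\<lambda>x. \<Prod>i. exp (ln_density i (x i))) x = lam * (\<Prod>i. exp (ln_density i (x i)))"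
proof -
  let ?h = "\<lambda>x. \<Prod>i. exp (ln_density i (x i))"
  have "?h (case_nat a x) * exp (ln (pot (case_nat a x))) = (g0 * ?h x) * pprod_inf a" for a
  proof -
    have h1: "?h (case_nat a x) = exp (ln_density 0 a + (\<Sum>i. ln_density i (x i)) - (\<Sum>i. ln (G (Suc i) (x i))))"
      using prodinf_exp[OF summable_ln_density_case_nat[OF x, of a]] suminf_ln_density_case_nat[OF x, of a] by simp
    have h2: "?h x = exp (\<Sum>i. ln_density i (x i))" by (rule prodinf_exp[OF x])
    have h3: "pprod_inf a = G 0 a * exp (ln_density 0 a)"
      using ln_density_0[of a] pprod_inf_pos[of a] G_pos[of 0 a] by (metis exp_add exp_ln)
    have h4: "exp (ln (pot (case_nat a x))) = g0 * G 0 a * exp (\<Sum>i. ln (G (Suc i) (x i)))"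
      by (simp only: exp_ln_pot) (rule pot_case_nat)
    show ?thesis unfolding h1 h2 h3 h4 by (simp add: exp_add exp_diff)
  qed
  then have "ruelle (\<lambda>x. ln (pot x)) ?h x = (\<Sum>\<^sub>\<infinity>a. (g0 * ?h x) * pprod_inf a)"
    unfolding ruelle_eq by (simp only:)
  also have "\<dots> = (g0 * ?h x) * Z_inf" unfolding Z_inf_def by (rule infsum_cmult_right')
  finally show ?thesis by simp
qed

lemma AE_summable_ln_density:
  assumes bal: "balanced G" and fin: "finite (UNIV :: 'a set)" and k: "k \<ge> 1"
    and s: "summable (\<lambda>i. SUP a. (\<Sum>j. ln (G (k + i + j) a))\<^sup>2)"
  shows "AE x in bernoulli_measure (\<lambda>_. 1 / real CARD('a)). summable (\<lambda>i. ln_density i (x i))"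
proof -
  have card: "real CARD('a) > 0" using fin by (simp add: card_gt_0_iff)
  have p_sum: "((\<lambda>_::'a. 1 / real CARD('a)) has_sum 1) UNIV"
    using has_sum_finite[OF fin, of "\<lambda>_. 1 / real CARD('a)"] card by simp
  have p_nonneg: "0 \<le> 1 / real CARD('a)" by simp
  note int = bernoulli_integral_coord_finite[OF p_sum p_nonneg fin]
  define c where "c i = (SUP a. (ln_density i a)\<^sup>2)" for i
  have c: "(ln_density i a)\<^sup>2 \<le> c i" for i a
    unfolding c_def using fin by (intro cSUP_upper bdd_above_finite) auto
  \<comment> \<open>\<open>ln_density i\<close> starts with factor \<open>G (Suc i)\<close>, so the
    hypothesis from factor \<open>k\<close> on concerns \<open>ln_density\<close> from index
    \<open>k - 1\<close> on; finitely many earlier terms do not affect summability.\<close>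
  have "Suc (j + (i + (k - 1))) = k + i + j" for i j using k by simp
  then have "summable (\<lambda>i. c (i + (k - 1)))" using s by (simp only: c_def ln_density_def)
  then have summable_c: "summable c" by (subst (asm) summable_iff_shift)
  interpret centred_bernoulli_sums "\<lambda>_. 1 / real CARD('a)" ln_density c
  proof
    show "\<exists>C. \<forall>a. \<bar>ln_density i a\<bar> \<le> C" for i
      unfolding ln_density_def using abs_suminf_ln_G_tail[of i "\<lambda>_. _"] by (intro exI[of _ "tail i"] allI)
    show "(\<integral>x. ln_density i (x 0) \<partial>bernoulli_measure (\<lambda>_. 1 / real CARD('a))) = 0" for i
    proof -
      have 1: "(\<Sum>a\<in>UNIV. ln_density i a) = (\<Sum>j. \<Sum>a\<in>UNIV. ln (G (Suc (j + i)) a))"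
        unfolding ln_density_def by (rule suminf_sum[symmetric]) (rule summable_ln_G_tail)
      have 2: "(\<Sum>a\<in>UNIV. ln (G (Suc (j + i)) a)) = 0" for j
      proof -
        have "ln (\<Prod>a\<in>UNIV. G (Suc (j + i)) a) = (\<Sum>a\<in>UNIV. ln (G (Suc (j + i)) a))"
          using fin by (intro ln_prod) (simp_all add: less_imp_neq[OF G_pos, THEN not_sym])
        then show ?thesis using bal by (simp add: balanced_def)
      qed
      show ?thesis by (simp add: int sum_divide_distrib[symmetric] 1 2)
    qed
    show "(\<integral>x. (ln_density i (x 0))\<^sup>2 \<partial>bernoulli_measure (\<lambda>_. 1 / real CARD('a))) \<le> c i" for i
    proof -
      have "(\<integral>x. (ln_density i (x 0))\<^sup>2 \<partial>bernoulli_measure (\<lambda>_. 1 / real CARD('a))) = (\<Sum>a\<in>UNIV. (ln_density i a)\<^sup>2 * (1 / real CARD('a)))"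
        by (rule int)
      also have "\<dots> \<le> (\<Sum>a\<in>(UNIV :: 'a set). c i * (1 / real CARD('a)))"
        by (intro sum_mono mult_right_mono c) simp
      finally show ?thesis using card by simp
    qed
  qed (use p_sum summable_c in auto)
  show ?thesis by (rule AE_summable)
qed

end

theorem theorem4p2:
  fixes g :: "(nat \<Rightarrow> 'a::{countable, discrete_topology}) \<Rightarrow> real"
    and g0 lam :: real
    and G weight :: "nat \<Rightarrow> 'a \<Rightarrow> real"
    and gt :: "(nat \<Rightarrow> 'a) \<Rightarrow> real"
    and weightt :: "'a \<Rightarrow> real"
    and \<mu> \<mu>t :: "(nat \<Rightarrow> 'a) measure"
    and H :: "nat \<Rightarrow> 'a \<Rightarrow> real"
    and h :: "(nat \<Rightarrow> 'a) \<Rightarrow> real"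
  assumes "product_type g g0 G" and "l1_bounded G" and "summable_potential G"
    and "lam = g0 * (\<Sum>\<^sub>\<infinity>a. \<Prod>k. G k a)"
    and "\<And>x. gt x = (\<Prod>i. G i (x 0)) / (\<Sum>\<^sub>\<infinity>a. \<Prod>i. G i a)"
    and "\<And>n a. weight n a = (\<Prod>i\<le>n. G i a) / (\<Sum>\<^sub>\<infinity>b. \<Prod>i\<le>n. G i b)"
    and "\<And>a. weightt a = (\<Prod>i. G i a) / (\<Sum>\<^sub>\<infinity>b. \<Prod>i. G i b)"
    and "\<mu> = product_type_measure weight"
    and "\<mu>t = bernoulli_measure weightt"
    and "\<And>i a. H i a = (\<Prod>k. G (i + 1 + k) a)"
    and "\<And>x. h x = (\<Prod>i. H i (x i))"
  shows
    "(\<comment> \<open>part (1)\<close>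
      ruelle_dual (\<lambda>x. ln (g x)) \<mu> = scale_measure (ennreal lam) \<mu> \<and>
      ruelle_dual (\<lambda>x. ln (gt x)) \<mu>t = \<mu>t \<and>
      convergent (pressure_seq (\<lambda>x. ln (g x))) \<and>
      ereal (ln lam) = pressure (\<lambda>x. ln (g x)) \<and>
      \<comment> \<open>the sum is undefined only if it is of the form \<infinity> - \<infinity>, which can occur
        for infinite alphabets; the rearranged identity is then still meaningful\<close>
      (ks_entropy \<mu>t shift_map \<noteq> \<infinity> \<or> ext_integral \<mu>t (\<lambda>x. ln (g x)) \<noteq> - \<infinity> \<longrightarrow>
        pressure (\<lambda>x. ln (g x)) = ks_entropy \<mu>t shift_map + ext_integral \<mu>t (\<lambda>x. ln (g x))) \<and>
      ks_entropy \<mu>t shift_map = pressure (\<lambda>x. ln (g x)) - ext_integral \<mu>t (\<lambda>x. ln (g x)) \<and>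
      (finite (UNIV :: 'a set) \<longrightarrow> equilibrium_state (\<lambda>x. ln (g x)) \<mu>t)) \<and>
     (\<comment> \<open>part (2); the identity for h holds wherever the product defining h converges\<close>
      balanced G \<and> finite (UNIV :: 'a set) \<and>
      (\<exists>k\<ge>1. summable (\<lambda>i. SUP a. (\<Sum>j. ln (G (k + i + j) a))\<^sup>2)) \<longrightarrow>
        (AE x in bernoulli_measure (\<lambda>_. 1 / real CARD('a)). convergent_prod (\<lambda>i. H i (x i))) \<and>
        (\<forall>x. convergent_prod (\<lambda>i. H i (x i)) \<longrightarrow>
           (\<forall>y. shift_map y = x \<longrightarrow> convergent_prod (\<lambda>i. H i (y i))) \<and>
           ruelle (\<lambda>x. ln (g x)) h x = lam * h x))"
proof -
  interpret product_potential g0 G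
    using assms(1-3) by unfold_locales (simp_all add: product_type_def)
  have g: "g = pot" using assms(1) by (simp add: product_type_def pot_def fun_eq_iff)
  have lam: "lam = g0 * Z_inf" using assms(4) by (simp add: Z_inf_def pprod_inf_def)
  have gt: "gt = (\<lambda>x. weight_inf (x 0))"
    using assms(5) by (simp add: fun_eq_iff weight_inf_def pprod_inf_def Z_inf_def)
  have w: "weight = product_potential.weight G"
    using assms(6) by (simp add: fun_eq_iff weight_def pprod_def Z_def)
  have wt: "weightt = weight_inf"
    using assms(7) by (simp add: fun_eq_iff weight_inf_def pprod_inf_def Z_inf_def)
  have \<mu>: "\<mu> = product_type_measure (product_potential.weight G)" using assms(8) w by simp
  have \<mu>t: "\<mu>t = bernoulli_measure weight_inf" using assms(9) wt by simp
  have H: "H i a = exp (ln_density i a)" for i a using assms(10) prodinf_G_offset by simp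
  have h: "h = (\<lambda>x. \<Prod>i. exp (ln_density i (x i)))" using assms(11) by (simp add: fun_eq_iff H)
  have conv: "convergent (pressure_seq (\<lambda>x. ln (g x)))"
    unfolding g using pressure_seq_tendsto by (auto simp: convergent_def)
  have pressure: "pressure (\<lambda>x. ln (g x)) = ereal (ln lam)"
    unfolding g lam pressure_def using pressure_seq_tendsto by (rule limI)
  show ?thesis
  proof (intro conjI impI allI)
    show "ruelle_dual (\<lambda>x. ln (g x)) \<mu> = scale_measure (ennreal lam) \<mu>"
      unfolding g \<mu> lam by (rule ruelle_dual_product_type_measure)
    show "ruelle_dual (\<lambda>x. ln (gt x)) \<mu>t = \<mu>t"
      unfolding gt \<mu>t by (rule ruelle_dual_bernoulli)
    show "convergent (pressure_seq (\<lambda>x. ln (g x)))" by (rule conv)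
    show "ereal (ln lam) = pressure (\<lambda>x. ln (g x))" by (simp only: pressure)
    show "pressure (\<lambda>x. ln (g x)) = ks_entropy \<mu>t shift_map + ext_integral \<mu>t (\<lambda>x. ln (g x))"
      if "ks_entropy \<mu>t shift_map \<noteq> \<infinity> \<or> ext_integral \<mu>t (\<lambda>x. ln (g x)) \<noteq> - \<infinity>"
      using that unfolding pressure unfolding lam g \<mu>t by (rule pressure_eq_entropy_plus_integral)
    show "ks_entropy \<mu>t shift_map = pressure (\<lambda>x. ln (g x)) - ext_integral \<mu>t (\<lambda>x. ln (g x))"
      unfolding pressure unfolding lam g \<mu>t by (rule ks_entropy_eq_pressure_minus)
    show "equilibrium_state (\<lambda>x. ln (g x)) \<mu>t" if "finite (UNIV :: 'a set)"
      using that unfolding g \<mu>t by (rule equilibrium_state_bernoulli)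
  next
    assume "balanced G \<and> finite (UNIV :: 'a set) \<and>
      (\<exists>k\<ge>1. summable (\<lambda>i. SUP a. (\<Sum>j. ln (G (k + i + j) a))\<^sup>2))"
    then obtain k where "balanced G" "finite (UNIV :: 'a set)" "k \<ge> 1"
        "summable (\<lambda>i. SUP a. (\<Sum>j. ln (G (k + i + j) a))\<^sup>2)" by blast
    from AE_summable_ln_density[OF this]
    show "AE x in bernoulli_measure (\<lambda>_. 1 / real CARD('a)). convergent_prod (\<lambda>i. H i (x i))"
      by (simp only: H convergent_density_iff)
  next
    fix x y assume "convergent_prod (\<lambda>i. H i (x i))" "shift_map y = x"
    then have x: "summable (\<lambda>i. ln_density i (x i))" and "y \<in> {y. shift_map y = x}"
      unfolding H convergent_density_iff by simp_all
    then obtain a where "y = case_nat a x"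
      unfolding shift_map_fibre by blast
    then show "convergent_prod (\<lambda>i. H i (y i))"
      unfolding H convergent_density_iff by (simp only: summable_ln_density_case_nat[OF x])
  next
    fix x assume "convergent_prod (\<lambda>i. H i (x i))"
    then show "ruelle (\<lambda>x. ln (g x)) h x = lam * h x"
      unfolding H convergent_density_iff g h lam by (rule ruelle_density)
  qed
qed

end
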